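(* Let $(\Gamma,\mu)$ be an infinite, connected, locally finite weighted graph satisfying (COUNT), (VD), (HOM) and (P0), and suppose that its heat kernel $p_n$ satisfies the sub-Gaussian bounds (UE) and (LE) with escape time exponent $\gamma>1$ (all conditions are spelled out in the context). Let $\phi:[0,\infty)\to[1,\infty)$ be a continuous regularly varying function of positive index, and let $K$ be a Markov operator on $\Gamma$, symmetric with respect to $\mu$, satisfying $(J_\phi)$. Then the following are equivalent: (a) $K$ has finite $\gamma$-moment, that is, $M_{\gamma,K}<\infty$. (b) There exists a constant $C>0$ such that $$\frac{C^{-1}}{V(n^{1/\gamma})}\le\psi_K(n)\le\frac{C}{V(n^{1/\gamma})}\qquad\text{for all } n\in\mathbb{N}=\{0,1,2,\dots\}.$$
   Context: Weighted graph: $\Gamma$ is the vertex set of an infinite, connected, locally finite graph, with a symmetric non-negative weight $\mu_{xy}$ on $\Gamma\times\Gamma$ such that $\mu_{xy}>0$ iff $x\sim y$ ($x,y$ are neighbors). Put $\mu(x)=\sum_{y\sim x}\mu_{xy}$ and $\mu(A)=\sum_{x\in A}\mu(x)$. Let $d$ be the graph distance, $B(x,r)=\{y: d(x,y)\le r\}$ and $V_\mu(x,r)=\mu(B(x,r))$. (COUNT): there is $C_\mu\ge 1$ with $C_\mu^{-1}\le\mu(x)\le C_\mu$ for all $x\in\Gamma$. (VD) and (HOM): there are a strictly increasing continuous function $V:[0,\infty)\to(0,\infty)$ and constants $C_D,C_h>1$ such that $V(2r)\le C_D V(r)$ for all $r>0$ (VD), and $C_h^{-1}V(r)\le V_\mu(x,r)\le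 C_hV(r)$ for all $x\in\Gamma$, $r>0$ (HOM). This $V$ is fixed. Natural random walk: $P(x,y)=\mu_{xy}/\mu(x)$, with $n$-step transition probabilities $P_n(x,y)$ and heat kernel $p_n(x,y)=P_n(x,y)/\mu(y)$. (P0): there is $p_0>0$ such that $P(x,y)\ge p_0$ whenever $x\sim y$. (UE), (LE) with exponent $\gamma>1$: there are constants $c,C>0$ such that for all $x,y\in\Gamma$, $$p_n(x,y)\le\frac{C}{V(n^{1/\gamma})}\exp\Big[-\Big(\frac{d(x,y)^\gamma}{Cn}\Big)^{\frac1{\gamma-1}}\Big]\quad\forall n\ge1,\tag{UE}$$ $$(p_n+p_{n+1})(x,y)\ge\frac{c}{V(n^{1/\gamma})}\exp\Big[-\Big(\frac{d(x,y)^\gamma}{cn}\Big)^{\frac1{\gamma-1}}\Big]\quad\forall n\ge1\vee d(x,y).\tag{LE}$$ Regular variation: a positive measurable function $f$ is regularly varying of index $\beta$ if $\lim_{t\to\infty}f(\lambda t)/f(t)=\lambda^\beta$ for every $\lambda>0$. $(J_\phi)$: $K$ is a Markov operator $Kf(x)=\sum_y k(x,y)f(y)\mu(y)$ with symmetric kernel $k(x,y)=k(y,x)\ge0$, $\sum_y k(x,y)\mu(y)=1$, and there is a constant $C_\phi>0$ with $$\frac{C_\phi^{-1}}{V(d(x,y))\phi(d(x,y))}\le k(x,y)\le\frac{C_\phi}{V(d(x,y))\phi(d(x,y))}\quad\forall x,y\in\Gamma.$$ $k_n(x,y)$ denotes the kernel of $K^n$ with respect to $\mu$, i.e. $K^nf(x)=\sum_y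 k_n(x,y)f(y)\mu(y)$. $\psi_K(n):=\sup_{x\in\Gamma}k_{2n}(x,x)=\sup_{x,y\in\Gamma}k_{2n}(x,y)=\|K^{2n}\|_{1\to\infty}=\|K^n\|_{1\to2}^2$ (norms between the spaces $\ell^p(\Gamma,\mu)$). Moments: for $r>0$, $M_{r,K}:=\sup_{x\in\Gamma}\mathbb{E}^x d(X_0,X_1)^r=\sup_{x\in\Gamma}\sum_{y\in\Gamma}d(x,y)^r\,k(x,y)\mu(y)$, where $(X_n)$ is the Markov chain with transition probabilities $k(x,y)\mu(y)$. *)

theory Defs
  imports "HOL-Analysis.Analysis"
begin

section \<open>Weighted graphs\<close>

text \<open>
  The vertex set is the whole type \<open>'v\<close>; \<open>E\<close> is the (symmetric) neighbour relation, and loops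
  are not excluded.  Symmetry of \<open>E\<close> follows from that of \<open>\<mu>\<close>.
\<close>

locale weighted_graph =
  fixes E :: "'v rel" and \<mu> :: "'v \<Rightarrow> 'v \<Rightarrow> real"
  assumes infinite_vertices: "infinite (UNIV :: 'v set)"
    and weight_sym: "\<mu> x y = \<mu> y x"
    and weight_nonneg: "\<mu> x y \<ge> 0"
    and weight_pos_iff: "\<mu> x y > 0 \<longleftrightarrow> (x, y) \<in> E"
    and locally_finite: "finite (E `` {x})"
    and connected: "(x, y) \<in> E\<^sup>*"

definition vertex_weight :: "'v rel \<Rightarrow> ('v \<Rightarrow> 'v \<Rightarrow> real) \<Rightarrow> 'v \<Rightarrow> real" where
  "vertex_weight E \<mu> x = (\<Sum>y\<in>E `` {x}. \<mu> x y)"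

definition graph_dist :: "'v rel \<Rightarrow> 'v \<Rightarrow> 'v \<Rightarrow> nat" where
  "graph_dist E x y = (LEAST n. (x, y) \<in> E ^^ n)"

definition graph_ball :: "'v rel \<Rightarrow> 'v \<Rightarrow> real \<Rightarrow> 'v set" where
  "graph_ball E x r = {y. real (graph_dist E x y) \<le> r}"

text \<open>In a weighted graph balls are finite (lemma \<open>finite_graph_ball\<close>), so a finite sum suffices.\<close>

definition volume :: "'v rel \<Rightarrow> ('v \<Rightarrow> 'v \<Rightarrow> real) \<Rightarrow> 'v \<Rightarrow> real \<Rightarrow> real" where
  "volume E \<mu> x r = (\<Sum>y\<in>graph_ball E x r. vertex_weight E \<mu> y)"

lemma (in weighted_graph) finite_graph_ball: "finite (graph_ball E x r)"
proof -
  have fin: "finite ((E ^^ n) `` {x})" for n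
  proof (induction n)
    case (Suc n)
    have "(E ^^ Suc n) `` {x} = (\<Union>z\<in>(E ^^ n) `` {x}. E `` {z})" by auto
    then show ?case using Suc locally_finite by simp
  qed simp
  have "graph_ball E x r \<subseteq> (\<Union>n\<in>{..nat \<lfloor>r\<rfloor>}. (E ^^ n) `` {x})"
  proof
    fix y assume y: "y \<in> graph_ball E x r"
    obtain n where "(x, y) \<in> E ^^ n"
      using connected rtrancl_imp_relpow by blast
    then have "(x, y) \<in> E ^^ graph_dist E x y"
      unfolding graph_dist_def by (rule LeastI)
    moreover have "graph_dist E x y \<le> nat \<lfloor>r\<rfloor>"
      using y by (simp add: graph_ball_def le_nat_floor)
    ultimately show "y \<in> (\<Union>n\<in>{..nat \<lfloor>r\<rfloor>}. (E ^^ n) `` {x})" by blast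
  qed
  then show ?thesis
    by (rule finite_subset) (use fin in blast)
qed

definition COUNT :: "'v rel \<Rightarrow> ('v \<Rightarrow> 'v \<Rightarrow> real) \<Rightarrow> bool" where
  "COUNT E \<mu> \<longleftrightarrow> (\<exists>C\<ge>1. \<forall>x. inverse C \<le> vertex_weight E \<mu> x \<and> vertex_weight E \<mu> x \<le> C)"

definition volume_scale :: "(real \<Rightarrow> real) \<Rightarrow> bool" where
  "volume_scale V \<longleftrightarrow> continuous_on {0..} V \<and> strict_mono_on {0..} V \<and> (\<forall>r\<ge>0. V r > 0)"

definition VD :: "(real \<Rightarrow> real) \<Rightarrow> bool" where
  "VD V \<longleftrightarrow> (\<exists>C>1. \<forall>r>0. V (2 * r) \<le> C * V r)"

definition HOM :: "'v rel \<Rightarrow> ('v \<Rightarrow> 'v \<Rightarrow> real) \<Rightarrow> (real \<Rightarrow> real) \<Rightarrow> bool" where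
  "HOM E \<mu> V \<longleftrightarrow> (\<exists>C>1. \<forall>x. \<forall>r>0. inverse C * V r \<le> volume E \<mu> x r \<and> volume E \<mu> x r \<le> C * V r)"


section \<open>The natural random walk\<close>

definition trans_prob :: "'v rel \<Rightarrow> ('v \<Rightarrow> 'v \<Rightarrow> real) \<Rightarrow> 'v \<Rightarrow> 'v \<Rightarrow> real" where
  "trans_prob E \<mu> x y = \<mu> x y / vertex_weight E \<mu> x"

primrec trans_prob_n :: "'v rel \<Rightarrow> ('v \<Rightarrow> 'v \<Rightarrow> real) \<Rightarrow> nat \<Rightarrow> 'v \<Rightarrow> 'v \<Rightarrow> real" where
  "trans_prob_n E \<mu> 0 x y = (if x = y then 1 else 0)"
| "trans_prob_n E \<mu> (Suc n) x y = (\<Sum>z\<in>E `` {x}. trans_prob E \<mu> x z * trans_prob_n E \<mu> n z y)"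

definition heat_kernel :: "'v rel \<Rightarrow> ('v \<Rightarrow> 'v \<Rightarrow> real) \<Rightarrow> nat \<Rightarrow> 'v \<Rightarrow> 'v \<Rightarrow> real" where
  "heat_kernel E \<mu> n x y = trans_prob_n E \<mu> n x y / vertex_weight E \<mu> y"

definition P0 :: "'v rel \<Rightarrow> ('v \<Rightarrow> 'v \<Rightarrow> real) \<Rightarrow> bool" where
  "P0 E \<mu> \<longleftrightarrow> (\<exists>p>0. \<forall>x y. (x, y) \<in> E \<longrightarrow> trans_prob E \<mu> x y \<ge> p)"

definition sub_gaussian :: "'v rel \<Rightarrow> (real \<Rightarrow> real) \<Rightarrow> real \<Rightarrow> real \<Rightarrow> nat \<Rightarrow> 'v \<Rightarrow> 'v \<Rightarrow> real" where
  "sub_gaussian E V \<gamma> C n x y =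
     C / V (real n powr (1 / \<gamma>)) *
       exp (- ((real (graph_dist E x y) powr \<gamma> / (C * real n)) powr (1 / (\<gamma> - 1))))"

definition UE :: "'v rel \<Rightarrow> ('v \<Rightarrow> 'v \<Rightarrow> real) \<Rightarrow> (real \<Rightarrow> real) \<Rightarrow> real \<Rightarrow> bool" where
  "UE E \<mu> V \<gamma> \<longleftrightarrow> (\<exists>C>0. \<forall>x y. \<forall>n\<ge>1. heat_kernel E \<mu> n x y \<le> sub_gaussian E V \<gamma> C n x y)"

definition LE :: "'v rel \<Rightarrow> ('v \<Rightarrow> 'v \<Rightarrow> real) \<Rightarrow> (real \<Rightarrow> real) \<Rightarrow> real \<Rightarrow> bool" where
  "LE E \<mu> V \<gamma> \<longleftrightarrow> (\<exists>c>0. \<forall>x y. \<forall>n\<ge>max 1 (graph_dist E x y).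
     heat_kernel E \<mu> n x y + heat_kernel E \<mu> (Suc n) x y \<ge> sub_gaussian E V \<gamma> c n x y)"


section \<open>Regular variation\<close>

definition regularly_varying :: "(real \<Rightarrow> real) \<Rightarrow> real \<Rightarrow> bool" where
  "regularly_varying f \<beta> \<longleftrightarrow>
     f \<in> borel_measurable (restrict_space borel {0..}) \<and> (\<forall>t\<ge>0. f t > 0) \<and>
     (\<forall>s>0. ((\<lambda>t. f (s * t) / f t) \<longlongrightarrow> s powr \<beta>) at_top)"


section \<open>Symmetric Markov operators\<close>

text \<open>
  In this section \<open>m\<close> is the measure on the vertices (later \<open>vertex_weight E \<mu>\<close>) and \<open>k\<close> is the
  kernel of the operator with respect to \<open>m\<close>.
\<close>

definition symmetric_markov_kernel :: "('v \<Rightarrow> real) \<Rightarrow> ('v \<Rightarrow> 'v \<Rightarrow> real) \<Rightarrow> bool" where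
  "symmetric_markov_kernel m k \<longleftrightarrow>
     (\<forall>x y. k x y = k y x) \<and> (\<forall>x y. k x y \<ge> 0) \<and> (\<forall>x. ((\<lambda>y. k x y * m y) has_sum 1) UNIV)"

definition markov_op :: "('v \<Rightarrow> real) \<Rightarrow> ('v \<Rightarrow> 'v \<Rightarrow> real) \<Rightarrow> ('v \<Rightarrow> real) \<Rightarrow> 'v \<Rightarrow> real" where
  "markov_op m k f x = (\<Sum>\<^sub>\<infinity>y. k x y * f y * m y)"

text \<open>
  The kernel of the \<open>n\<close>-th power of the operator; lemma \<open>markov_op_power\<close> shows that it is indeed
  the kernel of \<open>markov_op m k ^^ n\<close> with respect to \<open>m\<close>.
\<close>

primrec iter_kernel :: "('v \<Rightarrow> real) \<Rightarrow> ('v \<Rightarrow> 'v \<Rightarrow> real) \<Rightarrow> nat \<Rightarrow> 'v \<Rightarrow> 'v \<Rightarrow> real" where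
  "iter_kernel m k 0 x y = (if x = y then 1 / m y else 0)"
| "iter_kernel m k (Suc n) x y = (\<Sum>\<^sub>\<infinity>z. k x z * iter_kernel m k n z y * m z)"

lemma iter_kernel_0_op:
  assumes m: "\<And>x. m x > 0"
  shows "((\<lambda>y. iter_kernel m k 0 x y * f y * m y) has_sum f x) UNIV"
proof -
  have "((\<lambda>y. iter_kernel m k 0 x y * f y * m y) has_sum f x) {x}"
    using m[of x] by (simp add: has_sum_finite_iff)
  then show ?thesis
    by (subst has_sum_cong_neutral[where T = "{x}"]) auto
qed

lemma iter_kernel_has_sum:
  fixes k :: "'v \<Rightarrow> 'v \<Rightarrow> real"
  assumes K: "symmetric_markov_kernel m k" and m: "\<And>x. m x > 0" and f: "\<And>x. \<bar>f x\<bar> \<le> B"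
  shows "(\<forall>x y. iter_kernel m k n x y \<ge> 0) \<and>
    (\<forall>x. ((\<lambda>y. iter_kernel m k n x y * m y) has_sum 1) UNIV) \<and>
    (\<forall>x. ((\<lambda>y. iter_kernel m k n x y * f y * m y) has_sum (markov_op m k ^^ n) f x) UNIV) \<and>
    (\<forall>x. \<bar>(markov_op m k ^^ n) f x\<bar> \<le> B)"
proof (induction n)
  case 0
  show ?case
    using iter_kernel_0_op[OF m, where k = k and f = "\<lambda>_. 1"] iter_kernel_0_op[OF m, where k = k and f = f] m f
    by (auto simp: less_imp_le)
next
  case (Suc n)
  let ?q = "iter_kernel m k n" and ?g = "(markov_op m k ^^ n) f"
  have k0: "k x y \<ge> 0" and k1: "((\<lambda>y. k x y * m y) has_sum 1) UNIV" for x y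
    using K by (auto simp: symmetric_markov_kernel_def)
  have q0: "?q x y \<ge> 0" and q1: "((\<lambda>y. ?q x y * m y) has_sum 1) UNIV"
    and qf: "((\<lambda>y. ?q x y * f y * m y) has_sum ?g x) UNIV" and gB: "\<bar>?g x\<bar> \<le> B" for x y
    using Suc by auto
  have B0: "B \<ge> 0" using f[of undefined] by linarith
  have m0: "m x \<ge> 0" for x using m[of x] by simp
  have *: "((\<lambda>y. iter_kernel m k (Suc n) x y * h y * m y) has_sum markov_op m k g' x) UNIV"
    if h: "\<And>y. \<bar>h y\<bar> \<le> D" and g': "\<And>z. ((\<lambda>y. ?q z y * h y * m y) has_sum g' z) UNIV"
      and D0: "D \<ge> 0" for x h D g'
  proof -
    let ?F = "\<lambda>z y. k x z * m z * (?q z y * h y * m y)"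
    let ?G = "\<lambda>z y. D * (k x z * m z * (?q z y * m y))"
    have "((\<lambda>y. ?G z y) has_sum D * (k x z * m z * 1)) UNIV" for z
      by (intro has_sum_cmult_right q1)
    moreover have "(\<lambda>z. D * (k x z * m z * 1)) summable_on UNIV"
      using has_sum_cmult_right[OF k1[of x], of D] by (auto simp: summable_on_def)
    ultimately have G: "(\<lambda>(z, y). ?G z y) summable_on (UNIV \<times> UNIV)"
      by (intro summable_on_SigmaI[where g = "\<lambda>z. D * (k x z * m z * 1)"])
         (auto intro!: mult_nonneg_nonneg k0 q0 m0 D0)
    have le: "\<bar>?F z y\<bar> \<le> ?G z y" for z y
    proof -
      have "\<bar>?F z y\<bar> = k x z * m z * (?q z y * m y) * \<bar>h y\<bar>"
        by (simp add: abs_mult k0 q0 m0 mult_ac)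
      also have "\<dots> \<le> k x z * m z * (?q z y * m y) * D"
        by (intro mult_left_mono h mult_nonneg_nonneg k0 q0 m0)
      finally show ?thesis by (simp add: mult_ac)
    qed
    have F: "(\<lambda>(z, y). ?F z y) summable_on (UNIV \<times> UNIV)"
      by (rule Infinite_Sum.abs_summable_summable, rule Infinite_Sum.abs_summable_on_comparison_test'[OF G]) (use le in auto)
    have inner: "((\<lambda>y. ?F z y) has_sum k x z * m z * g' z) UNIV" for z
      by (intro has_sum_cmult_right g')
    have tot: "((\<lambda>(z, y). ?F z y) has_sum markov_op m k g' x) (UNIV \<times> UNIV)"
    proof -
      have "infsum (\<lambda>(z, y). ?F z y) (UNIV \<times> UNIV) = (\<Sum>\<^sub>\<infinity>z. \<Sum>\<^sub>\<infinity>y. ?F z y)"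
        using infsum_Sigma'_banach[OF F] by simp
      also have "\<dots> = (\<Sum>\<^sub>\<infinity>z. k x z * m z * g' z)"
        by (intro infsum_cong infsumI inner)
      also have "\<dots> = markov_op m k g' x"
        by (simp add: markov_op_def mult_ac)
      finally show ?thesis using has_sum_infsum[OF F] by simp
    qed
    have swap: "((\<lambda>(y, z). ?F z y) has_sum markov_op m k g' x) (UNIV \<times> UNIV)"
      using tot by (subst (asm) has_sum_swap) simp
    have col: "(\<lambda>z. ?F z y) summable_on UNIV" for y
      using summable_on_SigmaD1[of "\<lambda>y z. ?F z y" UNIV "\<lambda>_. UNIV" y] swap
      by (auto simp: summable_on_def)
    have "((\<lambda>z. ?F z y) has_sum iter_kernel m k (Suc n) x y * h y * m y) UNIV" for y
    proof -
      have "(\<Sum>\<^sub>\<infinity>z. ?F z y) = (\<Sum>\<^sub>\<infinity>z. k x z * ?q z y * m z * (h y * m y))"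
        by (simp add: mult_ac)
      also have "\<dots> = (\<Sum>\<^sub>\<infinity>z. k x z * ?q z y * m z) * (h y * m y)"
        by (rule infsum_cmult_left') 
      finally show ?thesis using has_sum_infsum[OF col[of y]] by (simp add: mult_ac)
    qed
    then show ?thesis
      using has_sum_SigmaD[OF swap] by auto
  qed
  have op1: "markov_op m k (\<lambda>_. 1) x = 1" for x
    using infsumI[OF k1[of x]] by (simp add: markov_op_def)
  have bd: "\<bar>markov_op m k ?g x\<bar> \<le> B" for x
  proof -
    have s: "((\<lambda>y. k x y * m y * B) has_sum 1 * B) UNIV"
      by (intro has_sum_cmult_left k1)
    have le: "norm (k x y * ?g y * m y) \<le> k x y * m y * B" for y
      using mult_left_mono[OF gB[of y], of "k x y * m y"] k0 m0
      by (simp add: abs_mult mult_ac)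
    have a: "(\<lambda>y. norm (k x y * ?g y * m y)) summable_on UNIV"
      using s by (intro Infinite_Sum.abs_summable_on_comparison_test'[OF _ le]) (auto simp: summable_on_def)
    have "norm (markov_op m k ?g x) \<le> (\<Sum>\<^sub>\<infinity>y. norm (k x y * ?g y * m y))"
      unfolding markov_op_def[where f = ?g] by (rule Infinite_Sum.norm_infsum_bound[OF a])
    also have "\<dots> \<le> (\<Sum>\<^sub>\<infinity>y. k x y * m y * B)"
      by (rule infsum_mono[OF a]) (use s le in \<open>auto simp: summable_on_def\<close>)
    also have "\<dots> = B" using infsumI[OF s] by simp
    finally show ?thesis by simp
  qed
  show ?case
    using *[of "\<lambda>_. 1" 1 "\<lambda>_. 1"] *[of f B ?g] q1 qf f B0 op1 bd
    by (auto intro!: infsum_nonneg mult_nonneg_nonneg k0 q0 m0)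
qed

lemma markov_op_power:
  assumes "symmetric_markov_kernel m k" and "\<And>x. m x > 0" and "bounded (range f)"
  shows "(markov_op m k ^^ n) f x = (\<Sum>\<^sub>\<infinity>y. iter_kernel m k n x y * f y * m y)"
proof -
  obtain B where "\<And>x. \<bar>f x\<bar> \<le> B"
    using assms(3) by (auto simp: bounded_iff)
  then show ?thesis
    using iter_kernel_has_sum[OF assms(1,2), of f B n] by (metis infsumI)
qed

definition J_bounds :: "'v rel \<Rightarrow> (real \<Rightarrow> real) \<Rightarrow> (real \<Rightarrow> real) \<Rightarrow> ('v \<Rightarrow> 'v \<Rightarrow> real) \<Rightarrow> bool" where
  "J_bounds E V \<phi> k \<longleftrightarrow> (\<exists>C>0. \<forall>x y.
     inverse C / (V (graph_dist E x y) * \<phi> (graph_dist E x y)) \<le> k x y \<and>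
     k x y \<le> C / (V (graph_dist E x y) * \<phi> (graph_dist E x y)))"

text \<open>Extended non-negative values avoid any convention for suprema or sums that are infinite.\<close>

definition psi :: "('v \<Rightarrow> real) \<Rightarrow> ('v \<Rightarrow> 'v \<Rightarrow> real) \<Rightarrow> nat \<Rightarrow> ennreal" where
  "psi m k n = (SUP x. ennreal (iter_kernel m k (2 * n) x x))"

definition moment :: "'v rel \<Rightarrow> ('v \<Rightarrow> real) \<Rightarrow> ('v \<Rightarrow> 'v \<Rightarrow> real) \<Rightarrow> real \<Rightarrow> ennreal" where
  "moment E m k r = (SUP x. \<Sum>\<^sub>\<infinity>y. ennreal (real (graph_dist E x y) powr r * k x y * m y))"

end

theory Submission
  imports Defs
begin

text \<open>
  Put \<open>\<rho>(n) = n powr (1/\<gamma>)\<close> and \<open>b(n) = 1/\<phi>(\<rho>(n))\<close>.  By (HOM), the \<open>\<gamma>\<close>-moment of \<open>K\<close> is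
  comparable to \<open>\<Sum>b(n)\<close>, and by (UE) and (LE) the kernel of \<open>K\<close> is comparable, off the diagonal, to
  the subordinated kernel \<open>\<Sum>(b(n)/n) p\<^sub>n\<close>.  Write \<open>E\<^sub>Q\<close> for the Dirichlet form of \<open>Q\<close>, and
  \<open>S(N)\<close> for the partial sums of \<open>b\<close>.

  Since \<open>n \<mapsto> \<parallel>P\<^sup>n f\<parallel>\<^sup>2\<close> is convex, \<open>E\<^sub>K \<ge> c (S(N)/N) E\<^bsub>P\<^sup>2\<^sup>N\<^esub>\<close> for every \<open>N\<close>; together with the
  diagonal bound for \<open>P\<close> this is a Nash-type inequality, which gives the upper bound on \<open>\<psi>\<^sub>K\<close>, and
  \<open>\<psi>\<^sub>K(n) = o(1/V(\<rho>(n)))\<close> along a sequence when \<open>S\<close> is unbounded.  When \<open>S\<close> is bounded,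
  \<open>E\<^sub>K \<le> C E\<^sub>P\<close>, and a heat kernel of \<open>P\<close> used as a test function gives the lower bound.
  Everything is done without spectral theory, with nonnegative functions and sums in \<open>[0, \<infinity>]\<close>.
\<close>

section \<open>Regular variation and scale functions\<close>

text \<open>Scaling forces the weight b(n)/n. The times n comparable to d^\<gamma> contribute about
  b(n)/(n V(\<rho>(n))) each, hence about 1/(V(d) \<phi>(d)) in total; shorter times are suppressed
  by the sub-Gaussian factor, longer ones by a Potter bound for \<phi>. A comparison off the
  diagonal is enough, because Dirichlet forms ignore the diagonal. The dichotomy is one of speed.
  The return probability of K relaxes to a level of order 1/V(\<rho>(N)) at a rate of at least a
  multiple of S(N)/N. If S is unbounded, then at suitable times t the level is already reached for
  an N that is a large multiple of t; volume grows at least linearly, so this level is much smaller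
  than 1/V(\<rho>(t)). The obstacle is negative spectrum, which neither P nor K excludes. For this
  reason convexity is used along even powers only. Moreover ||f||^2 - ||K f||^2, which drives the
  decay, is governed by K^2 and not by K; the uniform holding probability coming from the lower jump
  bound at distance 0 relates the two.\<close>

lemma baire_locally_bounded:
  fixes g :: "real \<Rightarrow> real"
  assumes cont: "continuous_on UNIV g"
    and lim: "\<And>u. ((\<lambda>x. g (x + u) - g x) \<longlongrightarrow> 0) at_top"
  obtains X a \<delta> where "\<delta> > 0"
    "\<And>x u. x \<ge> X \<Longrightarrow> \<bar>u - a\<bar> \<le> \<delta> \<Longrightarrow> \<bar>g (x + u) - g x\<bar> \<le> 1"
proof -
  \<comment> \<open>Pointwise convergence puts every u into some \<open>A N\<close>, and continuity
    of g makes each \<open>A N\<close> closed. By Baire one of them has interior points, which is a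
    bound uniform over an interval of shifts.\<close>
  define A where "A N = {u. \<forall>x\<ge>real N. \<bar>g (x + u) - g x\<bar> \<le> 1}" for N
  have cl: "closed (A N)" for N
  proof -
    have "A N = (\<Inter>x\<in>{real N..}. {u. \<bar>g (x + u) - g x\<bar> \<le> 1})"
      by (auto simp: A_def)
    moreover have "closed {u. \<bar>g (x + u) - g x\<bar> \<le> 1}" for x
      by (intro closed_Collect_le continuous_intros continuous_on_compose2[OF cont]) auto
    ultimately show ?thesis by auto
  qed
  have cover: "(\<Union>N. A N) = UNIV"
  proof -
    have "\<exists>N. u \<in> A N" for u
    proof -
      have "\<forall>\<^sub>F x in at_top. \<bar>g (x + u) - g x\<bar> < 1"
        using lim[of u] tendstoD[of _ 0 at_top 1] by (force simp: dist_real_def)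
      then obtain X where "\<And>x. x \<ge> X \<Longrightarrow> \<bar>g (x + u) - g x\<bar> < 1"
        by (auto simp: eventually_at_top_linorder)
      moreover obtain N where "real N \<ge> X" using real_arch_simple by blast
      ultimately show ?thesis by (intro exI[of _ N]) (auto simp: A_def intro: less_imp_le order_trans)
    qed
    then show ?thesis by auto
  qed
  have "\<exists>N. interior (A N) \<noteq> {}"
  proof (rule ccontr)
    assume "\<not> ?thesis"
    then have emp: "interior (A N) = {}" for N by auto
    have "(UNIV :: real set) \<subseteq> closure (\<Inter> (range (\<lambda>N. - A N)))"
      by (rule Baire) (use cl emp in \<open>auto simp: closure_complement\<close>)
    moreover have "\<Inter> (range (\<lambda>N. - A N)) = {}" using cover by auto
    ultimately show False by auto
  qed
  then obtain N a where "a \<in> interior (A N)" by auto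
  then obtain \<delta> where "\<delta> > 0" "cball a \<delta> \<subseteq> A N"
    by (auto simp: mem_interior_cball)
  then show thesis
    by (intro that[of \<delta> "real N" a])
       (auto simp: A_def subset_iff dist_real_def abs_minus_commute)
qed

text \<open>The interval of good shifts around a is moved to 0: the increment from x by u is the
  difference of the increments from x - a by a + u and by a. Shifts up to 1 are then reached by n
  steps of length at most \<delta>.\<close>

lemma locally_bounded_increments:
  fixes g :: "real \<Rightarrow> real"
  assumes cont: "continuous_on UNIV g"
    and lim: "\<And>u. ((\<lambda>x. g (x + u) - g x) \<longlongrightarrow> 0) at_top"
  obtains X B where "\<And>x u. x \<ge> X \<Longrightarrow> 0 \<le> u \<Longrightarrow> u \<le> 1 \<Longrightarrow> \<bar>g (x + u) - g x\<bar> \<le> B"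
proof -
  obtain X a \<delta> where \<delta>: "\<delta> > 0"
    and X: "\<And>x u. x \<ge> X \<Longrightarrow> \<bar>u - a\<bar> \<le> \<delta> \<Longrightarrow> \<bar>g (x + u) - g x\<bar> \<le> 1"
    using baire_locally_bounded[OF assms] by metis
  have small: "\<bar>g (x + u) - g x\<bar> \<le> 2" if "x \<ge> X + \<bar>a\<bar>" "0 \<le> u" "u \<le> \<delta>" for x u
  proof -
    have "X \<le> x - a" using that by linarith
    then show ?thesis
      using X[of "x - a" "a + u"] X[of "x - a" a] that \<delta> by (auto simp: abs_le_iff)
  qed
  have steps: "\<bar>g (x + real n * u) - g x\<bar> \<le> 2 * real n" if "x \<ge> X + \<bar>a\<bar>" "0 \<le> u" "u \<le> \<delta>" for x u n
  proof (induction n)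
    case (Suc n)
    have "\<bar>g ((x + real n * u) + u) - g (x + real n * u)\<bar> \<le> 2"
      using that mult_nonneg_nonneg[of "real n" u] by (intro small; linarith)
    then show ?case using Suc by (simp add: algebra_simps)
  qed simp
  obtain n :: nat where n: "real n \<ge> 1 / \<delta>" using real_arch_simple by blast
  have n0: "n > 0" using n \<delta> by (cases n) (auto simp: field_simps)
  show thesis
  proof (rule that[of "X + \<bar>a\<bar>" "2 * real n"])
    fix x u :: real assume x: "x \<ge> X + \<bar>a\<bar>" and u: "0 \<le> u" "u \<le> 1"
    have "u / real n \<le> 1 / real n" using u by (simp add: divide_right_mono)
    also have "\<dots> \<le> \<delta>" using n n0 \<delta> by (simp add: field_simps)
    finally have "u / real n \<le> \<delta>" .
    then show "\<bar>g (x + u) - g x\<bar> \<le> 2 * real n"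
      using steps[of x "u / real n" n] x u n0 by simp
  qed
qed

text \<open>Regular variation gives a limit for each fixed ratio separately, whereas the estimates
  below need one constant for all ratios in [1, 2] and all t \<ge> 1. In the variable x = ln t,
  \<open>g\<close> is the logarithm of \<phi> without its linear trend, so its increments tend to 0
  and the previous lemma applies.\<close>

lemma regularly_varying_comparable:
  assumes cont: "continuous_on {0..} \<phi>" and one: "\<forall>t\<ge>0. \<phi> t \<ge> 1"
    and rv: "regularly_varying \<phi> \<beta>" and \<beta>: "\<beta> > 0"
  obtains A where "A \<ge> 1" "\<And>s t. 1 \<le> t \<Longrightarrow> t \<le> s \<Longrightarrow> s \<le> 2 * t \<Longrightarrow> \<phi> s \<le> A * \<phi> t \<and> \<phi> t \<le> A * \<phi> s"
proof -
  define g where "g x = ln (\<phi> (exp x)) - \<beta> * x" for x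
  have pos: "\<phi> t > 0" if "t \<ge> 0" for t using one that by (smt (verit))
  have "continuous_on UNIV (\<lambda>x. \<phi> (exp x))"
    by (rule continuous_on_compose2[OF cont]) (auto intro!: continuous_intros)
  then have contg: "continuous_on UNIV g"
    unfolding g_def by (intro continuous_intros) (auto simp: pos intro!: less_imp_neq[symmetric] )
  have limg: "((\<lambda>x. g (x + u) - g x) \<longlongrightarrow> 0) at_top" for u
  proof -
    have "((\<lambda>t. \<phi> (exp u * t) / \<phi> t) \<longlongrightarrow> exp u powr \<beta>) at_top"
      using rv by (simp add: regularly_varying_def)
    then have "((\<lambda>x. \<phi> (exp u * exp x) / \<phi> (exp x)) \<longlongrightarrow> exp u powr \<beta>) at_top"
      by (rule filterlim_compose) (rule exp_at_top)
    then have "((\<lambda>x. ln (\<phi> (exp u * exp x) / \<phi> (exp x))) \<longlongrightarrow> ln (exp u powr \<beta>)) at_top"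
      by (rule tendsto_ln) simp
    then have "((\<lambda>x. ln (\<phi> (exp u * exp x) / \<phi> (exp x)) - \<beta> * u) \<longlongrightarrow> ln (exp u powr \<beta>) - \<beta> * u) at_top"
      by (rule tendsto_diff) (rule tendsto_const)
    moreover have "ln (\<phi> (exp u * exp x) / \<phi> (exp x)) - \<beta> * u = g (x + u) - g x" for x
      using pos[of "exp u * exp x"] pos[of "exp x"]
      by (simp add: g_def ln_div exp_add algebra_simps)
    ultimately show ?thesis by (simp add: ln_powr)
  qed
  obtain X B where XB: "\<And>x u. x \<ge> X \<Longrightarrow> 0 \<le> u \<Longrightarrow> u \<le> 1 \<Longrightarrow> \<bar>g (x + u) - g x\<bar> \<le> B"
    using locally_bounded_increments[OF contg limg] by metis
  \<comment> \<open>For t > T the increments of \<open>g\<close> are bounded by B. For t \<le> T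
    both t and s lie in the compact interval [0, 2T], where \<phi> has a bound F; as \<phi> \<ge> 1,
    F also bounds the ratios there.\<close>
  define T where "T = exp (max X 0)"
  have "compact (\<phi> ` {0..2 * T})"
    by (rule compact_continuous_image[OF continuous_on_subset[OF cont]]) auto
  then obtain F where F: "\<And>t. 0 \<le> t \<Longrightarrow> t \<le> 2 * T \<Longrightarrow> \<phi> t \<le> F"
    using bounded_imp_bdd_above[OF compact_imp_bounded] unfolding bdd_above_def by fastforce
  define A where "A = max (max 1 F) (exp (\<beta> + \<bar>B\<bar>))"
  show thesis
  proof (rule that[of A])
    show "A \<ge> 1" by (simp add: A_def)
    fix s t :: real assume st: "1 \<le> t" "t \<le> s" "s \<le> 2 * t"
    have ps: "\<phi> s \<ge> 1" "\<phi> t \<ge> 1" using one st by auto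
    show "\<phi> s \<le> A * \<phi> t \<and> \<phi> t \<le> A * \<phi> s"
    proof (cases "t \<le> T")
      case True
      then have "\<phi> s \<le> F" "\<phi> t \<le> F" using st by (auto intro!: F)
      then have "\<phi> s \<le> A * 1" "\<phi> t \<le> A * 1" by (auto simp: A_def)
      moreover have "A * 1 \<le> A * \<phi> t" "A * 1 \<le> A * \<phi> s"
        by (intro mult_left_mono ps; simp add: A_def)+
      ultimately show ?thesis by linarith
    next
      case False
      define u where "u = ln (s / t)"
      have "ln (s / t) \<le> ln 2" using st by (subst ln_le_cancel_iff) (auto simp: field_simps)
      also have "ln (2::real) \<le> 1" using ln_2_less_1 by simp
      finally have u: "0 \<le> u" "u \<le> 1" using st by (auto simp: u_def)
      have "exp (max X 0) < t" using False by (simp add: T_def)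
      then have "ln (exp (max X 0)) < ln t" using st by (subst ln_less_cancel_iff) auto
      then have "X \<le> ln t" by simp
      note b = XB[OF this u]
      have s: "exp (ln t + u) = s" using st by (simp add: u_def ln_div exp_diff)
      have "\<bar>ln (\<phi> s) - ln (\<phi> t) - \<beta> * u\<bar> \<le> B"
        using b st s by (simp add: g_def algebra_simps)
      moreover have "0 \<le> \<beta> * u" "\<beta> * u \<le> \<beta>" using u \<beta> mult_left_le by auto
      ultimately have c: "ln (\<phi> s) \<le> \<beta> + \<bar>B\<bar> + ln (\<phi> t)" "ln (\<phi> t) \<le> \<beta> + \<bar>B\<bar> + ln (\<phi> s)"
        using \<beta> by linarith+
      have "\<phi> s \<le> exp (\<beta> + \<bar>B\<bar>) * \<phi> t"
        using iffD2[OF exp_le_cancel_iff c(1)] ps unfolding exp_add[of _ "ln _"] by simp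
      moreover have "\<phi> t \<le> exp (\<beta> + \<bar>B\<bar>) * \<phi> s"
        using iffD2[OF exp_le_cancel_iff c(2)] ps unfolding exp_add[of _ "ln _"] by simp
      moreover have "exp (\<beta> + \<bar>B\<bar>) * \<phi> t \<le> A * \<phi> t" "exp (\<beta> + \<bar>B\<bar>) * \<phi> s \<le> A * \<phi> s"
        using ps by (auto intro!: mult_right_mono simp: A_def)
      ultimately show ?thesis by linarith
    qed
  qed
qed

section \<open>Doubling functions: polynomial growth and almost monotonicity\<close>

lemma dyadic_decompose:
  fixes s t :: real
  assumes "1 \<le> t" "t \<le> s"
  obtains i s' where "s = 2 ^ i * s'" "t \<le> s'" "s' \<le> 2 * t"
proof -
  have "\<exists>i. s \<le> 2 ^ i * (2 * t)"
  proof -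
    obtain i where "s < 2 ^ i" using real_arch_pow[of 2 s] by auto
    moreover have "2 ^ i * 1 \<le> 2 ^ i * (2 * t)" using assms by (intro mult_left_mono) auto
    ultimately show ?thesis by (intro exI[of _ i]) linarith
  qed
  define i where "i = (LEAST i. s \<le> 2 ^ i * (2 * t))"
  have i: "s \<le> 2 ^ i * (2 * t)" unfolding i_def by (rule LeastI_ex) fact
  have "2 ^ i * t \<le> s"
  proof (cases i)
    case (Suc j)
    have "\<not> s \<le> 2 ^ j * (2 * t)" using not_less_Least[of j "\<lambda>i. s \<le> 2 ^ i * (2 * t)"] Suc i_def by auto
    then show ?thesis using Suc by simp
  qed (use assms in simp)
  then show thesis using i
    by (intro that[of i "s / 2 ^ i"]) (auto simp: field_simps)
qed

text \<open>Each doubling costs a factor below 2^D. The 2 in \<open>2 * s / t\<close> pays for the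
  fractional step from t to the remainder s' in [t, 2t].\<close>

lemma doubling_polynomial:
  fixes f :: "real \<Rightarrow> real"
  assumes pos: "\<And>t. t \<ge> 1 \<Longrightarrow> f t > 0"
    and dbl: "\<And>s t. 1 \<le> t \<Longrightarrow> t \<le> s \<Longrightarrow> s \<le> 2 * t \<Longrightarrow> f s \<le> A * f t"
  obtains D :: nat where "\<And>s t. 1 \<le> t \<Longrightarrow> t \<le> s \<Longrightarrow> f s \<le> (2 * s / t) ^ D * f t"
proof -
  obtain D where D: "A < 2 ^ D" using real_arch_pow[of 2 A] by auto
  have iter: "f (2 ^ i * t) \<le> (2 ^ i) ^ D * f t" if "t \<ge> 1" for i t
  proof (induction i)
    case (Suc i)
    have t1: "2 ^ i * t \<ge> 1" using that mult_mono[of 1 "2^i" 1 t] by simp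
    then have "f (2 ^ Suc i * t) \<le> A * f (2 ^ i * t)"
      using dbl[of "2 ^ i * t" "2 ^ Suc i * t"] that by simp
    also have "\<dots> \<le> 2 ^ D * f (2 ^ i * t)"
      using D pos[OF t1] by (intro mult_right_mono) auto
    also have "\<dots> \<le> 2 ^ D * ((2 ^ i) ^ D * f t)" by (intro mult_left_mono Suc) auto
    also have "\<dots> = (2 ^ Suc i) ^ D * f t" by (simp add: power_mult_distrib)
    finally show ?case .
  qed simp
  show thesis
  proof (rule that[of D])
    fix s t :: real assume st: "1 \<le> t" "t \<le> s"
    obtain i s' where s: "s = 2 ^ i * s'" "t \<le> s'" "s' \<le> 2 * t"
      using dyadic_decompose[OF st] by metis
    have "f s \<le> (2 ^ i) ^ D * f s'" using iter[of s' i] s st by auto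
    also have "f s' \<le> A * f t" using dbl[of t s'] s st by auto
    also have "A * f t \<le> 2 ^ D * f t" using D pos[OF st(1)] by (intro mult_right_mono) auto
    finally have "f s \<le> (2 ^ i) ^ D * (2 ^ D * f t)" by (simp add: mult_left_mono)
    also have "\<dots> = (2 * 2 ^ i) ^ D * f t" by (simp add: power_mult_distrib)
    also have "\<dots> \<le> (2 * s / t) ^ D * f t"
      using s st pos[OF st(1)] by (intro mult_right_mono power_mono) (auto simp: field_simps)
    finally show "f s \<le> (2 * s / t) ^ D * f t" .
  qed
qed

text \<open>Since t \<ge> 1 and 2^L > T, at most L doublings start below T. Only these can increase
  f, each by at most the factor A; the fractional step from t to s' costs one more A.\<close>

lemma doubling_almost_decreasing:
  fixes f :: "real \<Rightarrow> real"
  assumes pos: "\<And>t. t \<ge> 1 \<Longrightarrow> f t > 0" and A: "A \<ge> 1"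
    and dbl: "\<And>s t. 1 \<le> t \<Longrightarrow> t \<le> s \<Longrightarrow> s \<le> 2 * t \<Longrightarrow> f s \<le> A * f t"
    and dec: "\<And>t. t \<ge> T \<Longrightarrow> f (2 * t) \<le> f t"
  obtains B where "B > 0" "\<And>s t. 1 \<le> t \<Longrightarrow> t \<le> s \<Longrightarrow> f s \<le> B * f t"
proof -
  obtain L where L: "T < 2 ^ L" using real_arch_pow[of 2 T] by auto
  have iter: "f (2 ^ i * t) \<le> A ^ i * f t" if "t \<ge> 1" for i t
  proof (induction i)
    case (Suc i)
    have t1: "2 ^ i * t \<ge> 1" using that mult_mono[of 1 "2^i" 1 t] by simp
    then have "f (2 ^ Suc i * t) \<le> A * f (2 ^ i * t)"
      using dbl[of "2 ^ i * t" "2 ^ Suc i * t"] that by simp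
    also have "\<dots> \<le> A * (A ^ i * f t)" using A by (intro mult_left_mono Suc) auto
    finally show ?case by simp
  qed simp
  have far: "f (2 ^ (L + i) * t) \<le> A ^ L * f t" if "t \<ge> 1" for i t
  proof (induction i)
    case (Suc i)
    have "2 ^ L * 1 * 1 \<le> 2 ^ L * 2 ^ i * t" using that by (intro mult_mono) auto
    then have "T \<le> 2 ^ (L + i) * t" using L unfolding power_add by linarith
    then have "f (2 ^ (L + Suc i) * t) \<le> f (2 ^ (L + i) * t)"
      using dec[of "2 ^ (L + i) * t"] by (simp add: mult.assoc)
    then show ?case using Suc by simp
  qed (use iter that in simp)
  have all: "f (2 ^ i * t) \<le> A ^ L * f t" if "t \<ge> 1" for i t
  proof (cases "i \<le> L")
    case True
    have "A ^ i * f t \<le> A ^ L * f t"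
      using True A pos[OF that] by (intro mult_right_mono power_increasing) auto
    then show ?thesis using iter[OF that, of i] by linarith
  next
    case False
    then show ?thesis using far[OF that, of "i - L"] by simp
  qed
  show thesis
  proof (rule that[of "A ^ L * A"])
    show "A ^ L * A > 0" using A by simp
    fix s t :: real assume st: "1 \<le> t" "t \<le> s"
    obtain i s' where s: "s = 2 ^ i * s'" "t \<le> s'" "s' \<le> 2 * t"
      using dyadic_decompose[OF st] by metis
    have "f s \<le> A ^ L * f s'" using all[of s' i] s st by auto
    also have "\<dots> \<le> A ^ L * (A * f t)" using dbl[of t s'] s st A by (intro mult_left_mono) auto
    finally show "f s \<le> A ^ L * A * f t" by (simp add: mult.assoc)
  qed
qed

text \<open>A Potter bound. Halving the index gives strict slack: doubling t eventually multiplies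
  \<phi> by more than 2^(\<beta>/2), so t^(\<beta>/2)/\<phi>(t) stops increasing under
  doubling.\<close>

lemma regularly_varying_potter_lower:
  assumes cont: "continuous_on {0..} \<phi>" and one: "\<forall>t\<ge>0. \<phi> t \<ge> 1"
    and rv: "regularly_varying \<phi> \<beta>" and \<beta>: "\<beta> > 0"
  obtains B where "B > 0"
    "\<And>s t. 1 \<le> t \<Longrightarrow> t \<le> s \<Longrightarrow> (s / t) powr (\<beta> / 2) * \<phi> t \<le> B * \<phi> s"
proof -
  obtain A where A: "A \<ge> 1"
    and cmp: "\<And>s t. 1 \<le> t \<Longrightarrow> t \<le> s \<Longrightarrow> s \<le> 2 * t \<Longrightarrow> \<phi> s \<le> A * \<phi> t \<and> \<phi> t \<le> A * \<phi> s"
    using regularly_varying_comparable[OF assms] by metis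
  have pos: "\<phi> t > 0" if "t \<ge> 0" for t using one that by (smt (verit))
  define f where "f t = t powr (\<beta> / 2) / \<phi> t" for t
  have "((\<lambda>t. \<phi> (2 * t) / \<phi> t) \<longlongrightarrow> 2 powr \<beta>) at_top"
    using rv by (simp add: regularly_varying_def)
  moreover have "(2::real) powr (\<beta> / 2) < 2 powr \<beta>" using \<beta> by simp
  ultimately have "\<forall>\<^sub>F t in at_top. 2 powr (\<beta> / 2) < \<phi> (2 * t) / \<phi> t"
    by (rule order_tendstoD)
  then obtain T where T: "\<And>t. t \<ge> T \<Longrightarrow> 2 powr (\<beta> / 2) < \<phi> (2 * t) / \<phi> t"
    by (auto simp: eventually_at_top_linorder)
  obtain B where B: "B > 0" "\<And>s t. 1 \<le> t \<Longrightarrow> t \<le> s \<Longrightarrow> f s \<le> B * f t"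
  proof (rule doubling_almost_decreasing[of f "2 powr (\<beta> / 2) * A" "max T 1"])
    show "f t > 0" if "t \<ge> 1" for t using that pos[of t] by (simp add: f_def)
    show "2 powr (\<beta> / 2) * A \<ge> 1"
      using A \<beta> mult_mono[of 1 "2 powr (\<beta> / 2)" 1 A] by (simp add: ge_one_powr_ge_zero)
    show "f s \<le> 2 powr (\<beta> / 2) * A * f t" if st: "1 \<le> t" "t \<le> s" "s \<le> 2 * t" for s t
    proof -
      have p: "s powr (\<beta> / 2) \<le> (2 * t) powr (\<beta> / 2)" using st \<beta> by (intro powr_mono2) auto
      have "\<phi> t \<le> A * \<phi> s" using cmp[OF st] by simp
      then have "1 / \<phi> s \<le> A / \<phi> t" using pos[of s] pos[of t] st by (simp add: field_simps)
      then have "s powr (\<beta> / 2) * (1 / \<phi> s) \<le> (2 * t) powr (\<beta> / 2) * (A / \<phi> t)"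
        using p pos[of s] st by (intro mult_mono) auto
      then show ?thesis using st by (simp add: f_def powr_mult mult_ac)
    qed
    show "f (2 * t) \<le> f t" if "t \<ge> max T 1" for t
    proof -
      have "2 powr (\<beta> / 2) * \<phi> t \<le> \<phi> (2 * t)"
        using T[of t] pos[of t] that by (simp add: field_simps)
      then have "t powr (\<beta> / 2) * (2 powr (\<beta> / 2) * \<phi> t) \<le> t powr (\<beta> / 2) * \<phi> (2 * t)"
        by (intro mult_left_mono) auto
      then show ?thesis using that pos[of t] pos[of "2 * t"]
        by (simp add: f_def powr_mult field_simps)
    qed
  qed metis
  show thesis
  proof (rule that[OF B(1)])
    fix s t :: real assume st: "1 \<le> t" "t \<le> s"
    have "s powr (\<beta> / 2) / \<phi> s \<le> B * (t powr (\<beta> / 2) / \<phi> t)"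
      using B(2)[OF st] by (simp add: f_def)
    then show "(s / t) powr (\<beta> / 2) * \<phi> t \<le> B * \<phi> s"
      using st pos[of s] pos[of t] by (simp add: powr_divide field_simps)
  qed
qed

section \<open>Tails of power sums and stretched exponentials\<close>

lemma powr_tail_sum:
  fixes s :: real
  assumes s: "s > 0"
  obtains C where "C > 0"
    "\<And>X F. X \<ge> 1 \<Longrightarrow> finite F \<Longrightarrow> (\<And>n. n \<in> F \<Longrightarrow> real n \<ge> X) \<Longrightarrow>
       (\<Sum>n\<in>F. real n powr (- 1 - s)) \<le> C * X powr (- s)"
proof -
  \<comment> \<open>The summand is compared with the drop of t^(-s) between n and n + 1. The mean
    value point z satisfies z < n + 1 \<le> 2n, which is the origin of 2^(1 + s).\<close>
  define C where "C = 2 powr (1 + s) / s"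
  have C: "C > 0" using s by (simp add: C_def)
  have step: "real n powr (- 1 - s) \<le> C * (real n powr (- s) - real (Suc n) powr (- s))" if n: "n \<ge> 1" for n
  proof -
    have "\<exists>z. real n < z \<and> z < real (Suc n) \<and>
        real (Suc n) powr (- s) - real n powr (- s) = (real (Suc n) - real n) * (- s * z powr (- s - 1))"
      by (rule MVT2) (use n in \<open>auto intro!: derivative_eq_intros simp: field_simps\<close>)
    then obtain z where z: "real n < z" "z < real n + 1"
      "real n powr (- s) - real (Suc n) powr (- s) = s * z powr (- s - 1)" by auto
    have "real n powr (- 1 - s) = 2 powr (1 + s) * (2 * real n) powr (- 1 - s)"
      using n by (simp add: powr_mult powr_add[symmetric] mult.assoc[symmetric])
    also have "\<dots> \<le> 2 powr (1 + s) * z powr (- 1 - s)"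
      using z n s by (intro mult_left_mono powr_mono2') auto
    also have "\<dots> = C * (s * z powr (- s - 1))" using s by (simp add: C_def minus_diff_commute)
    finally show ?thesis using z by simp
  qed
  show thesis
  proof (rule that[OF C])
    fix X :: real and F :: "nat set"
    assume X: "X \<ge> 1" and F: "finite F" and FX: "\<And>n. n \<in> F \<Longrightarrow> real n \<ge> X"
    define N where "N = nat \<lceil>X\<rceil>"
    have N: "real N \<ge> X" "N \<ge> 1" using X by (auto simp: N_def le_nat_iff) 
    obtain M where M: "F \<subseteq> {..<M}" using F finite_nat_iff_bounded by blast
    have sub: "F \<subseteq> {N..<N + M}" using M FX by (force simp: N_def nat_le_iff ceiling_le_iff)
    have "(\<Sum>n\<in>F. real n powr (- 1 - s)) \<le> (\<Sum>n\<in>{N..<N + M}. real n powr (- 1 - s))"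
      by (rule sum_mono2) (use sub in auto)
    also have "\<dots> \<le> (\<Sum>n\<in>{N..<N + M}. C * (real n powr (- s) - real (Suc n) powr (- s)))"
      by (intro sum_mono step) (use N in auto)
    also have "\<dots> = C * (real N powr (- s) - real (N + M) powr (- s))"
    proof -
      have "(\<Sum>n\<in>{N..<N + M}. real n powr (- s) - real (Suc n) powr (- s)) = real N powr (- s) - real (N + M) powr (- s)"
        by (induction M) auto
      then show ?thesis by (simp only: sum_distrib_left[symmetric])
    qed
    also have "\<dots> \<le> C * (real N powr (- s))" using C by (intro mult_left_mono) auto
    also have "\<dots> \<le> C * X powr (- s)"
      using C N X s by (intro mult_left_mono powr_mono2') auto
    finally show "(\<Sum>n\<in>F. real n powr (- 1 - s)) \<le> C * X powr (- s)" .
  qed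
qed

text \<open>With w = (1/(L r))^p, a single term of the exponential series gives w^j / j! \<le> e^w,
  and j is taken with p j \<ge> n. In the application r is the number of steps divided by
  d^\<gamma>, and the left side is the sub-Gaussian factor.\<close>

lemma exp_neg_powr_bound:
  fixes p :: real
  assumes p: "p > 0" and L: "L > 0"
  obtains C where "C > 0"
    "\<And>r. 0 < r \<Longrightarrow> r \<le> 1 \<Longrightarrow> exp (- ((1 / (L * r)) powr p)) \<le> C * r ^ n"
proof -
  obtain j :: nat where j: "real j \<ge> real n / p" using real_arch_simple by blast
  define C where "C = fact j * L powr (p * real j)"
  show thesis
  proof (rule that[of C])
    show "C > 0" using L by (simp add: C_def)
    fix r :: real assume r: "0 < r" "r \<le> 1"
    define w where "w = (1 / (L * r)) powr p"
    have w: "w > 0" using r L by (simp add: w_def)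
    have "inverse (fact j) * w ^ j \<le> (\<Sum>i. inverse (fact i) * w ^ i)"
      using sum_le_suminf[OF summable_exp[of w], of "{j}"] w by simp
    then have "w ^ j / fact j \<le> exp w"
      by (simp add: exp_def scaleR_conv_of_real divide_inverse mult.commute)
    then have "exp (- w) \<le> fact j / w ^ j"
      using w by (simp add: exp_minus field_simps)
    also have "\<dots> = fact j * (L * r) powr (p * real j)"
      using r L w by (simp add: w_def powr_realpow[symmetric] powr_powr powr_divide)
    also have "\<dots> = C * r powr (p * real j)" using r L by (simp add: C_def powr_mult)
    also have "\<dots> \<le> C * r powr real n"
      using r j p L by (intro mult_left_mono powr_mono') (auto simp: C_def field_simps)
    finally show "exp (- ((1 / (L * r)) powr p)) \<le> C * r ^ n"
      using r by (simp add: w_def powr_realpow)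
  qed
qed


section \<open>Symmetric Markov semigroups\<close>

definition usum :: "('a \<Rightarrow> ennreal) \<Rightarrow> ennreal" where
  "usum f = integral\<^sup>N (count_space UNIV) f"

lemma usum_cmult: "usum (\<lambda>x. c * f x) = c * usum f"
  unfolding usum_def by (rule nn_integral_cmult) simp

lemma usum_multc: "usum (\<lambda>x. f x * c) = usum f * c"
  unfolding usum_def by (rule nn_integral_multc) simp

lemma usum_add: "usum (\<lambda>x. f x + g x) = usum f + usum g"
  unfolding usum_def by (rule nn_integral_add) simp_all

lemma usum_mono: "(\<And>x. f x \<le> g x) \<Longrightarrow> usum f \<le> usum g"
  unfolding usum_def by (rule nn_integral_mono) simp

lemma usum_sum: "usum (\<lambda>x. \<Sum>i\<in>I. f i x) = (\<Sum>i\<in>I. usum (f i))"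
  unfolding usum_def by (rule nn_integral_sum) simp

text \<open>Tonelli for counting measures, free of summability conditions. This is the reason for
  working in [0, \<infinity>]: kernels are composed and forms rearranged without side
  conditions.\<close>

lemma usum_swap: "usum (\<lambda>x. usum (\<lambda>y. f x y)) = usum (\<lambda>y. usum (\<lambda>x. f x y))"
  unfolding usum_def
  using nn_integral_fst_count_space[of "\<lambda>(x, y). f x y"] nn_integral_snd_count_space[of "\<lambda>(x, y). f x y"]
  by simp

lemma usum_finite_support:
  assumes "finite A" and "\<And>x. x \<notin> A \<Longrightarrow> f x = 0"
  shows "usum f = (\<Sum>x\<in>A. f x)"
  unfolding usum_def by (rule nn_integral_count_space') (use assms in auto)

lemma sum_le_usum: "finite A \<Longrightarrow> (\<Sum>x\<in>A. f x) \<le> usum f"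
  using usum_finite_support[of A "\<lambda>x. if x \<in> A then f x else 0"]
    usum_mono[of "\<lambda>x. if x \<in> A then f x else 0" f] by simp

text \<open>The bridge from the real sums in the definition of \<open>iter_kernel\<close> to
  \<open>usum\<close>. It passes through \<open>infsetsum\<close>, which is an integral with respect
  to the counting measure.\<close>

lemma usum_eq_infsum:
  fixes f :: "'a \<Rightarrow> real"
  assumes "f summable_on UNIV" and "\<And>x. f x \<ge> 0"
  shows "usum (\<lambda>x. ennreal (f x)) = ennreal (infsum f UNIV)"
proof -
  have "(\<lambda>x. norm (f x)) summable_on UNIV" using assms by simp
  then have "Infinite_Set_Sum.abs_summable_on f UNIV"
    using abs_summable_equivalent[of f UNIV] by blast
  moreover from this have "infsetsum f UNIV = infsum f UNIV"
    by (rule infsetsum_infsum)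
  ultimately show ?thesis
    unfolding usum_def using assms(2)
    by (subst nn_integral_eq_integral) (auto simp: Infinite_Set_Sum.abs_summable_on_def infsetsum_def)
qed

lemma ennreal_two_mult_le: "2 * (a * b) \<le> a * a + b * (b :: ennreal)"
proof (cases a; cases b)
  fix r s :: real assume *: "a = ennreal r" "0 \<le> r" "b = ennreal s" "0 \<le> s"
  have "2 * (r * s) \<le> r * r + s * s" using sum_squares_bound[of r s] by (simp add: power2_eq_square)
  then have "ennreal (2 * (r * s)) \<le> ennreal (r * r + s * s)" by (rule ennreal_leI)
  then show ?thesis using * by (simp add: ennreal_mult ennreal_plus)
qed (auto simp: ennreal_top_mult)

text \<open>Subtraction in \<open>ennreal\<close> truncates at 0, so the difference is taken in the
  reals. At infinite arguments the value is not meaningful, since \<open>enn2real\<close> sends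
  \<infinity> to 0; hence the finiteness assumptions on f below.\<close>

definition sqd :: "ennreal \<Rightarrow> ennreal \<Rightarrow> ennreal" where
  "sqd a b = ennreal ((enn2real a - enn2real b)\<^sup>2)"

lemma sqd_same [simp]: "sqd a a = 0"
  by (simp add: sqd_def)

lemma sqd_add_mult:
  assumes "a < top" "b < top"
  shows "sqd a b + 2 * (a * b) = a * a + b * b"
proof -
  obtain r s where *: "a = ennreal r" "0 \<le> r" "b = ennreal s" "0 \<le> s"
    using assms by (metis ennreal_cases less_irrefl)
  have "ennreal ((r - s)\<^sup>2 + 2 * (r * s)) = ennreal (r * r + s * s)"
    by (simp add: power2_eq_square algebra_simps)
  then show ?thesis using * by (simp add: sqd_def ennreal_mult ennreal_plus)
qed

lemma sqd_triangle: "sqd a c \<le> 2 * sqd a b + 2 * sqd b c"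
proof -
  have *: "(x - z)\<^sup>2 \<le> 2 * (x - y)\<^sup>2 + 2 * (y - z)\<^sup>2" for x y z :: real
    using sum_squares_bound[of "x - y" "y - z"] by (simp add: power2_eq_square algebra_simps)
  show ?thesis
    using ennreal_leI[OF *[of "enn2real a" "enn2real c" "enn2real b"]]
    by (simp add: sqd_def ennreal_mult ennreal_plus)
qed

text \<open>The decrements of a convex sequence decrease, so the average drop over the first j steps
  dominates the average drop over the first n.\<close>

lemma convex_seq_slope:
  fixes W :: "nat \<Rightarrow> real"
  assumes convex: "\<And>i. 2 * W (Suc i) \<le> W i + W (Suc (Suc i))" and "j \<le> n"
  shows "real j * (W 0 - W n) \<le> real n * (W 0 - W j)"
proof -
  define D where "D i = W i - W (Suc i)" for i
  have "decseq D"
  proof (rule decseq_SucI)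
    show "D (Suc i) \<le> D i" for i unfolding D_def using convex[of i] by linarith
  qed
  then have dec: "D b \<le> D a" if "a \<le> b" for a b using that by (auto dest: antimonoD)
  have tele: "W 0 - W n = (\<Sum>i<n. D i)" for n
    by (induction n) (auto simp: D_def)
  show ?thesis using \<open>j \<le> n\<close>
  proof (induction n rule: dec_induct)
    case (step n)
    have "real j * D n = (\<Sum>i<j. D n)" by simp
    also have "\<dots> \<le> (\<Sum>i<j. D i)" by (intro sum_mono dec) (use step in auto)
    finally have "real j * D n \<le> W 0 - W j" by (simp add: tele)
    then show ?case using step.IH by (simp add: D_def algebra_simps)
  qed simp
qed

section \<open>Powers of a symmetric Markov kernel and their Dirichlet forms\<close>

locale markov_semigroup =
  fixes m :: "'v \<Rightarrow> ennreal" and q :: "nat \<Rightarrow> 'v \<Rightarrow> 'v \<Rightarrow> ennreal"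
  assumes m_pos: "0 < m x" and m_fin: "m x < top"
    and q_0: "q 0 x y = (if x = y then 1 / m x else 0)"
    and q_Suc: "q (Suc n) x y = usum (\<lambda>z. q (Suc 0) x z * q n z y * m z)"
    and q_1_sym: "q (Suc 0) x y = q (Suc 0) y x"
    and q_1_mass: "usum (\<lambda>y. q (Suc 0) x y * m y) = 1"
begin

lemma divide_m_mult: "1 / m x * m x = 1"
proof -
  obtain r where r: "m x = ennreal r" "r > 0"
    using m_pos[of x] m_fin[of x] by (cases "m x") auto
  then have "1 / m x = ennreal (1 / r)" by (simp add: divide_ennreal flip: ennreal_1)
  then have "1 / m x * m x = ennreal (1 / r * r)" using r by (simp only: ennreal_mult'')
  then show ?thesis using r by simp
qed

lemma usum_q_0: "usum (\<lambda>z. q 0 x z * f z * m z) = f x"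
proof -
  have "usum (\<lambda>z. q 0 x z * f z * m z) = (\<Sum>z\<in>{x}. q 0 x z * f z * m z)"
    by (rule usum_finite_support) (auto simp: q_0)
  also have "\<dots> = (1 / m x * m x) * f x" by (simp add: q_0 mult_ac)
  finally show ?thesis by (simp add: divide_m_mult)
qed

lemma q_add: "q (a + b) x y = usum (\<lambda>z. q a x z * q b z y * m z)"
proof (induction a arbitrary: x)
  case 0
  show ?case by (simp add: usum_q_0)
next
  case (Suc a)
  have "q (Suc a + b) x y = usum (\<lambda>z. usum (\<lambda>v. q (Suc 0) x z * (q a z v * q b v y * m v) * m z))"
    by (simp add: q_Suc[of "a + b"] Suc usum_cmult usum_multc)
  also have "\<dots> = usum (\<lambda>v. usum (\<lambda>z. (q (Suc 0) x z * q a z v * m z) * (q b v y * m v)))"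
    by (subst usum_swap) (simp add: mult_ac)
  also have "\<dots> = usum (\<lambda>v. q (Suc a) x v * q b v y * m v)"
    by (simp only: usum_multc, simp only: q_Suc[of a] mult.assoc)
  finally show ?case .
qed

lemma q_sym: "q n x y = q n y x"
proof (induction n arbitrary: x y)
  case (Suc n)
  have "q (n + 1) x y = usum (\<lambda>z. q n x z * q (Suc 0) z y * m z)"
    using q_add[of n "Suc 0"] by simp
  also have "\<dots> = usum (\<lambda>z. q (Suc 0) y z * q n z x * m z)"
    using Suc q_1_sym by (simp add: mult.commute)
  also have "\<dots> = q (Suc n) y x" by (rule q_Suc[symmetric])
  finally show ?case by simp
qed (auto simp: q_0)

lemma q_mass: "usum (\<lambda>y. q n x y * m y) = 1"
proof (induction n arbitrary: x)
  case 0
  show ?case using usum_q_0[of x "\<lambda>_. 1"] by simp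
next
  case (Suc n)
  have "usum (\<lambda>y. q (Suc n) x y * m y) = usum (\<lambda>y. usum (\<lambda>z. q (Suc 0) x z * q n z y * m z * m y))"
    by (simp add: q_Suc[of n] usum_multc)
  also have "\<dots> = usum (\<lambda>z. usum (\<lambda>y. (q (Suc 0) x z * m z) * (q n z y * m y)))"
    by (subst usum_swap) (simp add: mult_ac)
  also have "\<dots> = 1" by (simp only: usum_cmult Suc, simp add: q_1_mass)
  finally show ?case .
qed

lemma q_mult_m_le_1: "q n x y * m y \<le> 1"
  using sum_le_usum[of "{y}" "\<lambda>y. q n x y * m y"] by (simp add: q_mass)

definition T :: "nat \<Rightarrow> ('v \<Rightarrow> ennreal) \<Rightarrow> 'v \<Rightarrow> ennreal" where
  "T n f x = usum (\<lambda>y. q n x y * f y * m y)"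

text \<open>With Q the operator of \<open>q 1\<close>, this is the inner product of f and Q^n g in
  l^2(m).\<close>

definition bil :: "nat \<Rightarrow> ('v \<Rightarrow> ennreal) \<Rightarrow> ('v \<Rightarrow> ennreal) \<Rightarrow> ennreal" where
  "bil n f g = usum (\<lambda>x. usum (\<lambda>y. f x * g y * q n x y * m x * m y))"

text \<open>The Dirichlet form of \<kappa> without the customary factor 1/2.\<close>

definition form :: "('v \<Rightarrow> 'v \<Rightarrow> ennreal) \<Rightarrow> ('v \<Rightarrow> ennreal) \<Rightarrow> ennreal" where
  "form \<kappa> f = usum (\<lambda>x. usum (\<lambda>y. sqd (f x) (f y) * \<kappa> x y * m x * m y))"

lemma bil_add: "bil (a + b) f g = usum (\<lambda>z. T a f z * T b g z * m z)"
proof -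
  have "bil (a + b) f g = usum (\<lambda>x. usum (\<lambda>y. usum (\<lambda>z. f x * g y * (q a x z * q b z y * m z) * m x * m y)))"
    by (simp add: bil_def q_add usum_cmult usum_multc)
  also have "\<dots> = usum (\<lambda>x. usum (\<lambda>z. usum (\<lambda>y. f x * g y * (q a x z * q b z y * m z) * m x * m y)))"
    by (subst usum_swap) simp
  also have "\<dots> = usum (\<lambda>z. usum (\<lambda>x. usum (\<lambda>y. f x * g y * (q a x z * q b z y * m z) * m x * m y)))"
    by (rule usum_swap)
  also have "\<dots> = usum (\<lambda>z. usum (\<lambda>x. usum (\<lambda>y. (q a z x * f x * m x) * ((q b z y * g y * m y) * m z))))"
    by (simp add: q_sym[of a] mult_ac)
  also have "\<dots> = usum (\<lambda>z. T a f z * T b g z * m z)"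
    by (simp only: usum_cmult usum_multc, simp only: T_def mult.assoc)
  finally show ?thesis .
qed

lemma bil_0: "bil 0 f g = usum (\<lambda>x. f x * g x * m x)"
  using bil_add[of 0 0 f g] by (simp add: T_def usum_q_0)

text \<open>The inequality 2uv \<le> u^2 + v^2 for u = Q^a f and v = Q^b f, summed over the
  vertices. All convexity below comes from it.\<close>

lemma bil_double_add_le: "2 * bil (a + b) f f \<le> bil (2 * a) f f + bil (2 * b) f f"
proof -
  have "2 * bil (a + b) f f = usum (\<lambda>z. (2 * (T a f z * T b f z)) * m z)"
    by (simp add: bil_add mult.assoc usum_cmult)
  also have "\<dots> \<le> usum (\<lambda>z. (T a f z * T a f z + T b f z * T b f z) * m z)"
    by (intro usum_mono mult_right_mono ennreal_two_mult_le) simp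
  also have "\<dots> = bil (2 * a) f f + bil (2 * b) f f"
    by (simp add: bil_add mult_2 distrib_right usum_add)
  finally show ?thesis .
qed

text \<open>Expanding the square and using mass one in each variable turns the form into 2 ||f||^2 -
  2 (f, Q^n f). The identity is kept additive because the terms may be infinite.\<close>

lemma form_add_bil:
  assumes fin: "\<And>x. f x < top"
  shows "form (q n) f + 2 * bil n f f = 2 * bil 0 f f"
proof -
  have "form (q n) f + 2 * bil n f f =
    usum (\<lambda>x. usum (\<lambda>y. (sqd (f x) (f y) + 2 * (f x * f y)) * (q n x y * m x * m y)))"
    by (simp add: form_def bil_def distrib_right usum_add usum_cmult mult.assoc)
  also have "\<dots> = usum (\<lambda>x. usum (\<lambda>y. (f x * f x * m x) * (q n x y * m y) + f y * f y * (q n x y * m x * m y)))"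
    by (simp only: sqd_add_mult[OF fin fin], simp add: distrib_right distrib_left mult_ac)
  also have "\<dots> = bil 0 f f + usum (\<lambda>x. usum (\<lambda>y. f y * f y * (q n x y * m x * m y)))"
    by (simp add: usum_add usum_cmult q_mass bil_0)
  also have "usum (\<lambda>x. usum (\<lambda>y. f y * f y * (q n x y * m x * m y))) =
      usum (\<lambda>y. usum (\<lambda>x. (f y * f y * m y) * (q n y x * m x)))"
    by (subst usum_swap) (simp add: q_sym[of n] mult_ac)
  also have "\<dots> = bil 0 f f" by (simp add: usum_cmult q_mass bil_0)
  finally show ?thesis by (simp add: mult_2)
qed

lemma bil_le_bil_0:
  assumes fin: "\<And>x. f x < top"
  shows "bil n f f \<le> bil 0 f f"
proof -
  have "2 * bil n f f \<le> 2 * bil 0 f f"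
    using form_add_bil[of f n] fin by (metis le_add_same_cancel2 zero_le add.commute le_iff_add)
  then show ?thesis by (simp add: ennreal_mult_le_mult_iff)
qed

lemma form_eq:
  assumes fin: "\<And>x. f x < top" and l2: "bil 0 f f < top"
  shows "form (q n) f = ennreal (2 * (enn2real (bil 0 f f) - enn2real (bil n f f)))"
    and "bil n f f = ennreal (enn2real (bil n f f))"
    and "enn2real (bil n f f) \<le> enn2real (bil 0 f f)"
proof -
  have le: "bil n f f \<le> bil 0 f f" by (rule bil_le_bil_0) fact
  then show *: "bil n f f = ennreal (enn2real (bil n f f))" using l2 by simp
  show "enn2real (bil n f f) \<le> enn2real (bil 0 f f)"
    using le l2 by (simp add: enn2real_mono)
  have "form (q n) f + 2 * bil n f f = 2 * bil 0 f f" by (rule form_add_bil) fact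
  moreover have "2 * bil n f f \<noteq> top" by (subst *) (simp add: ennreal_mult_eq_top_iff)
  ultimately have "form (q n) f = 2 * bil 0 f f - 2 * bil n f f"
    by (metis ennreal_add_diff_cancel_right)
  also have "\<dots> = ennreal (2 * enn2real (bil 0 f f)) - ennreal (2 * enn2real (bil n f f))"
    using * l2 by (simp add: ennreal_mult'')
  finally show "form (q n) f = ennreal (2 * (enn2real (bil 0 f f) - enn2real (bil n f f)))"
    by (simp add: ennreal_minus right_diff_distrib)
qed

lemma enn2real_bil_double_add_le:
  assumes fin: "\<And>x. f x < top" and l2: "bil 0 f f < top"
  shows "2 * enn2real (bil (a + b) f f) \<le> enn2real (bil (2 * a) f f) + enn2real (bil (2 * b) f f)"
proof -
  note eq = form_eq(2)[OF fin l2]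
  have "ennreal (2 * enn2real (bil (a + b) f f)) = 2 * bil (a + b) f f"
    by (subst eq[of "a + b"]) (simp add: ennreal_mult)
  also have "\<dots> \<le> bil (2 * a) f f + bil (2 * b) f f" by (rule bil_double_add_le)
  also have "\<dots> = ennreal (enn2real (bil (2 * a) f f) + enn2real (bil (2 * b) f f))"
    by (subst eq[of "2 * a"], subst eq[of "2 * b"]) (simp add: ennreal_plus)
  finally show ?thesis by (subst (asm) ennreal_le_iff) auto
qed

text \<open>The sequence i \<mapsto> (f, Q^(2i) f) = ||Q^i f||^2 is convex: take the exponents i and
  i + 2 in the preceding inequality. Odd times are left out since Q may have negative
  spectrum.\<close>

lemma bil_even_slope:
  assumes fin: "\<And>x. f x < top" and l2: "bil 0 f f < top" and "j \<le> n"
  shows "real j * (enn2real (bil 0 f f) - enn2real (bil (2 * n) f f)) \<le>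
    real n * (enn2real (bil 0 f f) - enn2real (bil (2 * j) f f))"
proof -
  have "2 * enn2real (bil (2 * Suc i) f f) \<le>
      enn2real (bil (2 * i) f f) + enn2real (bil (2 * Suc (Suc i)) f f)" for i
  proof -
    have "i + Suc (Suc i) = 2 * Suc i" by simp
    then show ?thesis
      using enn2real_bil_double_add_le[OF fin l2, of i "Suc (Suc i)"] by (simp only:)
  qed
  from convex_seq_slope[of "\<lambda>i. enn2real (bil (2 * i) f f)", OF this \<open>j \<le> n\<close>]
  show ?thesis by simp
qed

lemma form_even_mono:
  assumes fin: "\<And>x. f x < top" and l2: "bil 0 f f < top" and "j \<le> n"
  shows "of_nat j * form (q (2 * n)) f \<le> of_nat n * form (q (2 * j)) f"
proof -
  have "real j * (2 * (enn2real (bil 0 f f) - enn2real (bil (2 * n) f f))) \<le>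
    real n * (2 * (enn2real (bil 0 f f) - enn2real (bil (2 * j) f f)))"
    using mult_left_mono[OF bil_even_slope[OF assms], of 2] by (simp add: algebra_simps)
  then show ?thesis
    unfolding form_eq(1)[OF fin l2] by (simp add: ennreal_of_nat_eq_real_of_nat form_eq(3)[OF fin l2] ennreal_leI flip: ennreal_mult)
qed

lemma form_two_le:
  assumes fin: "\<And>x. f x < top" and l2: "bil 0 f f < top"
  shows "form (q 2) f \<le> 2 * form (q 1) f"
proof -
  have "2 * (enn2real (bil 0 f f) - enn2real (bil 2 f f)) \<le> 2 * (2 * (enn2real (bil 0 f f) - enn2real (bil 1 f f)))"
    using enn2real_bil_double_add_le[OF fin l2, of 0 1] by simp
  then have "ennreal (2 * (enn2real (bil 0 f f) - enn2real (bil 2 f f))) \<le> ennreal (2 * (2 * (enn2real (bil 0 f f) - enn2real (bil 1 f f))))"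
    by (rule ennreal_leI)
  also have "\<dots> = 2 * ennreal (2 * (enn2real (bil 0 f f) - enn2real (bil 1 f f)))"
    using form_eq(3)[OF fin l2, of 1] by (subst ennreal_mult) auto
  finally show ?thesis unfolding form_eq(1)[OF fin l2] .
qed

text \<open>A midpoint z is inserted between x and y, after a steps. In each of the two resulting
  terms the kernel of the other leg sums to one.\<close>

lemma form_add_le: "form (q (a + b)) f \<le> 2 * form (q a) f + 2 * form (q b) f"
proof -
  have "form (q (a + b)) f =
      usum (\<lambda>x. usum (\<lambda>y. usum (\<lambda>z. sqd (f x) (f y) * (q a x z * q b z y * m z * m x * m y))))"
    by (simp add: form_def q_add usum_cmult[symmetric] usum_multc[symmetric] mult.assoc)
  also have "\<dots> \<le> usum (\<lambda>x. usum (\<lambda>y. usum (\<lambda>z.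
      (2 * sqd (f x) (f z) + 2 * sqd (f z) (f y)) * (q a x z * q b z y * m z * m x * m y))))"
    by (intro usum_mono mult_right_mono sqd_triangle) simp
  also have "\<dots> = usum (\<lambda>x. usum (\<lambda>y. usum (\<lambda>z. 2 * sqd (f x) (f z) * (q a x z * q b z y * m z * m x * m y))))
    + usum (\<lambda>x. usum (\<lambda>y. usum (\<lambda>z. 2 * sqd (f z) (f y) * (q a x z * q b z y * m z * m x * m y))))"
    by (simp add: distrib_right usum_add)
  also have "usum (\<lambda>x. usum (\<lambda>y. usum (\<lambda>z. 2 * sqd (f x) (f z) * (q a x z * q b z y * m z * m x * m y))))
    = usum (\<lambda>x. usum (\<lambda>z. usum (\<lambda>y. 2 * (sqd (f x) (f z) * q a x z * m x * m z) * (q b z y * m y))))"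
    by (subst usum_swap) (simp add: mult_ac)
  also have "\<dots> = 2 * form (q a) f"
    by (simp add: usum_cmult q_mass form_def)
  also have "usum (\<lambda>x. usum (\<lambda>y. usum (\<lambda>z. 2 * sqd (f z) (f y) * (q a x z * q b z y * m z * m x * m y))))
    = usum (\<lambda>y. usum (\<lambda>x. usum (\<lambda>z. 2 * sqd (f z) (f y) * (q a x z * q b z y * m z * m x * m y))))"
    by (rule usum_swap)
  also have "\<dots> = usum (\<lambda>y. usum (\<lambda>z. usum (\<lambda>x. 2 * sqd (f z) (f y) * (q a x z * q b z y * m z * m x * m y))))"
    by (subst usum_swap) simp
  also have "\<dots> = usum (\<lambda>z. usum (\<lambda>y. usum (\<lambda>x. 2 * sqd (f z) (f y) * (q a x z * q b z y * m z * m x * m y))))"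
    by (rule usum_swap)
  also have "\<dots> = usum (\<lambda>z. usum (\<lambda>y. usum (\<lambda>x. 2 * (sqd (f z) (f y) * q b z y * m z * m y) * (q a z x * m x))))"
    by (simp add: q_sym[of a] mult_ac)
  also have "\<dots> = 2 * form (q b) f"
    by (simp add: usum_cmult q_mass form_def)
  finally show ?thesis .
qed

text \<open>Convexity gives linear growth along even n; an odd n costs one further step through
  \<open>form_add_le\<close>. The constant 4 leaves room for both cases.\<close>

lemma form_le_form_1:
  assumes fin: "\<And>x. f x < top" and l2: "bil 0 f f < top"
  shows "form (q n) f \<le> of_nat (4 * n) * form (q 1) f"
proof -
  have even: "form (q (2 * j)) f \<le> of_nat (2 * j) * form (q 1) f" for j
  proof (cases "j = 0")
    case True
    have "form (q 0) f = 0" using form_eq(1)[OF fin l2, of 0] by simp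
    then show ?thesis using True by simp
  next
    case False
    then have "form (q (2 * j)) f \<le> of_nat j * form (q 2) f"
      using form_even_mono[OF fin l2, of 1 j] by simp
    also have "\<dots> \<le> of_nat j * (2 * form (q 1) f)"
      by (intro mult_left_mono form_two_le fin l2) simp
    finally show ?thesis by (simp add: mult_ac)
  qed
  obtain j where "n = 2 * j \<or> n = 2 * j + 1" by (metis oddE evenE)
  then show ?thesis
  proof
    assume n: "n = 2 * j"
    have "of_nat (2 * j) * form (q 1) f \<le> of_nat (4 * n) * form (q 1) f"
      by (intro mult_right_mono of_nat_mono) (use n in auto)
    then show ?thesis using even[of j] n by auto
  next
    assume n: "n = 2 * j + 1"
    have "form (q n) f \<le> 2 * form (q (2 * j)) f + 2 * form (q 1) f"
      unfolding n by (rule form_add_le)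
    also have "\<dots> \<le> 2 * (of_nat (2 * j) * form (q 1) f) + 2 * form (q 1) f"
      by (intro add_right_mono mult_left_mono even) simp
    also have "\<dots> = of_nat (4 * j + 2) * form (q 1) f"
    proof -
      have "4 * j + 2 = 2 * (2 * j) + 2" by simp
      then have "(of_nat (4 * j + 2) :: ennreal) = 2 * of_nat (2 * j) + 2"
        by (simp only: of_nat_add of_nat_mult of_nat_numeral)
      then show ?thesis by (simp only: distrib_right mult.assoc)
    qed
    also have "\<dots> \<le> of_nat (4 * n) * form (q 1) f"
      by (intro mult_right_mono of_nat_mono) (use n in auto)
    finally show ?thesis .
  qed
qed

text \<open>The diagonal terms vanish, so kernels that are comparable only for distinct points still
  have comparable forms.\<close>

lemma form_mono:
  assumes "\<And>x y. x \<noteq> y \<Longrightarrow> \<kappa> x y \<le> \<kappa>' x y"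
  shows "form \<kappa> f \<le> form \<kappa>' f"
  unfolding form_def
proof (intro usum_mono)
  fix x y
  show "sqd (f x) (f y) * \<kappa> x y * m x * m y \<le> sqd (f x) (f y) * \<kappa>' x y * m x * m y"
    by (cases "x = y") (auto intro!: mult_right_mono mult_left_mono assms)
qed

lemma form_cmult: "form (\<lambda>x y. c * \<kappa> x y) f = c * form \<kappa> f"
proof -
  have "form (\<lambda>x y. c * \<kappa> x y) f = usum (\<lambda>x. usum (\<lambda>y. c * (sqd (f x) (f y) * \<kappa> x y * m x * m y)))"
    by (simp add: form_def mult_ac)
  then show ?thesis by (simp add: usum_cmult form_def)
qed

lemma form_add: "form (\<lambda>x y. \<kappa> x y + \<kappa>' x y) f = form \<kappa> f + form \<kappa>' f"
  by (simp add: form_def distrib_left distrib_right usum_add)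

lemma form_sum: "form (\<lambda>x y. \<Sum>i\<in>I. \<kappa> i x y) f = (\<Sum>i\<in>I. form (\<kappa> i) f)"
  by (simp add: form_def sum_distrib_left sum_distrib_right usum_sum)

lemma form_usum: "form (\<lambda>x y. usum (\<lambda>i. \<kappa> i x y)) f = usum (\<lambda>i. form (\<kappa> i) f)"
proof -
  have "form (\<lambda>x y. usum (\<lambda>i. \<kappa> i x y)) f =
      usum (\<lambda>x. usum (\<lambda>y. usum (\<lambda>i. sqd (f x) (f y) * \<kappa> i x y * m x * m y)))"
    by (simp add: form_def usum_cmult usum_multc)
  also have "\<dots> = usum (\<lambda>x. usum (\<lambda>i. usum (\<lambda>y. sqd (f x) (f y) * \<kappa> i x y * m x * m y)))"
    by (subst usum_swap) simp
  also have "\<dots> = usum (\<lambda>i. form (\<kappa> i) f)"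
    unfolding form_def by (rule usum_swap)
  finally show ?thesis .
qed

lemma bil_le:
  assumes "\<And>x y. q n x y \<le> S"
  shows "bil n f f \<le> S * (usum (\<lambda>x. f x * m x) * usum (\<lambda>x. f x * m x))"
proof -
  have "bil n f f \<le> usum (\<lambda>x. usum (\<lambda>y. f x * f y * S * m x * m y))"
    unfolding bil_def by (intro usum_mono mult_right_mono mult_left_mono assms) auto
  also have "\<dots> = usum (\<lambda>x. usum (\<lambda>y. (S * (f x * m x)) * (f y * m y)))"
    by (simp add: mult_ac)
  also have "\<dots> = S * (usum (\<lambda>x. f x * m x) * usum (\<lambda>x. f x * m x))"
    by (simp only: usum_cmult usum_multc, simp only: mult.assoc)
  finally show ?thesis .
qed

text \<open>By symmetry \<open>q (2 * n) x y\<close> is the inner product of \<open>q n x\<close>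
  and \<open>q n y\<close>, hence at most the mean of the two diagonal values.\<close>

lemma q_even_le_diag:
  assumes "\<And>x. q (2 * n) x x \<le> S"
  shows "q (2 * n) x y \<le> S"
proof -
  have "2 * q (2 * n) x y = usum (\<lambda>z. (2 * (q n x z * q n z y)) * m z)"
    by (simp add: mult_2[of n] q_add usum_cmult mult.assoc)
  also have "\<dots> \<le> usum (\<lambda>z. (q n x z * q n x z + q n z y * q n z y) * m z)"
    by (intro usum_mono mult_right_mono ennreal_two_mult_le) simp
  also have "\<dots> = usum (\<lambda>z. q n x z * q n z x * m z) + usum (\<lambda>z. q n y z * q n z y * m z)"
    by (simp add: distrib_right usum_add q_sym[of n])
  also have "\<dots> = q (2 * n) x x + q (2 * n) y y"
    by (simp add: q_add[symmetric] mult_2)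
  also have "\<dots> \<le> 2 * S" unfolding mult_2[of S] by (intro add_mono assms)
  finally show ?thesis by (simp add: ennreal_mult_le_mult_iff)
qed

lemma bil_q: "bil n (q a x) (q b y) = q (a + n + b) x y"
proof -
  have "bil n (q a x) (q b y) = usum (\<lambda>v. usum (\<lambda>z. (q a x v * m v) * (q n v z * q b z y * m z)))"
    by (simp add: bil_def q_sym[of b y] mult_ac)
  also have "\<dots> = usum (\<lambda>v. q a x v * q (n + b) v y * m v)"
    by (simp only: usum_cmult q_add[of n b, symmetric], simp only: mult_ac)
  also have "\<dots> = q (a + (n + b)) x y" by (rule q_add[symmetric])
  finally show ?thesis by (simp add: add_ac)
qed

lemma bil_q_add:
  "bil n (\<lambda>y. q a x y + q b x y) (\<lambda>y. q a x y + q b x y) =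
    q (2 * a + n) x x + 2 * q (a + b + n) x x + q (2 * b + n) x x"
proof -
  have "bil n (\<lambda>y. q a x y + q b x y) (\<lambda>y. q a x y + q b x y) =
    bil n (q a x) (q a x) + bil n (q a x) (q b x) + (bil n (q b x) (q a x) + bil n (q b x) (q b x))"
    by (simp add: bil_def distrib_left distrib_right usum_add add_ac)
  then show ?thesis by (simp add: bil_q add_ac mult_2)
qed

end


section \<open>Graph distance and transition kernels\<close>

context weighted_graph
begin

lemma graph_dist_path: "(x, y) \<in> E ^^ graph_dist E x y"
proof -
  obtain n where "(x, y) \<in> E ^^ n" using connected[of x y] rtrancl_imp_relpow by metis
  then show ?thesis unfolding graph_dist_def by (rule LeastI)
qed

lemma graph_dist_le: "(x, y) \<in> E ^^ n \<Longrightarrow> graph_dist E x y \<le> n"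
  unfolding graph_dist_def by (rule Least_le)

lemma graph_dist_eq_0_iff [simp]: "graph_dist E x y = 0 \<longleftrightarrow> x = y"
  using graph_dist_path[of x y] graph_dist_le[of x y 0] by auto

lemma graph_dist_self [simp]: "graph_dist E x x = 0"
  by simp

lemma graph_dist_triangle: "graph_dist E x z \<le> graph_dist E x y + graph_dist E y z"
  unfolding graph_dist_def[of E x z]
  by (rule Least_le) (simp only: relpow_add relcompI[OF graph_dist_path graph_dist_path])

lemma edge_sym: "(x, y) \<in> E \<longleftrightarrow> (y, x) \<in> E"
  using weight_pos_iff[of x y] weight_pos_iff[of y x] weight_sym[of x y] by simp

lemma relpow_edge_sym: "(x, y) \<in> E ^^ n \<Longrightarrow> (y, x) \<in> E ^^ n"
proof (induction n arbitrary: y)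
  case (Suc n)
  then obtain z where "(x, z) \<in> E ^^ n" "(z, y) \<in> E" by auto
  then have "(z, x) \<in> E ^^ n" "(y, z) \<in> E" using Suc.IH edge_sym by blast+
  then show ?case by (rule relpow_Suc_I2[rotated])
qed simp

lemma graph_dist_sym: "graph_dist E x y = graph_dist E y x"
  by (rule antisym; rule graph_dist_le, rule relpow_edge_sym, rule graph_dist_path)

text \<open>Balls are finite and the graph is infinite, so some vertex lies beyond distance n, and a
  shortest path to it passes through distance n.\<close>

lemma exists_graph_dist_eq: "\<exists>y. graph_dist E x y = n"
proof -
  have "\<exists>y. y \<notin> graph_ball E x (real n)"
    using finite_graph_ball infinite_vertices by (metis UNIV_eq_I)
  then obtain y where y: "graph_dist E x y > n" by (auto simp: graph_ball_def not_le)
  then have "(x, y) \<in> E ^^ (n + (graph_dist E x y - n))" using graph_dist_path[of x y] by simp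
  then obtain z where z: "(x, z) \<in> E ^^ n" "(z, y) \<in> E ^^ (graph_dist E x y - n)"
    unfolding relpow_add by auto
  have "graph_dist E x y \<le> graph_dist E x z + (graph_dist E x y - n)"
    using graph_dist_triangle[of x y z] graph_dist_le[OF z(2)] by linarith
  then have "graph_dist E x z = n" using graph_dist_le[OF z(1)] y by linarith
  then show ?thesis by blast
qed

text \<open>A ball of radius s contains about s/r disjoint balls of radius r: centres at distances 3
  r i from the midpoint, i = 0, 1, ..., are at least 3 r apart, whether or not they lie on one path.
  Homogeneity makes their volumes comparable, so volume grows at least linearly.\<close>

lemma reverse_volume_doubling:
  assumes m: "\<And>x. vertex_weight E \<mu> x \<ge> 0" and Ch: "Ch > 1"
    and vol: "\<And>x r. r > 0 \<Longrightarrow> inverse Ch * V r \<le> volume E \<mu> x r \<and> volume E \<mu> x r \<le> Ch * V r"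
    and mono: "\<And>r s. 0 \<le> r \<Longrightarrow> r \<le> s \<Longrightarrow> V r \<le> V s" and pos: "\<And>r. 0 \<le> r \<Longrightarrow> V r > 0"
    and st: "1 \<le> t" "t \<le> s"
  shows "s / t * V t \<le> 8 * Ch\<^sup>2 * V s"
proof -
  define r where "r = nat \<lceil>t\<rceil>"
  have r: "t \<le> real r" "real r \<le> 2 * t" "r \<ge> 1" using st by (auto simp: r_def le_nat_iff; linarith)+
  show ?thesis
  proof (cases "s < real r")
    case True
    then have "s / t \<le> 2" using r st by (simp add: field_simps)
    also have "2 \<le> 8 * Ch\<^sup>2" using one_le_power[OF less_imp_le[OF Ch], of 2] by linarith
    finally show ?thesis
      using mono[of t s] pos[of t] st by (intro mult_mono) auto
  next
    case False
    \<comment> \<open>The largest J with 3 r J + r \<le> s, so that all J + 1 balls fit. Rounding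
      leaves J + 1 \<ge> s / (4 r), and r \<le> 2 t supplies the remaining factor 2 of the constant
      8.\<close>
    define J where "J = nat \<lfloor>(s - real r) / (3 * real r)\<rfloor>"
    have J1: "real J \<le> (s - real r) / (3 * real r)" using False r by (simp add: J_def)
    have J2: "(s - real r) / (3 * real r) < real J + 1" unfolding J_def by linarith
    have J4: "s / (4 * real r) \<le> real J + 1"
    proof (cases "s \<ge> 4 * real r")
      case True
      then have "s / (4 * real r) \<le> (s - real r) / (3 * real r)" using r by (simp add: field_simps)
      then show ?thesis using J2 by linarith
    next
      case False
      then have "s / (4 * real r) \<le> 1" using r by (simp add: field_simps)
      then show ?thesis by linarith
    qed
    obtain o1 :: 'v where True by simp
    have "\<forall>i. \<exists>y. graph_dist E o1 y = 3 * r * i" using exists_graph_dist_eq by blast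
    then obtain c where c: "\<And>i. graph_dist E o1 (c i) = 3 * r * i" by metis
    have disj: "graph_ball E (c i) (real r) \<inter> graph_ball E (c j) (real r) = {}" if "i < j" for i j
    proof (rule ccontr)
      assume "\<not> ?thesis"
      then obtain y where y: "graph_dist E (c i) y \<le> r" "graph_dist E (c j) y \<le> r"
        by (auto simp: graph_ball_def)
      have "3 * r * j \<le> 3 * r * i + graph_dist E (c i) (c j)"
        using graph_dist_triangle[of o1 "c j" "c i"] c by simp
      also have "graph_dist E (c i) (c j) \<le> 2 * r"
        using graph_dist_triangle[of "c i" "c j" y] y graph_dist_sym[of y "c j"] by simp
      finally have "3 * r * j < 3 * r * (i + 1)" using r by simp
      moreover have "3 * r * (i + 1) \<le> 3 * r * j" using that by (intro mult_left_mono) auto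
      ultimately show False by linarith
    qed
    then have disj: "graph_ball E (c i) (real r) \<inter> graph_ball E (c j) (real r) = {}" if "i \<noteq> j" for i j
      using disj[of i j] disj[of j i] that by (cases "i < j") (auto simp: Int_commute)
    have sub: "(\<Union>i\<in>{..J}. graph_ball E (c i) (real r)) \<subseteq> graph_ball E o1 s"
    proof
      fix y assume "y \<in> (\<Union>i\<in>{..J}. graph_ball E (c i) (real r))"
      then obtain i where i: "i \<le> J" "graph_dist E (c i) y \<le> r" by (auto simp: graph_ball_def)
      have "real (graph_dist E o1 y) \<le> 3 * real r * real i + real r"
        using graph_dist_triangle[of o1 y "c i"] i(2) c[of i] by (metis add_mono_thms_linordered_semiring(2) le_trans of_nat_add of_nat_le_iff of_nat_mult of_nat_numeral)
      also have "\<dots> \<le> 3 * real r * real J + real r" using i by (auto intro!: mult_left_mono)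
      also have "\<dots> \<le> s" using J1 r by (simp add: field_simps)
      finally show "y \<in> graph_ball E o1 s" by (simp add: graph_ball_def)
    qed
    have "(real J + 1) * (inverse Ch * V (real r)) = (\<Sum>i\<in>{..J}. inverse Ch * V (real r))" by simp
    also have "\<dots> \<le> (\<Sum>i\<in>{..J}. volume E \<mu> (c i) (real r))"
      by (intro sum_mono) (use vol r in auto)
    also have "\<dots> = (\<Sum>y\<in>(\<Union>i\<in>{..J}. graph_ball E (c i) (real r)). vertex_weight E \<mu> y)"
      unfolding volume_def
      by (rule sum.UNION_disjoint[symmetric]) (use finite_graph_ball disj in auto)
    also have "\<dots> \<le> volume E \<mu> o1 s"
      unfolding volume_def by (rule sum_mono2[OF finite_graph_ball sub]) (rule m)
    also have "\<dots> \<le> Ch * V s" using vol[of s o1] st by simp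
    finally have A: "(real J + 1) * V (real r) \<le> Ch\<^sup>2 * V s"
      using Ch by (simp add: field_simps power2_eq_square)
    have "s / t * V t \<le> s * 8 / (4 * real r) * V (real r)"
      using r st mono[of t "real r"] pos[of t] by (intro mult_mono) (auto simp: field_simps)
    also have "\<dots> = 8 * (s / (4 * real r) * V (real r))" by simp
    also have "\<dots> \<le> 8 * ((real J + 1) * V (real r))"
      using pos[of "real r"] J4 by (intro mult_left_mono mult_right_mono) auto
    also have "\<dots> \<le> 8 * (Ch\<^sup>2 * V s)" using A by simp
    finally show ?thesis by simp
  qed
qed

section \<open>Both walks as Markov semigroups\<close>

lemma trans_prob_n_1: "trans_prob_n E \<mu> (Suc 0) x y = trans_prob E \<mu> x y"
proof (cases "(x, y) \<in> E")
  case True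
  have "trans_prob_n E \<mu> (Suc 0) x y = (\<Sum>z\<in>E `` {x}. if z = y then trans_prob E \<mu> x z else 0)"
    by (auto intro!: sum.cong)
  then show ?thesis using True locally_finite[of x] by (simp add: sum.delta)
next
  case False
  then have "\<mu> x y = 0" using weight_pos_iff[of x y] weight_nonneg[of x y] by linarith
  moreover have "trans_prob_n E \<mu> (Suc 0) x y = 0" using False by (auto intro!: sum.neutral)
  ultimately show ?thesis by (simp add: trans_prob_def)
qed

lemma markov_semigroup_heat_kernel:
  assumes m: "\<And>x. vertex_weight E \<mu> x > 0"
  shows "markov_semigroup (\<lambda>x. ennreal (vertex_weight E \<mu> x)) (\<lambda>n x y. ennreal (heat_kernel E \<mu> n x y))"
    (is "markov_semigroup ?m ?q")
    and "heat_kernel E \<mu> n x y \<ge> 0"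
proof -
  have t0: "trans_prob_n E \<mu> n x y \<ge> 0" for n x y
    by (induction n arbitrary: x)
       (auto intro!: sum_nonneg mult_nonneg_nonneg divide_nonneg_pos weight_nonneg m simp: trans_prob_def)
  show nn: "heat_kernel E \<mu> n x y \<ge> 0" for n x y
    using t0[of n x y] m[of y] by (simp add: heat_kernel_def)
  have h1: "heat_kernel E \<mu> (Suc 0) x y = \<mu> x y / (vertex_weight E \<mu> x * vertex_weight E \<mu> y)" for x y
    unfolding heat_kernel_def trans_prob_n_1 by (simp add: trans_prob_def)
  have off: "\<mu> x y = 0" if "y \<notin> E `` {x}" for x y
    using that weight_pos_iff[of x y] weight_nonneg[of x y] by auto
  show "markov_semigroup ?m ?q"
  proof
    show "0 < ?m x" "?m x < top" for x using m by auto
    show "?q 0 x y = (if x = y then 1 / ?m x else 0)" for x y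
      using m[of y] divide_ennreal[of 1 "vertex_weight E \<mu> y"] by (simp add: heat_kernel_def)
    show "?q (Suc 0) x y = ?q (Suc 0) y x" for x y
      by (simp only: h1 weight_sym[of x y] mult.commute)
    show "usum (\<lambda>y. ?q (Suc 0) x y * ?m y) = 1" for x
    proof -
      have "usum (\<lambda>y. ?q (Suc 0) x y * ?m y) = (\<Sum>y\<in>E `` {x}. ?q (Suc 0) x y * ?m y)"
        by (rule usum_finite_support[OF locally_finite]) (simp add: h1 off)
      also have "\<dots> = (\<Sum>y\<in>E `` {x}. ennreal (\<mu> x y / vertex_weight E \<mu> x))"
        using m by (intro sum.cong refl) (simp add: h1 ennreal_mult''[symmetric] less_imp_le less_imp_neq[symmetric])
      also have "\<dots> = ennreal (\<Sum>y\<in>E `` {x}. \<mu> x y / vertex_weight E \<mu> x)"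
        using m by (intro sum_ennreal divide_nonneg_pos weight_nonneg)
      also have "(\<Sum>y\<in>E `` {x}. \<mu> x y / vertex_weight E \<mu> x) = 1"
        using m[of x] by (simp add: sum_divide_distrib[symmetric] vertex_weight_def)
      finally show ?thesis by simp
    qed
    show "?q (Suc n) x y = usum (\<lambda>z. ?q (Suc 0) x z * ?q n z y * ?m z)" for n x y
    proof -
      have "usum (\<lambda>z. ?q (Suc 0) x z * ?q n z y * ?m z) = (\<Sum>z\<in>E `` {x}. ?q (Suc 0) x z * ?q n z y * ?m z)"
        by (rule usum_finite_support[OF locally_finite]) (simp add: h1 off)
      also have "\<dots> = (\<Sum>z\<in>E `` {x}. ennreal (trans_prob E \<mu> x z * heat_kernel E \<mu> n z y))"
      proof (intro sum.cong refl)
        fix z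
        have "trans_prob E \<mu> x z * heat_kernel E \<mu> n z y = heat_kernel E \<mu> (Suc 0) x z * heat_kernel E \<mu> n z y * vertex_weight E \<mu> z"
          using m[of z] by (simp add: h1 trans_prob_def)
        then show "?q (Suc 0) x z * ?q n z y * ?m z = ennreal (trans_prob E \<mu> x z * heat_kernel E \<mu> n z y)"
          by (simp only: ennreal_mult nn mult_nonneg_nonneg less_imp_le[OF m])
      qed
      also have "\<dots> = ennreal (\<Sum>z\<in>E `` {x}. trans_prob E \<mu> x z * heat_kernel E \<mu> n z y)"
        using nn m by (intro sum_ennreal mult_nonneg_nonneg) (auto simp: trans_prob_def intro!: divide_nonneg_pos weight_nonneg)
      also have "(\<Sum>z\<in>E `` {x}. trans_prob E \<mu> x z * heat_kernel E \<mu> n z y) = heat_kernel E \<mu> (Suc n) x y"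
        by (simp add: heat_kernel_def sum_divide_distrib)
      finally show ?thesis ..
    qed
  qed
qed

end

lemma iter_kernel_1:
  assumes "\<And>x. m x > (0::real)"
  shows "iter_kernel m k (Suc 0) x y = k x y"
proof -
  have "((\<lambda>z. k x z * (if z = y then 1 / m z else 0) * m z) has_sum (\<Sum>z\<in>{y}. k x z * (if z = y then 1 / m z else 0) * m z)) {y}"
    by (rule has_sum_finite) simp
  then have "((\<lambda>z. k x z * (if z = y then 1 / m z else 0) * m z) has_sum k x y) {y}"
    using assms[of y] by simp
  then have "((\<lambda>z. k x z * (if z = y then 1 / m z else 0) * m z) has_sum k x y) UNIV"
    by (subst has_sum_cong_neutral[where T = "{y}"]) auto
  moreover have "(\<lambda>z. k x z * (if z = y then 1 / m z else 0) * m z) = (\<lambda>z. k x z * iter_kernel m k 0 z y * m z)"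
    by auto
  ultimately show ?thesis by (simp add: infsumI)
qed

lemma markov_semigroup_iter_kernel:
  fixes k :: "'v \<Rightarrow> 'v \<Rightarrow> real"
  assumes K: "symmetric_markov_kernel m k" and m: "\<And>x. m x > 0"
  shows "markov_semigroup (\<lambda>x. ennreal (m x)) (\<lambda>n x y. ennreal (iter_kernel m k n x y))"
    (is "markov_semigroup ?m ?q")
    and "iter_kernel m k n x y \<ge> 0"
proof -
  have k0: "k x y \<ge> 0" and ksym: "k x y = k y x" and k1: "((\<lambda>y. k x y * m y) has_sum 1) UNIV" for x y
    using K by (auto simp: symmetric_markov_kernel_def)
  show nn: "iter_kernel m k n x y \<ge> 0" for n x y
    using iter_kernel_has_sum[OF K m, of "\<lambda>_. 0" 0 n] by simp
  have mass: "((\<lambda>y. iter_kernel m k n x y * m y) has_sum 1) UNIV" for n x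
    using iter_kernel_has_sum[OF K m, of "\<lambda>_. 0" 0 n] by simp
  have m0: "m x \<ge> 0" for x using m[of x] by simp
  have bd: "iter_kernel m k n x y * m y \<le> 1" for n x y
  proof -
    have "(\<Sum>y\<in>{y}. iter_kernel m k n x y * m y) \<le> 1"
      by (rule finite_sum_le_has_sum[OF mass]) (use nn m0 in auto)
    then show ?thesis by simp
  qed
  show "markov_semigroup ?m ?q"
  proof
    show "0 < ?m x" "?m x < top" for x using m by auto
    show "?q 0 x y = (if x = y then 1 / ?m x else 0)" for x y
      using m[of y] divide_ennreal[of 1 "m y"] by simp
    show "?q (Suc 0) x y = ?q (Suc 0) y x" for x y
      unfolding iter_kernel_1[OF m] by (simp add: ksym)
    show "usum (\<lambda>y. ?q (Suc 0) x y * ?m y) = 1" for x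
    proof -
      have "usum (\<lambda>y. ?q (Suc 0) x y * ?m y) = usum (\<lambda>y. ennreal (k x y * m y))"
        unfolding iter_kernel_1[OF m] by (simp add: ennreal_mult k0 m0)
      also have "\<dots> = ennreal (\<Sum>\<^sub>\<infinity>y. k x y * m y)"
        by (rule usum_eq_infsum) (use k1[of x] k0 m0 in \<open>auto simp: summable_on_def\<close>)
      finally show ?thesis using infsumI[OF k1[of x]] by simp
    qed
    show "?q (Suc n) x y = usum (\<lambda>z. ?q (Suc 0) x z * ?q n z y * ?m z)" for n x y
    proof -
      \<comment> \<open>Mass one bounds the n-th iterate at (z, y) by 1 / m y; this majorant makes
        the series defining the next iterate summable.\<close>
      have sm: "(\<lambda>z. k x z * m z * (1 / m y)) summable_on UNIV"
        using k1[of x] by (intro summable_on_cmult_left) (auto simp: summable_on_def)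
      have "(\<lambda>z. k x z * iter_kernel m k n z y * m z) summable_on UNIV"
      proof (rule summable_on_comparison_test[OF sm])
        fix z
        have "iter_kernel m k n z y \<le> 1 / m y" using bd[of n z y] m[of y] by (simp add: field_simps)
        then have "(k x z * m z) * iter_kernel m k n z y \<le> (k x z * m z) * (1 / m y)"
          by (intro mult_left_mono mult_nonneg_nonneg k0 m0)
        then show "k x z * iter_kernel m k n z y * m z \<le> k x z * m z * (1 / m y)"
          by (simp add: mult_ac)
        show "0 \<le> k x z * iter_kernel m k n z y * m z" by (intro mult_nonneg_nonneg k0 m0 nn)
      qed
      then have "usum (\<lambda>z. ennreal (k x z * iter_kernel m k n z y * m z)) = ennreal (iter_kernel m k (Suc n) x y)"
        by (subst usum_eq_infsum) (auto intro!: mult_nonneg_nonneg k0 m0 nn)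
      then show ?thesis
        unfolding iter_kernel_1[OF m] by (simp add: ennreal_mult k0 m0 nn)
    qed
  qed
qed


section \<open>Subordination sums\<close>

text \<open>Growth of V and \<phi> at radii at least 1, where all estimates take place. In the
  application \<alpha> = \<beta>/2 comes from the Potter bound, R = 8 \<open>Ch\<close>^2 from the
  linear volume growth, and D, D' are the doubling exponents of V and \<phi>.\<close>

locale scale_functions =
  fixes V \<phi> :: "real \<Rightarrow> real" and \<gamma> \<alpha> R B :: real and D D' :: nat
  assumes gamma: "\<gamma> > 1" and alpha: "\<alpha> > 0" and R_pos: "R > 0" and B_pos: "B > 0"
    and V_pos: "0 \<le> t \<Longrightarrow> V t > 0"
    and V_mono: "0 \<le> s \<Longrightarrow> s \<le> t \<Longrightarrow> V s \<le> V t"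
    and V_upper: "1 \<le> t \<Longrightarrow> t \<le> s \<Longrightarrow> V s \<le> (2 * s / t) ^ D * V t"
    and V_lower: "1 \<le> t \<Longrightarrow> t \<le> s \<Longrightarrow> s / t * V t \<le> R * V s"
    and phi_ge_1: "0 \<le> t \<Longrightarrow> 1 \<le> \<phi> t"
    and phi_upper: "1 \<le> t \<Longrightarrow> t \<le> s \<Longrightarrow> \<phi> s \<le> (2 * s / t) ^ D' * \<phi> t"
    and phi_lower: "1 \<le> t \<Longrightarrow> t \<le> s \<Longrightarrow> (s / t) powr \<alpha> * \<phi> t \<le> B * \<phi> s"
begin

definition rho :: "nat \<Rightarrow> real" where "rho n = real n powr (1 / \<gamma>)"

text \<open>1/\<phi>(d) is the order of the probability that K jumps over a distance comparable to
  d; \<open>b n\<close> is its value at \<open>rho n\<close>, the distance covered by the natural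
  walk in n steps.\<close>

definition b :: "nat \<Rightarrow> real" where "b n = 1 / \<phi> (rho n)"

lemma phi_pos: "0 \<le> t \<Longrightarrow> 0 < \<phi> t"
  using phi_ge_1[of t] by simp

lemma rho_nonneg [simp]: "0 \<le> rho n"
  by (simp add: rho_def)

lemma rho_ge_1: "n \<ge> 1 \<Longrightarrow> 1 \<le> rho n"
  using gamma by (simp add: rho_def ge_one_powr_ge_zero)

lemma rho_mono: "m \<le> n \<Longrightarrow> rho m \<le> rho n"
  using gamma by (auto simp: rho_def intro!: powr_mono2)

lemma V_rho_pos [simp]: "0 < V (rho n)"
  by (simp add: V_pos)

lemma V_rho_neq_0 [simp]: "V (rho n) \<noteq> 0"
  using V_rho_pos[of n] by linarith

lemma V_rho_mono: "m \<le> n \<Longrightarrow> V (rho m) \<le> V (rho n)"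
  by (simp add: V_mono rho_mono)

lemma b_pos: "0 < b n" and b_le_1: "b n \<le> 1"
  using phi_ge_1[of "rho n"] by (auto simp: b_def)

lemma rho_powr: "rho n powr \<gamma> = real n"
  using gamma by (cases "n = 0") (auto simp: rho_def powr_powr)

lemma le_rho_iff: "0 \<le> d \<Longrightarrow> d \<le> rho n \<longleftrightarrow> d powr \<gamma> \<le> real n"
proof
  assume "0 \<le> d" "d \<le> rho n"
  then show "d powr \<gamma> \<le> real n"
    using powr_mono2[of \<gamma> d "rho n"] gamma by (simp add: rho_powr)
next
  assume d: "0 \<le> d" "d powr \<gamma> \<le> real n"
  then have "(d powr \<gamma>) powr (1 / \<gamma>) \<le> rho n"
    unfolding rho_def using gamma by (intro powr_mono2) auto
  then show "d \<le> rho n" using gamma d by (simp add: powr_powr)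
qed

lemma V_rho_le:
  assumes "1 \<le> n" "n \<le> t" "real t \<le> Q * real n"
  shows "V (rho t) \<le> (2 * Q) ^ D * V (rho n)"
proof -
  have "Q * real n \<ge> 1 * real n" using assms by linarith
  then have Q: "Q \<ge> 1" using assms(1) by (auto simp: mult_le_cancel_right)
  have "rho t \<le> (Q * real n) powr (1 / \<gamma>)"
    unfolding rho_def using assms gamma by (intro powr_mono2) auto
  also have "\<dots> = Q powr (1 / \<gamma>) * rho n" using Q by (simp add: rho_def powr_mult)
  also have "Q powr (1 / \<gamma>) \<le> Q powr 1" using Q gamma by (intro powr_mono) auto
  finally have le: "rho t / rho n \<le> Q"
    using Q rho_ge_1[OF assms(1)] by (simp add: field_simps mult_right_mono)
  have "V (rho t) \<le> (2 * rho t / rho n) ^ D * V (rho n)"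
    using assms by (intro V_upper rho_ge_1 rho_mono)
  also have "\<dots> \<le> (2 * Q) ^ D * V (rho n)"
    using le by (intro mult_right_mono power_mono) (auto simp: less_imp_le)
  finally show ?thesis .
qed

text \<open>The times are split at d^\<gamma>: earlier ones are damped by the exponential, later
  ones are summed by means of the Potter bound. The heat kernel bound is taken at the even times 2n
  because the energies are compared along even powers.\<close>

lemma kernel_sum_upper:
  assumes C: "C > 0"
  obtains C' where "C' > 0"
    "\<And>d N. d \<ge> 1 \<Longrightarrow> (\<Sum>n\<in>{1..N}. b n / real n * (C / V (rho (2 * n)) *
        exp (- ((d powr \<gamma> / (C * real (2 * n))) powr (1 / (\<gamma> - 1)))))) \<le> C' / (V d * \<phi> d)"
proof -
  \<comment> \<open>D + D' powers of r = n / d^\<gamma> offset the growth of V and \<phi> from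
    \<open>rho n\<close> to d. The extra power turns the weight 1/n into 1/X, where X = d^\<gamma>,
    so the at most X early terms have one common bound \<open>C1 / (W * X)\<close>.\<close>
  define \<kappa> where "\<kappa> = D + D' + 1"
  obtain Ce where Ce: "Ce > 0"
    "\<And>r. 0 < r \<Longrightarrow> r \<le> 1 \<Longrightarrow> exp (- ((1 / ((2 * C) * r)) powr (1 / (\<gamma> - 1)))) \<le> Ce * r ^ \<kappa>"
    using exp_neg_powr_bound[of "1 / (\<gamma> - 1)" "2 * C" \<kappa>] gamma C by auto
  obtain Ct where Ct: "Ct > 0"
    "\<And>X F. X \<ge> 1 \<Longrightarrow> finite F \<Longrightarrow> (\<And>n. n \<in> F \<Longrightarrow> real n \<ge> X) \<Longrightarrow>
       (\<Sum>n\<in>F. real n powr (- 1 - \<alpha> / \<gamma>)) \<le> Ct * X powr (- (\<alpha> / \<gamma>))"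
    using powr_tail_sum[of "\<alpha> / \<gamma>"] gamma alpha by (metis divide_pos_pos less_trans zero_less_one)
  define C1 where "C1 = C * Ce * 2 ^ (D + D')"
  define C2 where "C2 = B * C * Ct"
  show thesis
  proof (rule that[of "C1 + C2"])
    show "C1 + C2 > 0" using C Ce Ct B_pos by (simp add: C1_def C2_def add_pos_pos)
    fix d :: real and N :: nat assume d: "d \<ge> 1"
    define W where "W = V d * \<phi> d"
    have W: "W > 0" using d by (simp add: W_def V_pos phi_pos)
    define X where "X = d powr \<gamma>"
    have X: "X \<ge> 1" using d gamma by (simp add: X_def ge_one_powr_ge_zero)
    define h where "h n = b n / real n * (C / V (rho (2 * n)) *
        exp (- ((X / (C * real (2 * n))) powr (1 / (\<gamma> - 1)))))" for n
    define near where "near = {n\<in>{1..N}. real n < X}"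
    define far where "far = {n\<in>{1..N}. real n \<ge> X}"
    have split: "(\<Sum>n\<in>{1..N}. h n) = (\<Sum>n\<in>near. h n) + (\<Sum>n\<in>far. h n)"
      by (subst sum.union_disjoint[symmetric]) (auto simp: near_def far_def intro!: sum.cong)
    have hn: "h n \<le> C1 / (W * X)" if n: "n \<in> near" for n
    proof -
      define r where "r = real n / X"
      have n1: "n \<ge> 1" "real n < X" using n by (auto simp: near_def)
      have r: "0 < r" "r \<le> 1" using n1 X by (auto simp: r_def)
      have "\<not> d \<le> rho n" using le_rho_iff[of d n] d n1 by (simp add: X_def)
      then have rd: "rho n \<le> d" by simp
      have "d / rho n = (X / real n) powr (1 / \<gamma>)"
        using n1 d gamma by (simp add: X_def rho_def powr_divide powr_powr)
      also have "\<dots> \<le> (X / real n) powr 1" using n1 gamma by (intro powr_mono) auto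
      finally have "2 * d / rho n \<le> 2 / r" using n1 X by (simp add: r_def)
      then have pw: "(2 * d / rho n) ^ j \<le> (2 / r) ^ j" for j using d by (intro power_mono) auto
      have "V d \<le> (2 * d / rho n) ^ D * V (rho n)" using n1 rd by (intro V_upper rho_ge_1)
      also have "\<dots> \<le> (2 / r) ^ D * V (rho n)" by (intro mult_right_mono pw) (simp add: less_imp_le)
      finally have Vd: "V d \<le> (2 / r) ^ D * V (rho n)" .
      have "\<phi> d \<le> (2 * d / rho n) ^ D' * \<phi> (rho n)" using n1 rd by (intro phi_upper rho_ge_1)
      also have "\<dots> \<le> (2 / r) ^ D' * \<phi> (rho n)"
        by (intro mult_right_mono pw) (simp add: less_imp_le phi_pos)
      finally have "W \<le> ((2 / r) ^ D * V (rho n)) * ((2 / r) ^ D' * \<phi> (rho n))"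
        unfolding W_def using Vd d r by (intro mult_mono) (auto simp: less_imp_le phi_pos V_pos)
      then have "W * r ^ (D + D') \<le> 2 ^ (D + D') * (V (rho n) * \<phi> (rho n))"
        using r by (simp add: power_divide power_add field_simps)
      then have inv: "1 / (V (rho n) * \<phi> (rho n)) * r ^ (D + D') \<le> 2 ^ (D + D') / W"
        using W phi_pos[of "rho n"] by (simp add: field_simps)
      have ex: "exp (- ((X / (C * real (2 * n))) powr (1 / (\<gamma> - 1)))) \<le> Ce * r ^ \<kappa>"
      proof -
        have "X / (C * real (2 * n)) = 1 / ((2 * C) * r)" using n1 X by (simp add: r_def)
        then show ?thesis using Ce(2)[OF r] by simp
      qed
      have "h n \<le> b n / real n * (C / V (rho n) * (Ce * r ^ \<kappa>))"
        unfolding h_def using C ex Ce r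
        by (intro mult_left_mono mult_mono divide_left_mono V_rho_mono)
           (auto simp: b_pos less_imp_le)
      also have "\<dots> = C * Ce * (r / real n) * (1 / (V (rho n) * \<phi> (rho n)) * r ^ (D + D'))"
        by (simp add: b_def \<kappa>_def field_simps)
      also have "\<dots> \<le> C * Ce * (r / real n) * (2 ^ (D + D') / W)"
        using C Ce r inv by (intro mult_left_mono) auto
      also have "\<dots> = C1 / (W * X)" using n1 X by (simp add: C1_def r_def field_simps)
      finally show ?thesis .
    qed
    have "(\<Sum>n\<in>near. h n) \<le> (\<Sum>n\<in>near. C1 / (W * X))" by (intro sum_mono hn)
    also have "\<dots> = real (card near) * (C1 / (W * X))" by simp
    also have "\<dots> \<le> X * (C1 / (W * X))"
    proof (rule mult_right_mono)
      have "near \<subseteq> {1..nat \<lfloor>X\<rfloor>}" using X by (auto simp: near_def le_nat_floor)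
      then have "card near \<le> nat \<lfloor>X\<rfloor>" using card_mono[of "{1..nat \<lfloor>X\<rfloor>}" near] by simp
      then show "real (card near) \<le> X" using X by linarith
      show "0 \<le> C1 / (W * X)" using C Ce W X by (simp add: C1_def)
    qed
    finally have near: "(\<Sum>n\<in>near. h n) \<le> C1 / W" using X by simp
    have hf: "h n \<le> B * C / W * d powr \<alpha> * real n powr (- 1 - \<alpha> / \<gamma>)" if n: "n \<in> far" for n
    proof -
      have n1: "n \<ge> 1" "real n \<ge> X" using n by (auto simp: far_def)
      have rd: "d \<le> rho n" using le_rho_iff[of d n] d n1 by (simp add: X_def)
      have "(rho n / d) powr \<alpha> * \<phi> d \<le> B * \<phi> (rho n)" using d rd by (rule phi_lower)
      moreover have "(rho n / d) powr \<alpha> = real n powr (\<alpha> / \<gamma>) / d powr \<alpha>"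
        using d by (simp add: rho_def powr_divide powr_powr)
      ultimately have "real n powr (\<alpha> / \<gamma>) * \<phi> d \<le> B * \<phi> (rho n) * d powr \<alpha>"
        using d by (simp add: field_simps)
      then have bn: "b n \<le> B * d powr \<alpha> * real n powr (- (\<alpha> / \<gamma>)) / \<phi> d"
        using n1 d phi_pos[of d] phi_pos[of "rho n"] by (simp add: b_def powr_minus field_simps)
      have "V d \<le> V (rho (2 * n))" using rd rho_mono[of n "2 * n"] d by (intro V_mono) auto
      then have Cv: "C / V (rho (2 * n)) * exp (- ((X / (C * real (2 * n))) powr (1 / (\<gamma> - 1)))) \<le> C / V d * 1"
        using C d by (intro mult_mono divide_left_mono) (auto simp: V_pos less_imp_le)
      have "h n \<le> (B * d powr \<alpha> * real n powr (- (\<alpha> / \<gamma>)) / \<phi> d) / real n * (C / V d * 1)"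
        unfolding h_def using C B_pos d
        by (intro mult_mono[OF divide_right_mono[OF bn] Cv]) (auto simp: less_imp_le V_pos phi_pos)
      also have "\<dots> = B * C / W * d powr \<alpha> * (real n powr (- (\<alpha> / \<gamma>)) / real n)"
        using d V_pos[of d] phi_pos[of d] by (simp add: W_def field_simps)
      also have "real n powr (- (\<alpha> / \<gamma>)) / real n = real n powr (- 1 - \<alpha> / \<gamma>)"
        using n1 by (simp add: powr_diff powr_minus field_simps)
      finally show ?thesis .
    qed
    have "(\<Sum>n\<in>far. h n) \<le> B * C / W * d powr \<alpha> * (\<Sum>n\<in>far. real n powr (- 1 - \<alpha> / \<gamma>))"
      unfolding sum_distrib_left by (intro sum_mono hf)
    also have "\<dots> \<le> B * C / W * d powr \<alpha> * (Ct * X powr (- (\<alpha> / \<gamma>)))"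
      using B_pos C W by (intro mult_left_mono Ct(2) X) (auto simp: far_def)
    also have "X powr (- (\<alpha> / \<gamma>)) = 1 / d powr \<alpha>"
      using gamma by (simp add: X_def powr_powr powr_minus field_simps)
    also have "B * C / W * d powr \<alpha> * (Ct * (1 / d powr \<alpha>)) = C2 / W"
      using d by (simp add: C2_def)
    finally have "(\<Sum>n\<in>{1..N}. h n) \<le> (C1 + C2) / W"
      using near unfolding split add_divide_distrib by linarith
    then show "(\<Sum>n\<in>{1..N}. b n / real n * (C / V (rho (2 * n)) *
        exp (- ((d powr \<gamma> / (C * real (2 * n))) powr (1 / (\<gamma> - 1)))))) \<le> (C1 + C2) / (V d * \<phi> d)"
      by (simp only: h_def X_def W_def)
  qed
qed

text \<open>One time scale for the distance d \<ge> 1: at least d^\<gamma> integers, all between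
  d^\<gamma> and 4 d^\<gamma> because rounding up at most doubles d^\<gamma>. There V, \<phi> and
  the exponential factor change only by constants.\<close>

definition shell :: "real \<Rightarrow> nat set" where
  "shell d = {nat \<lceil>d powr \<gamma>\<rceil>..2 * nat \<lceil>d powr \<gamma>\<rceil>}"

lemma shell:
  assumes d: "d \<ge> 1" and n: "n \<in> shell d"
  shows "d powr \<gamma> \<le> real n" "real n \<le> 4 * d powr \<gamma>" "n \<ge> 1" "d \<le> rho n"
    "1 / (8 ^ (D + D') * (V d * \<phi> d)) \<le> b n / V (rho n)"
proof -
  have X: "d powr \<gamma> \<ge> 1" using d gamma by (simp add: ge_one_powr_ge_zero)
  show 1: "d powr \<gamma> \<le> real n" and 2: "real n \<le> 4 * d powr \<gamma>"
    using n X by (auto simp: shell_def nat_le_iff ceiling_le_iff; linarith)+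
  show "n \<ge> 1" using 1 X by linarith
  show rd: "d \<le> rho n" using 1 d by (simp add: le_rho_iff)
  have "rho n \<le> (4 * d powr \<gamma>) powr (1 / \<gamma>)"
    unfolding rho_def using 2 gamma by (intro powr_mono2) auto
  also have "\<dots> = 4 powr (1 / \<gamma>) * d" using d gamma by (simp add: powr_mult powr_powr)
  also have "4 powr (1 / \<gamma>) \<le> (4::real) powr 1" using gamma by (intro powr_mono) auto
  finally have "rho n \<le> 4 * d" using d by simp
  \<comment> \<open>The base 8 combines \<open>rho n\<close> \<le> 4 d with the 2 built into
    \<open>V_upper\<close> and \<open>phi_upper\<close>.\<close>
  then have q: "2 * rho n / d \<le> 8" using d by (simp add: field_simps)
  have "V (rho n) \<le> (2 * rho n / d) ^ D * V d" using d rd by (rule V_upper)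
  also have "\<dots> \<le> 8 ^ D * V d" using q d by (intro mult_right_mono power_mono) (auto simp: V_pos less_imp_le)
  finally have V8: "V (rho n) \<le> 8 ^ D * V d" .
  have "\<phi> (rho n) \<le> (2 * rho n / d) ^ D' * \<phi> d" using d rd by (rule phi_upper)
  also have "\<dots> \<le> 8 ^ D' * \<phi> d" using q d by (intro mult_right_mono power_mono) (auto simp: phi_pos less_imp_le)
  finally have "V (rho n) * \<phi> (rho n) \<le> (8 ^ D * V d) * (8 ^ D' * \<phi> d)"
    using V8 d by (intro mult_mono) (auto simp: phi_pos V_pos less_imp_le)
  also have "\<dots> = 8 ^ (D + D') * (V d * \<phi> d)" by (simp add: power_add)
  finally have "1 / (8 ^ (D + D') * (V d * \<phi> d)) \<le> 1 / (V (rho n) * \<phi> (rho n))"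
    using d by (intro divide_left_mono) (auto simp: phi_pos V_pos)
  then show "1 / (8 ^ (D + D') * (V d * \<phi> d)) \<le> b n / V (rho n)"
    by (simp add: b_def mult.commute)
qed

lemma card_shell: "d \<ge> 1 \<Longrightarrow> real (card (shell d)) \<ge> d powr \<gamma>"
  unfolding shell_def by (simp, linarith)

lemma kernel_sum_lower:
  assumes c: "c > 0"
  obtains c' where "c' > 0"
    "\<And>d. d \<ge> 1 \<Longrightarrow> c' / (V d * \<phi> d) \<le> (\<Sum>n\<in>shell d. b n / real n * (c / V (rho n) *
        exp (- ((d powr \<gamma> / (c * real n)) powr (1 / (\<gamma> - 1))))))"
proof -
  define e where "e = exp (- ((1 / c) powr (1 / (\<gamma> - 1))))"
  define c' where "c' = c * e / (4 * 8 ^ (D + D'))"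
  show thesis
  proof (rule that[of c'])
    show "c' > 0" using c by (simp add: c'_def e_def)
    fix d :: real assume d: "d \<ge> 1"
    define X where "X = d powr \<gamma>"
    have X: "X \<ge> 1" using d gamma by (simp add: X_def ge_one_powr_ge_zero)
    have W: "V d * \<phi> d > 0" using d by (simp add: V_pos phi_pos)
    have summand: "c' / (V d * \<phi> d) / X \<le> b n / real n * (c / V (rho n) *
        exp (- ((X / (c * real n)) powr (1 / (\<gamma> - 1)))))" if n: "n \<in> shell d" for n
    proof -
      note s = shell[OF d n, folded X_def]
      have "X / (c * real n) \<le> 1 / c" using s c by (simp add: field_simps)
      then have e: "e \<le> exp (- ((X / (c * real n)) powr (1 / (\<gamma> - 1))))"
        unfolding e_def using gamma c X s by (auto intro!: powr_mono2)
      have "c' / (V d * \<phi> d) / X = (1 / (4 * X)) * (c * e) * (1 / (8 ^ (D + D') * (V d * \<phi> d)))"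
        by (simp add: c'_def)
      also have "\<dots> \<le> (1 / real n) * (c * e) * (b n / V (rho n))"
        using s X c W by (intro mult_mono divide_left_mono) (auto simp: e_def)
      also have "\<dots> = b n / real n * (c / V (rho n) * e)" by simp
      also have "\<dots> \<le> b n / real n * (c / V (rho n) * exp (- ((X / (c * real n)) powr (1 / (\<gamma> - 1)))))"
        using e c by (intro mult_left_mono) (auto simp: b_pos less_imp_le)
      finally show ?thesis .
    qed
    have "c' / (V d * \<phi> d) = X * (c' / (V d * \<phi> d) / X)" using X by simp
    also have "\<dots> \<le> real (card (shell d)) * (c' / (V d * \<phi> d) / X)"
      using card_shell[OF d, folded X_def] \<open>c' > 0\<close> W X by (intro mult_right_mono) auto
    also have "\<dots> = (\<Sum>n\<in>shell d. c' / (V d * \<phi> d) / X)" by simp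
    also have "\<dots> \<le> (\<Sum>n\<in>shell d. b n / real n * (c / V (rho n) *
        exp (- ((X / (c * real n)) powr (1 / (\<gamma> - 1))))))"
      by (intro sum_mono summand)
    finally show "c' / (V d * \<phi> d) \<le> (\<Sum>n\<in>shell d. b n / real n * (c / V (rho n) *
        exp (- ((d powr \<gamma> / (c * real n)) powr (1 / (\<gamma> - 1))))))"
      by (simp only: X_def)
  qed
qed

lemma powr_le_shell_sum:
  assumes d: "d \<ge> 1"
  shows "d powr \<gamma> / (V d * \<phi> d) \<le> 8 ^ (D + D') * (\<Sum>n\<in>shell d. b n / V (rho n))"
proof -
  have W: "V d * \<phi> d > 0" using d by (simp add: V_pos phi_pos)
  have "d powr \<gamma> * (1 / (8 ^ (D + D') * (V d * \<phi> d))) \<le> real (card (shell d)) * (1 / (8 ^ (D + D') * (V d * \<phi> d)))"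
    using card_shell[OF d] W by (intro mult_right_mono) auto
  also have "\<dots> = (\<Sum>n\<in>shell d. 1 / (8 ^ (D + D') * (V d * \<phi> d)))" by simp
  also have "\<dots> \<le> (\<Sum>n\<in>shell d. b n / V (rho n))" by (intro sum_mono shell d)
  finally show ?thesis using V_pos[of d] phi_pos[of d] d by (simp add: field_simps)
qed

text \<open>There are at most d^\<gamma> / \<epsilon> such n, and for each of them
  \<open>rho n\<close> \<ge> d allows V and \<phi> to be replaced by their values at d, at the cost
  of B. Together with \<open>powr_le_shell_sum\<close> this gives both directions of the comparison
  between the moment and the sum of \<open>b\<close>.\<close>

lemma annulus_sum_le:
  assumes d: "d \<ge> 1" and \<epsilon>: "\<epsilon> > 0"
  shows "(\<Sum>n\<in>{n\<in>{1..N}. d \<le> rho n \<and> \<epsilon> * real n < d powr \<gamma>}. b n / V (rho n))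
    \<le> B / \<epsilon> * (d powr \<gamma> / (V d * \<phi> d))"
proof -
  define I where "I = {n\<in>{1..N}. d \<le> rho n \<and> \<epsilon> * real n < d powr \<gamma>}"
  have W: "V d * \<phi> d > 0" using d by (simp add: V_pos phi_pos)
  have "b n / V (rho n) \<le> B / (V d * \<phi> d)" if "n \<in> I" for n
  proof -
    have n: "d \<le> rho n" "n \<ge> 1" using that by (auto simp: I_def)
    have "1 * \<phi> d \<le> (rho n / d) powr \<alpha> * \<phi> d"
      using n d alpha by (intro mult_right_mono ge_one_powr_ge_zero) (auto simp: phi_pos less_imp_le)
    also have "\<dots> \<le> B * \<phi> (rho n)" using d n by (intro phi_lower)
    finally have "V d * \<phi> d \<le> V (rho n) * (B * \<phi> (rho n))"
      using n d V_mono[of d "rho n"] by (intro mult_mono) (auto simp: phi_pos V_pos less_imp_le)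
    then show ?thesis using W phi_pos[of "rho n"] by (simp add: b_def field_simps)
  qed
  then have "(\<Sum>n\<in>I. b n / V (rho n)) \<le> real (card I) * (B / (V d * \<phi> d))"
    using sum_mono[of I "\<lambda>n. b n / V (rho n)" "\<lambda>_. B / (V d * \<phi> d)"] by simp
  also have "\<dots> \<le> d powr \<gamma> / \<epsilon> * (B / (V d * \<phi> d))"
  proof (rule mult_right_mono)
    have "I \<subseteq> {1..nat \<lfloor>d powr \<gamma> / \<epsilon>\<rfloor>}"
      using \<epsilon> by (auto simp: I_def field_simps intro!: le_nat_floor)
    then have "card I \<le> nat \<lfloor>d powr \<gamma> / \<epsilon>\<rfloor>" using card_mono[of "{1..nat \<lfloor>d powr \<gamma> / \<epsilon>\<rfloor>}" I] by simp
    moreover have "d powr \<gamma> / \<epsilon> \<ge> 0" using \<epsilon> by simp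
    ultimately show "real (card I) \<le> d powr \<gamma> / \<epsilon>" by linarith
    show "0 \<le> B / (V d * \<phi> d)" using W B_pos by simp
  qed
  finally show ?thesis using \<epsilon> by (simp add: I_def mult_ac)
qed

definition S :: "nat \<Rightarrow> real" where "S N = (\<Sum>n\<in>{1..N}. b n)"

lemma S_le: "S N \<le> real N"
  unfolding S_def using sum_mono[of "{1..N}" b "\<lambda>_. 1"] b_le_1 by simp

lemma S_mono: "M \<le> N \<Longrightarrow> S M \<le> S N"
  unfolding S_def by (intro sum_mono2) (auto simp: b_pos less_imp_le)

lemma S_ge: "N \<ge> 1 \<Longrightarrow> b 1 \<le> S N"
  using S_mono[of 1 N] by (simp add: S_def)

end


section \<open>Upper bounds for return probabilities\<close>

declare iter_kernel.simps [simp del]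

lemma usum_nat_le:
  fixes f :: "nat \<Rightarrow> ennreal"
  assumes "\<And>N. (\<Sum>n<N. f n) \<le> C"
  shows "usum f \<le> C"
  unfolding usum_def nn_integral_count_space_nat suminf_eq_SUP
  by (rule SUP_least) (rule assms)

section \<open>Comparison of the jump walk with powers of the natural walk\<close>

locale long_range_walk = weighted_graph E \<mu> + scale_functions V \<phi> \<gamma> \<alpha> R B D D'
  for E :: "'v rel" and \<mu> :: "'v \<Rightarrow> 'v \<Rightarrow> real" and V \<phi> \<gamma> \<alpha> R B D D' +
  fixes k :: "'v \<Rightarrow> 'v \<Rightarrow> real" and Cm Ch Cu cl Ck :: real
  assumes Cm: "Cm \<ge> 1"
    and count_lower: "inverse Cm \<le> vertex_weight E \<mu> x"
    and count_upper: "vertex_weight E \<mu> x \<le> Cm"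
    and Ch: "Ch > 1"
    and vol_lower: "r > 0 \<Longrightarrow> inverse Ch * V r \<le> volume E \<mu> x r"
    and vol_upper: "r > 0 \<Longrightarrow> volume E \<mu> x r \<le> Ch * V r"
    and Cu: "Cu > 0"
    and heat_upper: "n \<ge> 1 \<Longrightarrow> heat_kernel E \<mu> n x y \<le> sub_gaussian E V \<gamma> Cu n x y"
    and cl: "cl > 0"
    and heat_lower: "n \<ge> 1 \<Longrightarrow> graph_dist E x y \<le> n \<Longrightarrow>
      sub_gaussian E V \<gamma> cl n x y \<le> heat_kernel E \<mu> n x y + heat_kernel E \<mu> (Suc n) x y"
    and markov: "symmetric_markov_kernel (vertex_weight E \<mu>) k"
    and Ck: "Ck > 0"
    and jump_lower: "inverse Ck / (V (graph_dist E x y) * \<phi> (graph_dist E x y)) \<le> k x y"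
    and jump_upper: "k x y \<le> Ck / (V (graph_dist E x y) * \<phi> (graph_dist E x y))"
begin

abbreviation "m \<equiv> vertex_weight E \<mu>"
abbreviation "p \<equiv> heat_kernel E \<mu>"
abbreviation "kn \<equiv> iter_kernel (vertex_weight E \<mu>) k"
abbreviation "d x y \<equiv> real (graph_dist E x y)"

lemma m_gt_0: "0 < m x"
  using count_lower[of x] Cm by (smt (verit) inverse_positive_iff_positive)

lemma m_ge_0: "0 \<le> m x"
  using m_gt_0[of x] by simp

lemma k_nonneg: "0 \<le> k x y"
  using markov by (simp add: symmetric_markov_kernel_def)

lemma p_nonneg: "0 \<le> p n x y"
  by (rule markov_semigroup_heat_kernel(2)) (rule m_gt_0)

lemma kn_nonneg: "0 \<le> kn n x y"
  by (rule markov_semigroup_iter_kernel(2)) (rule markov m_gt_0)+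

lemma kn_1: "kn (Suc 0) x y = k x y"
  by (rule iter_kernel_1) (rule m_gt_0)

sublocale P: markov_semigroup "\<lambda>x. ennreal (m x)" "\<lambda>n x y. ennreal (p n x y)"
  by (rule markov_semigroup_heat_kernel(1)) (rule m_gt_0)

sublocale K: markov_semigroup "\<lambda>x. ennreal (m x)" "\<lambda>n x y. ennreal (kn n x y)"
  by (rule markov_semigroup_iter_kernel(1)) (rule markov m_gt_0)+

text \<open>\<open>form\<close> involves the weights only, so \<open>P.form\<close> and
  \<open>K.form\<close> are the same term. \<open>bil\<close> involves the kernel, and the agreement
  at time 0 has to be proved.\<close>

lemma bil_0_eq: "K.bil 0 f g = P.bil 0 f g"
  by (simp add: K.bil_0 P.bil_0)

lemma form_kn_1: "P.form (\<lambda>x y. ennreal (kn 1 x y)) f = P.form (\<lambda>x y. ennreal (k x y)) f"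
  by (simp only: One_nat_def kn_1)

lemma dist_ge_1: "x \<noteq> y \<Longrightarrow> 1 \<le> d x y"
  using graph_dist_eq_0_iff[of x y] by linarith

lemma sub_gaussian_le: "C > 0 \<Longrightarrow> sub_gaussian E V \<gamma> C n x y \<le> C / V (rho n)"
  unfolding sub_gaussian_def rho_def[symmetric] by (rule mult_right_le_one_le) (auto simp: less_imp_le)

lemma heat_even_le: "N \<ge> 1 \<Longrightarrow> p (2 * N) x y \<le> Cu / V (rho N)"
proof -
  assume N: "N \<ge> 1"
  have "p (2 * N) x y \<le> Cu / V (rho (2 * N))"
    using heat_upper[of "2 * N" x y] sub_gaussian_le[OF Cu, of "2 * N" x y] N by simp
  also have "\<dots> \<le> Cu / V (rho N)"
    using Cu by (intro divide_left_mono V_rho_mono) auto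
  finally show ?thesis .
qed

lemma heat_diag_lower: "n \<ge> 1 \<Longrightarrow> cl / V (rho n) \<le> p n x x + p (Suc n) x x"
  using heat_lower[of n x x] by (simp add: sub_gaussian_def rho_def)

lemma b_div_nonneg: "0 \<le> b n / real n"
  using b_pos[of n] by (simp add: less_imp_le)

lemma heat_sum_le_jump:
  obtains C where "C > 0"
    "\<And>x y N. x \<noteq> y \<Longrightarrow> (\<Sum>n\<in>{1..N}. b n / real n * p (2 * n) x y) \<le> C * k x y"
proof -
  obtain C' where C': "C' > 0" "\<And>d N. d \<ge> 1 \<Longrightarrow> (\<Sum>n\<in>{1..N}. b n / real n * (Cu / V (rho (2 * n)) *
        exp (- ((d powr \<gamma> / (Cu * real (2 * n))) powr (1 / (\<gamma> - 1)))))) \<le> C' / (V d * \<phi> d)"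
    using kernel_sum_upper[OF Cu] by blast
  show thesis
  proof (rule that[of "C' * Ck"])
    show "C' * Ck > 0" using C' Ck by simp
    fix x y :: 'v and N :: nat assume "x \<noteq> y"
    then have d: "d x y \<ge> 1" by (rule dist_ge_1)
    have "(\<Sum>n\<in>{1..N}. b n / real n * p (2 * n) x y) \<le> (\<Sum>n\<in>{1..N}. b n / real n * (Cu / V (rho (2 * n)) *
        exp (- ((d x y powr \<gamma> / (Cu * real (2 * n))) powr (1 / (\<gamma> - 1))))))"
    proof (intro sum_mono mult_left_mono)
      fix n assume n: "n \<in> {1..N}"
      show "p (2 * n) x y \<le> Cu / V (rho (2 * n)) *
        exp (- ((d x y powr \<gamma> / (Cu * real (2 * n))) powr (1 / (\<gamma> - 1))))"
        using heat_upper[of "2 * n" x y] n by (simp add: sub_gaussian_def rho_def)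
      show "0 \<le> b n / real n" by (rule b_div_nonneg)
    qed
    also have "\<dots> \<le> C' / (V (d x y) * \<phi> (d x y))" using d by (rule C'(2))
    also have "\<dots> = C' * Ck * (inverse Ck / (V (d x y) * \<phi> (d x y)))" using Ck by simp
    also have "\<dots> \<le> C' * Ck * k x y" using C' Ck by (intro mult_left_mono jump_lower) auto
    finally show "(\<Sum>n\<in>{1..N}. b n / real n * p (2 * n) x y) \<le> C' * Ck * k x y" .
  qed
qed

lemma jump_le_heat_sum:
  obtains C where "C > 0"
    "\<And>x y. x \<noteq> y \<Longrightarrow> k x y \<le> C * (\<Sum>n\<in>shell (d x y). b n / real n * (p n x y + p (Suc n) x y))"
proof -
  obtain c' where c': "c' > 0"
    "\<And>d. d \<ge> 1 \<Longrightarrow> c' / (V d * \<phi> d) \<le> (\<Sum>n\<in>shell d. b n / real n * (cl / V (rho n) *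
        exp (- ((d powr \<gamma> / (cl * real n)) powr (1 / (\<gamma> - 1))))))"
    using kernel_sum_lower[OF cl] by blast
  show thesis
  proof (rule that[of "Ck / c'"])
    show "Ck / c' > 0" using c' Ck by simp
    fix x y :: 'v assume "x \<noteq> y"
    then have d: "d x y \<ge> 1" by (rule dist_ge_1)
    have "k x y \<le> Ck / (V (d x y) * \<phi> (d x y))" by (rule jump_upper)
    also have "\<dots> = Ck / c' * (c' / (V (d x y) * \<phi> (d x y)))" using c' by simp
    also have "\<dots> \<le> Ck / c' * (\<Sum>n\<in>shell (d x y). b n / real n * (cl / V (rho n) *
        exp (- ((d x y powr \<gamma> / (cl * real n)) powr (1 / (\<gamma> - 1))))))"
      using c' Ck d by (intro mult_left_mono c'(2)) auto
    also have "\<dots> \<le> Ck / c' * (\<Sum>n\<in>shell (d x y). b n / real n * (p n x y + p (Suc n) x y))"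
    proof (intro mult_left_mono sum_mono)
      fix n assume n: "n \<in> shell (d x y)"
      have "d x y = d x y powr 1" using d by simp
      also have "\<dots> \<le> d x y powr \<gamma>" using d gamma by (intro powr_mono) auto
      finally have "graph_dist E x y \<le> n" using shell(1)[OF d n] by linarith
      then show "cl / V (rho n) * exp (- ((d x y powr \<gamma> / (cl * real n)) powr (1 / (\<gamma> - 1)))) \<le> p n x y + p (Suc n) x y"
        using heat_lower[of n x y] shell(3)[OF d n] by (simp add: sub_gaussian_def rho_def)
      show "0 \<le> b n / real n" by (rule b_div_nonneg)
    qed (use c' Ck in auto)
    finally show "k x y \<le> Ck / c' * (\<Sum>n\<in>shell (d x y). b n / real n * (p n x y + p (Suc n) x y))" .
  qed
qed

text \<open>The first of two steps is a stay with probability at least c, by the jump bound at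
  distance 0 and (COUNT), so k_2 \<ge> c k. The decay of return probabilities is driven by ||f||^2 -
  ||K f||^2, the form of K^2 up to a factor, which spectrum of K near -1 could make much smaller
  than the form of K.\<close>

lemma form_jump_le_two_step:
  obtains c where "c > 0" "\<And>f. ennreal c * P.form (\<lambda>x y. ennreal (k x y)) f \<le> P.form (\<lambda>x y. ennreal (kn 2 x y)) f"
proof -
  define c where "c = inverse Cm * (inverse Ck / (V 0 * \<phi> 0))"
  have V0: "V 0 * \<phi> 0 > 0" by (simp add: V_pos phi_pos)
  then have c: "c > 0" using Cm Ck by (simp add: c_def)
  have le: "ennreal c * ennreal (k x y) \<le> ennreal (kn 2 x y)" for x y
  proof -
    have "c \<le> m x * k x x"
      unfolding c_def using jump_lower[of x x] count_lower[of x] Cm Ck V0 m_ge_0[of x]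
      by (intro mult_mono) auto
    then have "c * k x y \<le> (m x * k x x) * k x y" using k_nonneg by (intro mult_right_mono)
    then have "ennreal (c * k x y) \<le> ennreal ((m x * k x x) * k x y)" by (rule ennreal_leI)
    then have "ennreal c * ennreal (k x y) \<le> ennreal (k x x) * ennreal (k x y) * ennreal (m x)"
      using c k_nonneg m_ge_0 by (simp add: ennreal_mult mult_ac)
    also have "\<dots> \<le> usum (\<lambda>z. ennreal (k x z) * ennreal (k z y) * ennreal (m z))"
      using sum_le_usum[of "{x}" "\<lambda>z. ennreal (k x z) * ennreal (k z y) * ennreal (m z)"] by simp
    also have "\<dots> = ennreal (kn (Suc 0 + Suc 0) x y)"
      by (simp only: K.q_add kn_1)
    finally show ?thesis by (simp add: numeral_2_eq_2)
  qed
  show thesis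
  proof (rule that[OF c])
    fix f
    show "ennreal c * P.form (\<lambda>x y. ennreal (k x y)) f \<le> P.form (\<lambda>x y. ennreal (kn 2 x y)) f"
      unfolding P.form_cmult[symmetric] by (rule P.form_mono) (rule le)
  qed
qed

text \<open>Slicing: the jump kernel dominates a mixture of even powers of the natural walk, and
  convexity of \<open>n \<mapsto> \<parallel>P\<^sup>n f\<parallel>\<^sup>2\<close> reduces all of them to the single power \<open>2N\<close>.\<close>

lemma energy_lower:
  obtains c where "c > 0" "c \<le> 1"
    "\<And>f N. (\<And>x. f x < top) \<Longrightarrow> P.bil 0 f f < top \<Longrightarrow> N \<ge> 1 \<Longrightarrow>
      c * S N / real N * (enn2real (P.bil 0 f f) - enn2real (P.bil (2 * N) f f))
        \<le> enn2real (P.bil 0 f f) - enn2real (K.bil 2 f f)"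
proof -
  obtain C where C: "C > 0"
    "\<And>x y N. x \<noteq> y \<Longrightarrow> (\<Sum>n\<in>{1..N}. b n / real n * p (2 * n) x y) \<le> C * k x y"
    using heat_sum_le_jump by blast
  obtain e where e: "e > 0" "\<And>f. ennreal e * P.form (\<lambda>x y. ennreal (k x y)) f \<le> P.form (\<lambda>x y. ennreal (kn 2 x y)) f"
    using form_jump_le_two_step by blast
  \<comment> \<open>The minimum with 1 serves \<open>return_decay\<close>, where c S(N) / N must not
    exceed 1.\<close>
  define c where "c = min 1 (e / C)"
  show thesis
  proof (rule that[of c])
    show "c > 0" "c \<le> 1" using e C by (auto simp: c_def)
    fix f and N :: nat
    assume fin: "\<And>x. f x < top" and l2: "P.bil 0 f f < top" and N: "N \<ge> 1"
    define \<Delta> where "\<Delta> n = enn2real (P.bil 0 f f) - enn2real (P.bil (2 * n) f f)" for n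
    define G where "G = enn2real (P.bil 0 f f) - enn2real (K.bil 2 f f)"
    have \<Delta>0: "\<Delta> n \<ge> 0" for n using P.form_eq(3)[OF fin l2] by (simp add: \<Delta>_def)
    have l2': "K.bil 0 f f < top" using l2 by (simp add: bil_0_eq)
    have fP: "P.form (\<lambda>x y. ennreal (p (2 * n) x y)) f = ennreal (2 * \<Delta> n)" for n
      unfolding \<Delta>_def by (rule P.form_eq(1)[OF fin l2])
    have fK: "P.form (\<lambda>x y. ennreal (kn 2 x y)) f = ennreal (2 * G)"
      unfolding G_def using K.form_eq(1)[OF fin l2', of 2] by (simp add: bil_0_eq)
    have G0: "G \<ge> 0" using K.form_eq(3)[OF fin l2', of 2] by (simp add: G_def bil_0_eq)
    \<comment> \<open>Convexity gives \<open>\<Delta> n\<close> \<ge> (n/N)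
      \<open>\<Delta> N\<close>. The factor n cancels the weight 1/n, which leaves the plain sum
      \<open>S N\<close>.\<close>
    have "S N / real N * \<Delta> N \<le> (\<Sum>n\<in>{1..N}. b n / real n * \<Delta> n)"
    proof -
      have "S N / real N * \<Delta> N = (\<Sum>n\<in>{1..N}. b n / real n * (real n * \<Delta> N / real N))"
        by (simp add: S_def sum_divide_distrib sum_distrib_right)
      also have "\<dots> \<le> (\<Sum>n\<in>{1..N}. b n / real n * \<Delta> n)"
      proof (intro sum_mono mult_left_mono)
        fix n assume n: "n \<in> {1..N}"
        have "real n * \<Delta> N \<le> real N * \<Delta> n"
          unfolding \<Delta>_def using P.bil_even_slope[OF fin l2, of n N] n by simp
        then show "real n * \<Delta> N / real N \<le> \<Delta> n" using N by (simp add: field_simps)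
        show "0 \<le> b n / real n" using b_pos[of n] by (simp add: less_imp_le)
      qed
      finally show ?thesis .
    qed
    then have "2 * (S N / real N * \<Delta> N) \<le> 2 * (\<Sum>n\<in>{1..N}. b n / real n * \<Delta> n)" by simp
    also have "\<dots> = (\<Sum>n\<in>{1..N}. b n / real n * (2 * \<Delta> n))"
      by (simp add: sum_distrib_left mult_ac)
    finally have "ennreal (2 * (S N / real N * \<Delta> N)) \<le> ennreal (\<Sum>n\<in>{1..N}. b n / real n * (2 * \<Delta> n))"
      by (rule ennreal_leI)
    also have "\<dots> = (\<Sum>n\<in>{1..N}. ennreal (b n / real n) * ennreal (2 * \<Delta> n))"
      by (subst sum_ennreal[symmetric])
         (auto intro!: sum.cong ennreal_mult mult_nonneg_nonneg b_div_nonneg \<Delta>0 simp del: times_divide_eq_left times_divide_eq_right)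
    also have "\<dots> = P.form (\<lambda>x y. \<Sum>n\<in>{1..N}. ennreal (b n / real n) * ennreal (p (2 * n) x y)) f"
      by (simp only: P.form_sum P.form_cmult fP)
    also have "\<dots> \<le> P.form (\<lambda>x y. ennreal C * ennreal (k x y)) f"
    proof (rule P.form_mono)
      fix x y :: 'v assume "x \<noteq> y"
      have "(\<Sum>n\<in>{1..N}. ennreal (b n / real n) * ennreal (p (2 * n) x y)) =
          ennreal (\<Sum>n\<in>{1..N}. b n / real n * p (2 * n) x y)"
        by (subst sum_ennreal[symmetric])
           (auto intro!: sum.cong ennreal_mult[symmetric] mult_nonneg_nonneg b_div_nonneg p_nonneg simp del: times_divide_eq_left times_divide_eq_right)
      also have "\<dots> \<le> ennreal (C * k x y)" by (intro ennreal_leI C(2)) fact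
      finally show "(\<Sum>n\<in>{1..N}. ennreal (b n / real n) * ennreal (p (2 * n) x y)) \<le> ennreal C * ennreal (k x y)"
        using C k_nonneg by (simp add: ennreal_mult)
    qed
    also have "\<dots> = ennreal C * P.form (\<lambda>x y. ennreal (k x y)) f" by (rule P.form_cmult)
    finally have "ennreal e * ennreal (2 * (S N / real N * \<Delta> N)) \<le> ennreal e * (ennreal C * P.form (\<lambda>x y. ennreal (k x y)) f)"
      by (intro mult_left_mono) auto
    also have "\<dots> = ennreal C * (ennreal e * P.form (\<lambda>x y. ennreal (k x y)) f)" by (simp only: mult_ac)
    also have "\<dots> \<le> ennreal C * ennreal (2 * G)"
      using e(2)[of f] unfolding fK by (intro mult_left_mono) auto
    finally have "ennreal (e * (2 * (S N / real N * \<Delta> N))) \<le> ennreal (C * (2 * G))"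
      using e C G0 by (simp only: ennreal_mult' less_imp_le)
    then have "e * (2 * (S N / real N * \<Delta> N)) \<le> C * (2 * G)"
      using C G0 by (subst (asm) ennreal_le_iff) auto
    moreover have "e / C * Z \<le> G" if "e * (2 * Z) \<le> C * (2 * G)" for Z
      using that C(1) by (simp add: field_simps)
    ultimately have "e / C * (S N / real N * \<Delta> N) \<le> G" by blast
    moreover have "S N \<ge> 0" using S_mono[of 0 N] by (simp add: S_def)
    then have "c * (S N / real N * \<Delta> N) \<le> e / C * (S N / real N * \<Delta> N)"
      using \<Delta>0[of N] by (intro mult_right_mono) (auto simp: c_def)
    ultimately show "c * S N / real N * (enn2real (P.bil 0 f f) - enn2real (P.bil (2 * N) f f))
        \<le> enn2real (P.bil 0 f f) - enn2real (K.bil 2 f f)"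
      by (simp add: \<Delta>_def G_def)
  qed
qed

lemma kn_le_Cm: "kn n x x \<le> Cm"
proof -
  have "ennreal (kn n x x * m x) \<le> ennreal 1"
    using K.q_mult_m_le_1[of n x x] kn_nonneg m_ge_0 by (simp add: ennreal_mult)
  then have "kn n x x * m x \<le> 1" by (subst (asm) ennreal_le_iff) auto
  then have "kn n x x * inverse Cm \<le> 1"
    using mult_left_mono[OF count_lower[of x] kn_nonneg[of n x x]] by linarith
  then show ?thesis using Cm by (simp add: field_simps)
qed

text \<open>The energy bound is applied to f = k_t(x, .), which has mass one: ||f||^2 is k_2t(x, x),
  and (f, P^(2N) f) is at most the supremum of p_2N. Hence the excess of the return probability over
  the level Cu / V(rho N) shrinks by the factor 1 - \<theta> in each step. N stays free; the two
  applications choose it differently.\<close>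

lemma return_decay:
  obtains c where "c > 0"
    "\<And>x s t N. N \<ge> 1 \<Longrightarrow>
      kn (2 * (s + t)) x x \<le> Cu / V (rho N) + exp (- (c * S N / real N * real t)) * kn (2 * s) x x"
proof -
  obtain c where c: "c > 0" "c \<le> 1" and en:
    "\<And>f N. (\<And>x. f x < top) \<Longrightarrow> P.bil 0 f f < top \<Longrightarrow> N \<ge> 1 \<Longrightarrow>
      c * S N / real N * (enn2real (P.bil 0 f f) - enn2real (P.bil (2 * N) f f))
        \<le> enn2real (P.bil 0 f f) - enn2real (K.bil 2 f f)"
    using energy_lower by blast
  show thesis
  proof (rule that[OF c(1)])
    fix x :: 'v and s t N :: nat assume N: "N \<ge> 1"
    define \<theta> where "\<theta> = c * S N / real N"
    define \<psi> where "\<psi> = Cu / V (rho N)"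
    have \<psi>0: "\<psi> \<ge> 0" using Cu by (simp add: \<psi>_def less_imp_le)
    have S0: "S N \<ge> 0" using S_mono[of 0 N] by (simp add: S_def)
    have "c * S N \<le> 1 * real N" using c S0 S_le[of N] by (intro mult_mono) auto
    then have \<theta>: "0 \<le> \<theta>" "\<theta> \<le> 1" using c S0 N by (auto simp: \<theta>_def)
    have step: "kn (2 * Suc t) x x - \<psi> \<le> (1 - \<theta>) * (kn (2 * t) x x - \<psi>)" for t
    proof -
      define f where "f y = ennreal (kn t x y)" for y
      have bilK: "K.bil n f f = ennreal (kn (2 * t + n) x x)" for n
        using K.bil_q[of n t x t x] by (simp add: f_def[abs_def] mult_2 add_ac)
      have fin: "f y < top" for y by (simp add: f_def)
      have l2: "P.bil 0 f f < top" using bilK[of 0] by (simp add: bil_0_eq)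
      have "P.bil (2 * N) f f \<le> ennreal \<psi> * (usum (\<lambda>y. f y * ennreal (m y)) * usum (\<lambda>y. f y * ennreal (m y)))"
        unfolding \<psi>_def by (intro P.bil_le ennreal_leI heat_even_le N)
      also have "\<dots> = ennreal \<psi>" by (simp add: f_def K.q_mass)
      finally have le: "enn2real (P.bil (2 * N) f f) \<le> \<psi>"
        using \<psi>0 by (metis enn2real_ennreal enn2real_mono ennreal_less_top)
      have "\<theta> * (kn (2 * t) x x - \<psi>) \<le> \<theta> * (enn2real (P.bil 0 f f) - enn2real (P.bil (2 * N) f f))"
        using le \<theta> bilK[of 0] kn_nonneg by (intro mult_left_mono) (auto simp: bil_0_eq)
      also have "\<dots> \<le> enn2real (P.bil 0 f f) - enn2real (K.bil 2 f f)"
        unfolding \<theta>_def by (rule en[OF fin l2 N])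
      also have "\<dots> = kn (2 * t) x x - kn (2 * Suc t) x x"
        using bilK[of 0] bilK[of 2] kn_nonneg by (simp add: bil_0_eq)
      finally show ?thesis by (simp add: algebra_simps)
    qed
    have "kn (2 * (s + t)) x x - \<psi> \<le> (1 - \<theta>) ^ t * kn (2 * s) x x"
    proof (induction t)
      case (Suc t)
      have "kn (2 * Suc (s + t)) x x - \<psi> \<le> (1 - \<theta>) * (kn (2 * (s + t)) x x - \<psi>)" by (rule step)
      also have "\<dots> \<le> (1 - \<theta>) * ((1 - \<theta>) ^ t * kn (2 * s) x x)"
        using \<theta> by (intro mult_left_mono Suc) auto
      finally show ?case by (simp add: mult.assoc)
    qed (use \<psi>0 in simp)
    also have "\<dots> \<le> exp (- (\<theta> * real t)) * kn (2 * s) x x"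
    proof (rule mult_right_mono[OF _ kn_nonneg])
      have "(1 - \<theta>) ^ t \<le> exp (- \<theta>) ^ t"
        using \<theta> exp_ge_add_one_self[of "- \<theta>"] by (intro power_mono) auto
      also have "\<dots> = exp (- (\<theta> * real t))" by (simp add: exp_of_nat_mult[symmetric] mult.commute)
      finally show "(1 - \<theta>) ^ t \<le> exp (- (\<theta> * real t))" .
    qed
    finally show "kn (2 * (s + t)) x x \<le> Cu / V (rho N) + exp (- (c * S N / real N * real t)) * kn (2 * s) x x"
      by (simp add: \<theta>_def \<psi>_def)
  qed
qed

text \<open>Induction from s = t div 2 to t. The decay over the remaining t - s steps has to beat
  the doubling loss V(rho t) / V(rho s), while N comparable to t keeps the level at the right
  order.\<close>

lemma return_upper:
  obtains A where "A > 0" "\<And>x t. t \<ge> 1 \<Longrightarrow> kn (2 * t) x x \<le> A / V (rho t)"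
proof -
  obtain c where c: "c > 0" and dec: "\<And>x s t N. N \<ge> 1 \<Longrightarrow>
      kn (2 * (s + t)) x x \<le> Cu / V (rho N) + exp (- (c * S N / real N * real t)) * kn (2 * s) x x"
    using return_decay by blast
  define \<beta>0 where "\<beta>0 = c * b 1"
  have \<beta>0: "\<beta>0 > 0" using c b_pos by (simp add: \<beta>0_def)
  \<comment> \<open>N will be s div m0. Since S N \<ge> b 1, the exponent is then at least
    \<open>\<beta>0 * m0\<close>, large enough to beat the loss 6^D caused by t \<le> 3 s.\<close>
  obtain m0 :: nat where "real m0 \<ge> 2 * 6 ^ D / \<beta>0" using real_arch_simple by blast
  then have m0b: "\<beta>0 * real m0 \<ge> 2 * 6 ^ D" using \<beta>0 by (simp add: field_simps)
  moreover have "(6 :: real) ^ D > 0" by simp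
  ultimately have m0: "m0 \<ge> 1" by (cases m0) auto
  have ex: "exp (- (\<beta>0 * real m0)) * 6 ^ D \<le> 1 / 2"
  proof -
    have "2 * 6 ^ D \<le> exp (\<beta>0 * real m0)" using m0b exp_ge_add_one_self[of "\<beta>0 * real m0"] by linarith
    then show ?thesis by (simp add: exp_minus field_simps)
  qed
  \<comment> \<open>The first entry makes the level term at most A/2, the (12 m0)^D coming from t
    \<le> 6 m0 N; the second entry settles the times t < 2 m0.\<close>
  define A where "A = max (2 * Cu * (12 * real m0) ^ D) (Cm * V (rho (2 * m0)))"
  have A0: "A > 0" unfolding A_def using Cm V_rho_pos[of "2 * m0"] by (intro less_max_iff_disj[THEN iffD2] disjI2) simp
  show thesis
  proof (rule that[OF A0])
    fix x :: 'v and t :: nat assume "t \<ge> 1"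
    then show "kn (2 * t) x x \<le> A / V (rho t)"
    proof (induction t rule: less_induct)
      case (less t)
      show ?case
      proof (cases "t < 2 * m0")
        case True
        have "kn (2 * t) x x * V (rho t) \<le> Cm * V (rho (2 * m0))"
          using kn_le_Cm True Cm kn_nonneg by (intro mult_mono V_rho_mono) (auto simp: less_imp_le)
        also have "\<dots> \<le> A" by (simp add: A_def)
        finally show ?thesis by (simp add: field_simps)
      next
        case False
        define s where "s = t div 2"
        define N where "N = s div m0"
        have s: "s \<ge> m0" "s \<ge> 1" "s < t" "t \<le> 3 * s" "s \<le> t - s" using False m0 by (auto simp: s_def)
        have N: "N \<ge> 1" using s m0 by (simp add: N_def div_greater_zero_iff Suc_le_eq)
        have Ns: "N * m0 \<le> s" "s < m0 * (N + 1)"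
          using m0 by (auto simp: N_def dividend_less_times_div)
        have "m0 * (N + 1) \<le> m0 * (2 * N)" using N by (intro mult_left_mono) auto
        then have tN: "t \<le> 6 * m0 * N" using Ns s by linarith
        have "N * 1 \<le> N * m0" using m0 by (intro mult_left_mono) auto
        then have Nt: "N \<le> t" using Ns s by linarith
        have V1: "V (rho t) \<le> (12 * real m0) ^ D * V (rho N)"
          using V_rho_le[OF N Nt, of "6 * real m0"] of_nat_mono[OF tN, where 'a = real] by simp
        have V2: "V (rho t) \<le> 6 ^ D * V (rho s)"
          using V_rho_le[of s t 3] s by simp
        have IH: "kn (2 * s) x x \<le> A / V (rho s)" using s by (intro less.IH) auto
        have "\<beta>0 * real m0 = c * b 1 / real N * (real N * real m0)" using N by (simp add: \<beta>0_def)
        also have "\<dots> \<le> c * S N / real N * real (t - s)"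
        proof (intro mult_mono divide_right_mono mult_left_mono S_ge N)
          have "real (N * m0) \<le> real (t - s)" using Ns s by (intro of_nat_mono) linarith
          then show "real N * real m0 \<le> real (t - s)" by simp
        qed (use c b_pos order_trans[OF less_imp_le[OF b_pos] S_ge[OF N]] in \<open>auto simp: less_imp_le\<close>)
        finally have "exp (- (c * S N / real N * real (t - s))) \<le> exp (- (\<beta>0 * real m0))" by simp
        then have "exp (- (c * S N / real N * real (t - s))) * kn (2 * s) x x \<le> exp (- (\<beta>0 * real m0)) * (A / V (rho s))"
          using IH kn_nonneg by (intro mult_mono) auto
        then have "kn (2 * t) x x \<le> Cu / V (rho N) + exp (- (\<beta>0 * real m0)) * (A / V (rho s))"
          using dec[OF N, of s "t - s" x] s by simp
        then have "kn (2 * t) x x * V (rho t) \<le> (Cu / V (rho N) + exp (- (\<beta>0 * real m0)) * (A / V (rho s))) * V (rho t)"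
          by (intro mult_right_mono) (auto simp: less_imp_le)
        also have "\<dots> = Cu / V (rho N) * V (rho t) + exp (- (\<beta>0 * real m0)) * (A / V (rho s)) * V (rho t)"
          by (simp add: distrib_right)
        also have "\<dots> \<le> Cu / V (rho N) * ((12 * real m0) ^ D * V (rho N)) + exp (- (\<beta>0 * real m0)) * (A / V (rho s)) * (6 ^ D * V (rho s))"
          using V1 V2 Cu A0 by (intro add_mono mult_left_mono) (auto simp: less_imp_le)
        also have "\<dots> = Cu * (12 * real m0) ^ D + (exp (- (\<beta>0 * real m0)) * 6 ^ D) * A"
          using V_rho_pos[of N] V_rho_pos[of s] by (simp add: less_imp_neq[symmetric])
        also have "\<dots> \<le> A / 2 + (1 / 2) * A"
          using ex A0 by (intro add_mono mult_right_mono) (auto simp: A_def)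
        finally show ?thesis by (simp add: field_simps)
      qed
    qed
  qed
qed

text \<open>For N = M s the exponent is c S(N) / M, which is as large as desired for every fixed M
  once S is unbounded. A large M makes the level Cu / V(rho N) small compared with 1 / V(rho s), by
  the linear lower growth of V.\<close>

lemma return_small:
  assumes unb: "\<And>L. \<exists>N\<ge>1. S N \<ge> L" and \<eta>: "\<eta> > 0"
  obtains t where "t \<ge> 1" "\<And>x. kn (2 * t) x x \<le> \<eta> / V (rho t)"
proof -
  obtain c where c: "c > 0" and dec: "\<And>x s t N. N \<ge> 1 \<Longrightarrow>
      kn (2 * (s + t)) x x \<le> Cu / V (rho N) + exp (- (c * S N / real N * real t)) * kn (2 * s) x x"
    using return_decay by blast
  obtain A where A: "A > 0" "\<And>x t. t \<ge> 1 \<Longrightarrow> kn (2 * t) x x \<le> A / V (rho t)"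
    using return_upper by blast
  \<comment> \<open>Y and the later z make each of the two terms at most half of the target; 4^D is
    the price of passing from s to the final time 2 s.\<close>
  define Y where "Y = 2 * 4 ^ D * Cu * R / \<eta>"
  have Y: "Y > 0" using Cu R_pos \<eta> by (simp add: Y_def)
  obtain M :: nat where M: "real M \<ge> max 1 (Y powr \<gamma>)" using real_arch_simple by blast
  then have M1: "M \<ge> 1" and MY: "Y \<le> rho M" using Y by (auto simp: le_rho_iff)
  define z where "z = 2 * 4 ^ D * A / \<eta>"
  have z: "z > 0" using A \<eta> by (simp add: z_def)
  obtain s where s: "s \<ge> 1" "S s \<ge> real M / c * z" using unb by blast
  define N where "N = M * s"
  have N: "N \<ge> 1" "s \<le> N" using M1 s by (auto simp: N_def)
  have "z = c * (real M / c * z) / real M" using c M1 by simp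
  also have "\<dots> \<le> c * S N / real M"
    using s S_mono[OF N(2)] c by (intro divide_right_mono mult_left_mono) auto
  also have "\<dots> = c * S N / real N * real s" using s by (simp add: N_def)
  finally have zle: "z \<le> c * S N / real N * real s" .
  have "exp (- (c * S N / real N * real s)) \<le> exp (- z)" using zle by simp
  also have "\<dots> \<le> 1 / z"
  proof -
    have "z \<le> exp z" using exp_ge_add_one_self[of z] by linarith
    then show ?thesis using z by (simp add: exp_minus field_simps)
  qed
  finally have ez: "exp (- (c * S N / real N * real s)) \<le> 1 / z" .
  show thesis
  proof (rule that[of "2 * s"])
    show "2 * s \<ge> 1" using s by simp
    fix x
    have "rho N / rho s = rho M"
      using s by (simp add: rho_def N_def powr_mult)
    then have "rho M * V (rho s) \<le> R * V (rho N)"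
      using V_lower[of "rho s" "rho N"] rho_ge_1[OF s(1)] rho_mono[OF N(2)] by simp
    then have "Y * V (rho s) \<le> R * V (rho N)"
      using mult_right_mono[OF MY less_imp_le[OF V_rho_pos[of s]]] by linarith
    then have "Cu / V (rho N) \<le> Cu * R / (Y * V (rho s))"
      using Cu Y V_rho_pos[of s] V_rho_pos[of N] by (simp add: field_simps)
    also have "\<dots> = (\<eta> / (2 * 4 ^ D)) / V (rho s)"
      using Cu R_pos \<eta> by (simp add: Y_def)
    finally have t1: "Cu / V (rho N) \<le> (\<eta> / (2 * 4 ^ D)) / V (rho s)" .
    have "exp (- (c * S N / real N * real s)) * kn (2 * s) x x \<le> (1 / z) * (A / V (rho s))"
      using ez A(2)[OF s(1)] kn_nonneg z by (intro mult_mono) auto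
    also have "\<dots> = (\<eta> / (2 * 4 ^ D)) / V (rho s)" using A \<eta> by (simp add: z_def)
    finally have "kn (2 * (s + s)) x x \<le> 2 * ((\<eta> / (2 * 4 ^ D)) / V (rho s))"
      using dec[OF N(1), of s s x] t1 by linarith
    then have "kn (2 * (2 * s)) x x \<le> 2 * ((\<eta> / (2 * 4 ^ D)) / V (rho s))"
      by (simp only: mult_2[of s])
    also have "\<dots> = \<eta> / (4 ^ D * V (rho s))" by simp
    also have "\<dots> \<le> \<eta> / V (rho (2 * s))"
      using V_rho_le[of s "2 * s" 2] s \<eta> by (intro divide_left_mono) auto
    finally show "kn (2 * (2 * s)) x x \<le> \<eta> / V (rho (2 * s))" .
  qed
qed

end


section \<open>Lower bounds and moments\<close>

context long_range_walk
begin

section \<open>Lower bound on return probabilities when S is bounded\<close>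

lemma energy_upper:
  assumes bd: "\<And>N. S N \<le> Bd"
  obtains C where "C > 0"
    "\<And>f. (\<And>x. f x < top) \<Longrightarrow> P.bil 0 f f < top \<Longrightarrow>
      P.form (\<lambda>x y. ennreal (k x y)) f \<le> ennreal C * P.form (\<lambda>x y. ennreal (p 1 x y)) f"
proof -
  obtain C0 where C0: "C0 > 0"
    "\<And>x y. x \<noteq> y \<Longrightarrow> k x y \<le> C0 * (\<Sum>n\<in>shell (d x y). b n / real n * (p n x y + p (Suc n) x y))"
    using jump_le_heat_sum by blast
  have Bd: "Bd > 0" using bd[of 1] S_ge[of 1] b_pos[of 1] by simp
  show thesis
  proof (rule that[of "12 * C0 * Bd"])
    show "12 * C0 * Bd > 0" using C0 Bd by simp
    fix f assume fin: "\<And>x. f x < top" and l2: "P.bil 0 f f < top"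
    define a where "a n = C0 * (b n / real n)" for n
    have a0: "a n \<ge> 0" for n unfolding a_def by (intro mult_nonneg_nonneg b_div_nonneg less_imp_le C0)
    define F where "F = P.form (\<lambda>x y. ennreal (p 1 x y)) f"
    \<comment> \<open>The term n = 0 vanishes because b 0 / 0 = 0 in HOL, so the sum over all n is
      controlled by the partial sums S, which start at 1.\<close>
    define g where "g n = (if n = 0 then 0 else b n)" for n :: nat
    have g0: "g n \<ge> 0" for n using b_pos by (simp add: g_def less_imp_le)
    \<comment> \<open>The shell depends on x and y; enlarging it to all n gives a fixed mixture of
      powers, whose form is the sum of their forms. Linear growth of these forms in n then cancels
      the weight 1/n, and 12 comes from 4 n + 4 (n + 1) \<le> 12 n.\<close>
    have "P.form (\<lambda>x y. ennreal (k x y)) f \<le>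
        P.form (\<lambda>x y. usum (\<lambda>n. ennreal (a n) * (ennreal (p n x y) + ennreal (p (Suc n) x y)))) f"
    proof (rule P.form_mono)
      fix x y :: 'v assume "x \<noteq> y"
      then have "ennreal (k x y) \<le> ennreal (\<Sum>n\<in>shell (d x y). a n * (p n x y + p (Suc n) x y))"
        using C0(2)[of x y] by (intro ennreal_leI) (simp add: a_def sum_distrib_left mult.assoc)
      also have "\<dots> = (\<Sum>n\<in>shell (d x y). ennreal (a n) * (ennreal (p n x y) + ennreal (p (Suc n) x y)))"
        by (subst sum_ennreal[symmetric])
           (auto simp: a0 p_nonneg ennreal_mult ennreal_plus intro!: sum.cong)
      also have "\<dots> \<le> usum (\<lambda>n. ennreal (a n) * (ennreal (p n x y) + ennreal (p (Suc n) x y)))"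
        by (rule sum_le_usum) (simp add: shell_def)
      finally show "ennreal (k x y) \<le> usum (\<lambda>n. ennreal (a n) * (ennreal (p n x y) + ennreal (p (Suc n) x y)))" .
    qed
    also have "\<dots> = usum (\<lambda>n. ennreal (a n) * (P.form (\<lambda>x y. ennreal (p n x y)) f + P.form (\<lambda>x y. ennreal (p (Suc n) x y)) f))"
      by (simp only: P.form_usum P.form_cmult P.form_add)
    also have "\<dots> \<le> usum (\<lambda>n. ennreal (12 * C0) * F * ennreal (g n))"
    proof (rule usum_mono)
      fix n
      show "ennreal (a n) * (P.form (\<lambda>x y. ennreal (p n x y)) f + P.form (\<lambda>x y. ennreal (p (Suc n) x y)) f)
        \<le> ennreal (12 * C0) * F * ennreal (g n)"
      proof (cases "n = 0")
        case True
        then show ?thesis by (simp add: a_def)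
      next
        case False
        have "P.form (\<lambda>x y. ennreal (p n x y)) f + P.form (\<lambda>x y. ennreal (p (Suc n) x y)) f
            \<le> of_nat (4 * n) * F + of_nat (4 * Suc n) * F"
          unfolding F_def by (intro add_mono P.form_le_form_1 fin l2)
        also have "\<dots> = of_nat (4 * n + 4 * Suc n) * F" by (simp only: of_nat_add distrib_right)
        also have "\<dots> \<le> of_nat (12 * n) * F"
          using False by (intro mult_right_mono of_nat_mono) auto
        also have "\<dots> = ennreal (12 * real n) * F"
          by (simp add: ennreal_of_nat_eq_real_of_nat)
        finally have "ennreal (a n) * (P.form (\<lambda>x y. ennreal (p n x y)) f + P.form (\<lambda>x y. ennreal (p (Suc n) x y)) f)
            \<le> ennreal (a n) * (ennreal (12 * real n) * F)" by (intro mult_left_mono) auto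
        also have "\<dots> = ennreal (a n * (12 * real n)) * F"
          using a0 by (simp add: ennreal_mult mult.assoc)
        also have "a n * (12 * real n) = 12 * C0 * g n" using False by (simp add: a_def g_def)
        also have "ennreal (12 * C0 * g n) * F = ennreal (12 * C0) * F * ennreal (g n)"
          using C0 g0 by (subst ennreal_mult) (auto simp: mult_ac)
        finally show ?thesis .
      qed
    qed
    also have "\<dots> = ennreal (12 * C0) * F * usum (\<lambda>n. ennreal (g n))" by (rule usum_cmult)
    also have "\<dots> \<le> ennreal (12 * C0) * F * ennreal Bd"
    proof (intro mult_left_mono usum_nat_le)
      fix N
      have "(\<Sum>n<N. g n) = (\<Sum>n\<in>{1..<N}. b n)"
        by (rule sum.mono_neutral_cong_right) (auto simp: g_def)
      also have "\<dots> \<le> (\<Sum>n\<in>{1..N}. b n)"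
        by (rule sum_mono2) (auto simp: b_pos less_imp_le)
      finally have "(\<Sum>n<N. g n) \<le> Bd" using bd[of N] by (simp add: S_def)
      then show "(\<Sum>n<N. ennreal (g n)) \<le> ennreal Bd"
        using g0 by (subst sum_ennreal) (auto intro: ennreal_leI)
    qed simp
    also have "\<dots> = ennreal (12 * C0 * Bd) * F"
      using C0 Bd by (simp add: ennreal_mult mult_ac)
    finally show "P.form (\<lambda>x y. ennreal (k x y)) f \<le> ennreal (12 * C0 * Bd) * P.form (\<lambda>x y. ennreal (p 1 x y)) f"
      by (simp only: F_def)
  qed
qed

text \<open>The test function is \<open>p\<^sub>n(o, \<cdot>) + p\<^sub>n\<^sub>+\<^sub>1(o, \<cdot>)\<close>: its energy telescopes in \<open>n\<close>, so some
  \<open>n \<in> [N, 2N)\<close> has energy at most \<open>1/N\<close> times the mass.\<close>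

lemma return_lower:
  assumes bd: "\<And>N. S N \<le> Bd"
  obtains c where "c > 0"
    "\<And>T Se. T \<ge> 1 \<Longrightarrow> (\<And>x. ennreal (kn (2 * T) x x) \<le> Se) \<Longrightarrow> ennreal (c / V (rho T)) \<le> Se"
proof -
  obtain C where C: "C > 0" and en: "\<And>f. (\<And>x. f x < top) \<Longrightarrow> P.bil 0 f f < top \<Longrightarrow>
      P.form (\<lambda>x y. ennreal (k x y)) f \<le> ennreal C * P.form (\<lambda>x y. ennreal (p 1 x y)) f"
    using energy_upper[OF bd] by blast
  \<comment> \<open>In units of 1 / V(rho N), \<open>c1\<close> bounds ||f||^2 from below; 8^D is
    the cost of the time 2n < 4N. The next constant L, the ratio N / T, is so large that K loses at
    most half of this in 2T steps.\<close>
  define c1 where "c1 = cl / 8 ^ D"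
  have c1: "c1 > 0" using cl by (simp add: c1_def)
  obtain L :: nat where L: "real L \<ge> max 1 (8 * C * Cu / c1)" using real_arch_simple by blast
  then have L1: "L \<ge> 1" by simp
  \<comment> \<open>8 = 2 * 4: one half of ||f||^2 may be lost, and f has l^1 mass 2, whose square
    is 4. (2 L)^D replaces V(rho N) by V(rho T).\<close>
  define c where "c = c1 / (8 * (2 * real L) ^ D)"
  show thesis
  proof (rule that[of c])
    show "c > 0" using c1 L1 by (simp add: c_def)
    fix T :: nat and Se :: ennreal
    assume T: "T \<ge> 1" and Se: "\<And>x. ennreal (kn (2 * T) x x) \<le> Se"
    define N where "N = L * T"
    have N: "N \<ge> 1" "T \<le> N" using L1 T by (auto simp: N_def)
    define o1 :: 'v where "o1 = undefined"
    define \<pi> where "\<pi> n = p n o1 o1" for n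
    define b' where "b' n = \<pi> (2 * n) + \<pi> (Suc (2 * n))" for n
    have \<pi>0: "\<pi> n \<ge> 0" for n by (simp add: \<pi>_def p_nonneg)
    have pi_le: "\<pi> n \<le> Cu / V (rho N)" if "n \<ge> N" for n
    proof -
      have "\<pi> n \<le> Cu / V (rho n)"
        unfolding \<pi>_def using heat_upper[of n o1 o1] sub_gaussian_le[OF Cu, of n o1 o1] N that by simp
      also have "\<dots> \<le> Cu / V (rho N)" using Cu that by (intro divide_left_mono V_rho_mono) auto
      finally show ?thesis .
    qed
    have b'N: "b' N \<le> 2 * Cu / V (rho N)"
      using pi_le[of "2 * N"] pi_le[of "Suc (2 * N)"] by (simp add: b'_def)
    have "\<exists>n\<in>{N..<N + N}. b' n - b' (Suc n) \<le> b' N / real N"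
    proof (rule ccontr)
      assume "\<not> ?thesis"
      then have "(\<Sum>n\<in>{N..<N + N}. b' N / real N) < (\<Sum>n\<in>{N..<N + N}. b' n - b' (Suc n))"
        using N by (intro sum_strict_mono) (auto simp: not_le)
      also have "(\<Sum>n\<in>{N..<N + M}. b' n - b' (Suc n)) = b' N - b' (N + M)" for M
        by (induction M) auto
      also have "b' N - b' (N + N) \<le> b' N"
        using \<pi>0[of "2 * (N + N)"] \<pi>0[of "Suc (2 * (N + N))"] by (simp add: b'_def)
      finally show False using N by simp
    qed
    then obtain n where n: "N \<le> n" "n < 2 * N" "b' n - b' (Suc n) \<le> b' N / real N" by auto
    define f where "f y = ennreal (p n o1 y) + ennreal (p (Suc n) o1 y)" for y
    \<comment> \<open>\<open>w j\<close> is (f, P^j f). Two consecutive heat kernels are added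
      because (LE) controls only such sums; with this choice \<open>w 0 - w 1\<close> is exactly
      \<open>b' n - b' (Suc n)\<close>.\<close>
    define w where "w j = \<pi> (2 * n + j) + 2 * \<pi> (Suc (2 * n) + j) + \<pi> (Suc (Suc (2 * n)) + j)" for j
    have w0: "w j \<ge> 0" for j using \<pi>0 by (simp add: w_def)
    have bilP: "P.bil j f f = ennreal (w j)" for j
    proof -
      have "P.bil j f f = ennreal (\<pi> (2 * n + j)) + 2 * ennreal (\<pi> (n + Suc n + j)) + ennreal (\<pi> (2 * Suc n + j))"
        unfolding f_def[abs_def] \<pi>_def by (rule P.bil_q_add)
      moreover have "n + Suc n + j = Suc (2 * n) + j" "2 * Suc n + j = Suc (Suc (2 * n)) + j" by simp_all
      moreover have "ennreal (w j) = ennreal (\<pi> (2 * n + j)) + ennreal 2 * ennreal (\<pi> (Suc (2 * n) + j))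
          + ennreal (\<pi> (Suc (Suc (2 * n)) + j))"
        unfolding w_def
        by (simp only: ennreal_plus ennreal_mult add_nonneg_nonneg mult_nonneg_nonneg zero_le_numeral \<pi>0)
      ultimately show ?thesis by (simp only: ennreal_numeral)
    qed
    have fin: "f y < top" for y
      by (simp add: f_def)
    have l2: "P.bil 0 f f < top" "K.bil 0 f f < top" by (simp_all add: bilP bil_0_eq)
    define u where "u j = enn2real (K.bil j f f)" for j
    have u0: "u 0 = w 0" using w0 by (simp add: u_def bil_0_eq bilP)
    have wdiff: "w 0 - w 1 = b' n - b' (Suc n)"
      by (simp add: w_def b'_def)
    have "P.form (\<lambda>x y. ennreal (kn 2 x y)) f \<le> 2 * P.form (\<lambda>x y. ennreal (k x y)) f"
      using K.form_two_le[OF fin l2(2)] by (simp only: form_kn_1)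
    also have "\<dots> \<le> 2 * (ennreal C * P.form (\<lambda>x y. ennreal (p 1 x y)) f)"
      by (intro mult_left_mono en fin l2) simp
    also have "P.form (\<lambda>x y. ennreal (p 1 x y)) f = ennreal (2 * (w 0 - w 1))"
      using P.form_eq(1)[OF fin l2(1), of 1] w0 by (simp add: bilP)
    also note wdiff
    finally have le: "ennreal (2 * (u 0 - u 2)) \<le> 2 * (ennreal C * ennreal (2 * (b' n - b' (Suc n))))"
      using K.form_eq(1)[OF fin l2(2), of 2] by (simp add: u_def)
    have pos: "0 \<le> b' n - b' (Suc n)"
      using P.form_eq(3)[OF fin l2(1), of 1] wdiff by (simp add: bilP w0)
    have "2 * (ennreal C * ennreal (2 * (b' n - b' (Suc n)))) = ennreal (2 * (C * (2 * (b' n - b' (Suc n)))))"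
      using C pos by (simp add: ennreal_mult)
    with le have "2 * (u 0 - u 2) \<le> 2 * (C * (2 * (b' n - b' (Suc n))))"
      using C pos by (simp only: ennreal_le_iff mult_nonneg_nonneg less_imp_le zero_le_numeral)
    then have "u 0 - u 2 \<le> C * (2 * (b' n - b' (Suc n)))" by simp
    also have "\<dots> \<le> C * (2 * (2 * Cu / V (rho N) / real N))"
      using n(3) divide_right_mono[OF b'N, of "real N"] C by (intro mult_left_mono) auto
    finally have u2: "u 0 - u 2 \<le> 4 * C * Cu / V (rho N) / real N" by (simp add: mult_ac)
    \<comment> \<open>Convexity for K: T double steps lose at most T times what the first one
      loses.\<close>
    have "u 0 - u (2 * T) \<le> real T * (u 0 - u 2)"
      using K.bil_even_slope[OF fin l2(2), of 1 T] T by (simp add: u_def)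
    also have "\<dots> \<le> real T * (4 * C * Cu / V (rho N) / real N)"
      using u2 by (intro mult_left_mono) auto
    also have "\<dots> = (4 * C * Cu / real L) / V (rho N)" using T by (simp add: N_def mult_ac)
    also have "\<dots> \<le> (c1 / 2) / V (rho N)"
    proof (rule divide_right_mono)
      have "8 * C * Cu / c1 \<le> real L" using L by simp
      then show "4 * C * Cu / real L \<le> c1 / 2" using c1 L1 by (simp add: field_simps)
    qed (simp add: less_imp_le)
    finally have d1: "u 0 - u (2 * T) \<le> (c1 / 2) / V (rho N)" .
    have "c1 / V (rho N) = cl / (8 ^ D * V (rho N))" by (simp add: c1_def)
    also have "\<dots> \<le> cl / V (rho (2 * n))"
      using V_rho_le[of N "2 * n" 4] N n cl by (intro divide_left_mono) auto
    also have "\<dots> \<le> b' n"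
      using heat_diag_lower[of "2 * n" o1] n N by (simp add: b'_def \<pi>_def)
    also have "\<dots> \<le> w 0" using \<pi>0 by (simp add: b'_def w_def add_nonneg_nonneg)
    finally have d2: "c1 / V (rho N) \<le> u 0" by (simp add: u0)
    have "4 * (c / V (rho T)) = (c1 / 2) / ((2 * real L) ^ D * V (rho T))"
      by (simp add: c_def)
    also have "\<dots> \<le> (c1 / 2) / V (rho N)"
      using V_rho_le[OF T N(2), of "real L"] c1 L1 by (intro divide_left_mono) (auto simp: N_def)
    also have "\<dots> \<le> u (2 * T)" using d1 d2 by (simp add: field_simps)
    finally have "4 * ennreal (c / V (rho T)) \<le> ennreal (u (2 * T))"
      using \<open>c > 0\<close> by (subst ennreal_numeral[symmetric], subst ennreal_mult[symmetric])
        (auto intro!: ennreal_leI divide_nonneg_pos)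
    also have "\<dots> = K.bil (2 * T) f f"
      unfolding u_def by (rule K.form_eq(2)[OF fin l2(2), symmetric])
    also have "\<dots> \<le> Se * (usum (\<lambda>y. f y * ennreal (m y)) * usum (\<lambda>y. f y * ennreal (m y)))"
      by (rule K.bil_le, rule K.q_even_le_diag, rule Se)
    also have "usum (\<lambda>y. f y * ennreal (m y)) = 2"
      by (simp add: f_def distrib_right usum_add P.q_mass)
    finally have "4 * ennreal (c / V (rho T)) \<le> 4 * Se" by (simp add: mult.commute)
    then show "ennreal (c / V (rho T)) \<le> Se" by (simp add: ennreal_mult_le_mult_iff)
  qed
qed

section \<open>The \<gamma>-moment and the partial sums of b\<close>

lemma S_le_moment:
  "\<exists>Q\<ge>0. \<exists>Q0. \<forall>N x. S N \<le> Q0 + Q * (\<Sum>y\<in>graph_ball E x (rho N). d x y powr \<gamma> * k x y * m y)"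
proof -
  \<comment> \<open>Linear growth gives V(\<eta> rho n) \<le> \<eta> R V(rho n). This \<eta> keeps
    the inner ball below half of the guaranteed volume of the outer one, so the annulus retains a
    fixed share of V(rho n).\<close>
  define \<eta> where "\<eta> = min 1 (1 / (2 * Ch\<^sup>2 * R))"
  have \<eta>: "0 < \<eta>" "\<eta> \<le> 1" using Ch R_pos by (auto simp: \<eta>_def)
  define \<epsilon> where "\<epsilon> = \<eta> powr \<gamma>"
  have \<epsilon>: "\<epsilon> > 0" using \<eta> by (simp add: \<epsilon>_def)
  have \<epsilon>\<eta>: "(\<epsilon> * real n) powr (1 / \<gamma>) = \<eta> * rho n" for n
    using \<eta> gamma by (simp add: \<epsilon>_def powr_mult powr_powr rho_def)
  \<comment> \<open>From n0 on the inner radius \<eta> rho n is at least 1, as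
    \<open>V_lower\<close> demands. Each earlier \<open>b n\<close> is at most 1, and together they
    give the additive constant.\<close>
  define n0 where "n0 = nat \<lceil>1 / \<epsilon>\<rceil>"
  have annulus: "V (rho n) \<le> 2 * Ch * (\<Sum>y\<in>{y\<in>graph_ball E x (rho n). \<epsilon> * real n < d x y powr \<gamma>}. m y)"
    if n: "n \<ge> n0" "n \<ge> 1" for n x
  proof -
    define r where "r = \<eta> * rho n"
    have "1 / \<epsilon> \<le> real n" using n by (simp add: n0_def nat_le_iff ceiling_le_iff)
    then have "1 \<le> \<epsilon> * real n" using \<epsilon> by (simp add: field_simps)
    then have r1: "1 \<le> r" unfolding r_def \<epsilon>\<eta>[symmetric] using gamma by (intro ge_one_powr_ge_zero) auto
    have rr: "r \<le> rho n" using \<eta> by (simp add: r_def mult_left_le_one_le)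
    have "(1 / \<eta>) * V r \<le> R * V (rho n)"
      using V_lower[OF r1 rr] \<eta> r1 rho_ge_1[OF n(2)] by (auto simp: r_def split: if_splits)
    then have "V r \<le> \<eta> * R * V (rho n)" using \<eta> by (simp add: field_simps)
    also have "\<dots> \<le> 1 / (2 * Ch\<^sup>2 * R) * R * V (rho n)"
      using R_pos by (intro mult_right_mono) (auto simp: \<eta>_def less_imp_le)
    also have "\<dots> = V (rho n) / (2 * Ch\<^sup>2)" using R_pos by simp
    finally have Vr: "Ch * V r \<le> V (rho n) / (2 * Ch)" using Ch by (simp add: field_simps power2_eq_square)
    have sub: "graph_ball E x (rho n) - graph_ball E x r \<subseteq> {y\<in>graph_ball E x (rho n). \<epsilon> * real n < d x y powr \<gamma>}"
    proof
      fix y assume y: "y \<in> graph_ball E x (rho n) - graph_ball E x r"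
      then have "r < d x y" by (auto simp: graph_ball_def)
      then have "r powr \<gamma> < d x y powr \<gamma>" using gamma r1 by (intro powr_less_mono2) auto
      moreover have "r powr \<gamma> = \<epsilon> * real n"
        using \<eta> by (simp add: r_def powr_mult rho_powr \<epsilon>_def)
      ultimately show "y \<in> {y\<in>graph_ball E x (rho n). \<epsilon> * real n < d x y powr \<gamma>}" using y by simp
    qed
    have "V (rho n) / Ch - V (rho n) / (2 * Ch) \<le> volume E \<mu> x (rho n) - volume E \<mu> x r"
    proof -
      have "inverse Ch * V (rho n) \<le> volume E \<mu> x (rho n)" "volume E \<mu> x r \<le> Ch * V r"
        using r1 rr by (intro vol_lower vol_upper; linarith)+
      moreover have "inverse Ch * V (rho n) = V (rho n) / Ch" by (simp add: divide_inverse)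
      ultimately show ?thesis using Vr by linarith
    qed
    also have "\<dots> = (\<Sum>y\<in>graph_ball E x (rho n) - graph_ball E x r. m y)"
      unfolding volume_def by (rule sum_diff[symmetric]) (use finite_graph_ball rr in \<open>auto simp: graph_ball_def\<close>)
    also have "\<dots> \<le> (\<Sum>y\<in>{y\<in>graph_ball E x (rho n). \<epsilon> * real n < d x y powr \<gamma>}. m y)"
      by (rule sum_mono2[OF _ sub]) (auto simp: finite_graph_ball m_ge_0)
    finally show ?thesis using Ch by (simp add: field_simps)
  qed
  show ?thesis
  proof (rule exI[of _ "2 * Ch * (B / \<epsilon> * Ck)"], intro exI[of _ "real n0"] conjI allI)
    show "0 \<le> 2 * Ch * (B / \<epsilon> * Ck)" using Ch B_pos \<epsilon> Ck by simp
    fix N x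
    define Fin where "Fin = graph_ball E x (rho N)"
    have finF: "finite Fin" by (simp add: Fin_def finite_graph_ball)
    define cond where "cond n y \<longleftrightarrow> d x y \<le> rho n \<and> \<epsilon> * real n < d x y powr \<gamma>" for n y
    have bn: "b n \<le> (if n < n0 then 1 else 0) + 2 * Ch * (\<Sum>y\<in>Fin. if cond n y then m y * (b n / V (rho n)) else 0)"
      if n: "n \<in> {1..N}" for n
    proof (cases "n < n0")
      case True
      have "0 \<le> (\<Sum>y\<in>Fin. if cond n y then m y * (b n / V (rho n)) else 0)"
        by (intro sum_nonneg) (auto simp: m_ge_0 b_pos less_imp_le)
      then have "0 \<le> 2 * Ch * (\<Sum>y\<in>Fin. if cond n y then m y * (b n / V (rho n)) else 0)"
        using Ch by simp
      then show ?thesis using True b_le_1[of n] by simp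
    next
      case False
      have "b n = V (rho n) * (b n / V (rho n))" using V_rho_pos[of n] by simp
      also have "\<dots> \<le> 2 * Ch * (\<Sum>y\<in>{y\<in>graph_ball E x (rho n). \<epsilon> * real n < d x y powr \<gamma>}. m y) * (b n / V (rho n))"
        using False n by (intro mult_right_mono annulus) (auto simp: b_pos less_imp_le)
      also have "{y\<in>graph_ball E x (rho n). \<epsilon> * real n < d x y powr \<gamma>} = {y\<in>Fin. cond n y}"
        using n rho_mono[of n N] by (auto simp: Fin_def cond_def graph_ball_def)
      also have "2 * Ch * (\<Sum>y\<in>{y\<in>Fin. cond n y}. m y) * (b n / V (rho n)) =
          2 * Ch * (\<Sum>y\<in>{y\<in>Fin. cond n y}. m y * (b n / V (rho n)))"
        by (simp only: sum_distrib_right mult.assoc)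
      also have "(\<Sum>y\<in>{y\<in>Fin. cond n y}. m y * (b n / V (rho n))) = (\<Sum>y\<in>Fin. if cond n y then m y * (b n / V (rho n)) else 0)"
        by (rule sum.inter_filter[OF finF])
      finally show ?thesis using False by simp
    qed
    \<comment> \<open>A vertex y is met only at times comparable to d(x, y)^\<gamma>, and
      \<open>annulus_sum_le\<close> bounds their total by the contribution of y to the
      moment.\<close>
    have inner: "(\<Sum>n\<in>{1..N}. if cond n y then m y * (b n / V (rho n)) else 0)
        \<le> B / \<epsilon> * Ck * (d x y powr \<gamma> * k x y * m y)" for y
    proof (cases "x = y")
      case True
      then have "\<not> cond n y" for n using \<epsilon> by (auto simp: cond_def mult_less_0_iff)
      then show ?thesis using B_pos \<epsilon> Ck k_nonneg m_ge_0 by simp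
    next
      case False
      then have d: "d x y \<ge> 1" by (rule dist_ge_1)
      have "(\<Sum>n\<in>{1..N}. if cond n y then m y * (b n / V (rho n)) else 0) =
          (\<Sum>n\<in>{n\<in>{1..N}. cond n y}. m y * (b n / V (rho n)))"
        by (rule sum.inter_filter[symmetric]) simp
      also have "\<dots> = m y * (\<Sum>n\<in>{n\<in>{1..N}. cond n y}. b n / V (rho n))"
        by (simp only: sum_distrib_left)
      also have "\<dots> \<le> m y * (B / \<epsilon> * (d x y powr \<gamma> / (V (d x y) * \<phi> (d x y))))"
        unfolding cond_def using d \<epsilon> by (intro mult_left_mono annulus_sum_le m_ge_0)
      also have "\<dots> = m y * (B / \<epsilon> * (d x y powr \<gamma> * (Ck * (inverse Ck / (V (d x y) * \<phi> (d x y))))))"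
        using Ck by simp
      also have "\<dots> \<le> m y * (B / \<epsilon> * (d x y powr \<gamma> * (Ck * k x y)))"
        using B_pos \<epsilon> Ck by (intro mult_left_mono jump_lower m_ge_0) auto
      finally show ?thesis by (simp add: mult_ac)
    qed
    have "S N \<le> (\<Sum>n\<in>{1..N}. (if n < n0 then 1 else 0) + 2 * Ch * (\<Sum>y\<in>Fin. if cond n y then m y * (b n / V (rho n)) else 0))"
      unfolding S_def by (intro sum_mono bn)
    also have "\<dots> = (\<Sum>n\<in>{1..N}. if n < n0 then 1 else 0) + 2 * Ch * (\<Sum>n\<in>{1..N}. \<Sum>y\<in>Fin. if cond n y then m y * (b n / V (rho n)) else 0)"
      by (simp only: sum.distrib sum_distrib_left)
    also have "(\<Sum>n\<in>{1..N}. if n < n0 then 1 else (0::real)) \<le> real n0"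
    proof -
      have "(\<Sum>n\<in>{1..N}. if n < n0 then 1 else (0::real)) = (\<Sum>n\<in>{n\<in>{1..N}. n < n0}. 1)"
        by (rule sum.inter_filter[symmetric]) simp
      also have "\<dots> \<le> real (card {..<n0})" by (simp, rule card_mono[of "{..<n0}", simplified]) auto
      finally show ?thesis by simp
    qed
    also have "(\<Sum>n\<in>{1..N}. \<Sum>y\<in>Fin. if cond n y then m y * (b n / V (rho n)) else 0) =
        (\<Sum>y\<in>Fin. \<Sum>n\<in>{1..N}. if cond n y then m y * (b n / V (rho n)) else 0)"
      by (rule sum.swap)
    also have "2 * Ch * \<dots> \<le> 2 * Ch * (\<Sum>y\<in>Fin. B / \<epsilon> * Ck * (d x y powr \<gamma> * k x y * m y))"
      using Ch by (intro mult_left_mono sum_mono inner) auto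
    also have "\<dots> = 2 * Ch * (B / \<epsilon> * Ck) * (\<Sum>y\<in>Fin. d x y powr \<gamma> * k x y * m y)"
      by (simp only: sum_distrib_left mult.assoc)
    finally show "S N \<le> real n0 + 2 * Ch * (B / \<epsilon> * Ck) * (\<Sum>y\<in>graph_ball E x (rho N). d x y powr \<gamma> * k x y * m y)"
      by (simp add: Fin_def)
  qed
qed

text \<open>Each y is charged to the times in its shell. After exchanging the sums, time n is
  charged at most by the ball B(x, rho n), whose volume cancels V(rho n) and leaves
  \<open>b n\<close>.\<close>

lemma moment_sum_le:
  assumes bd: "\<And>N. S N \<le> Bd"
  obtains C where "\<And>x F. finite F \<Longrightarrow> (\<Sum>y\<in>F. d x y powr \<gamma> * k x y * m y) \<le> C"
proof
  fix x and F :: "'v set" assume F: "finite F"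
  define G where "G = Ck * 8 ^ (D + D')"
  have G: "G > 0" using Ck by (simp add: G_def)
  have "finite (\<Union>y\<in>F. shell (d x y))" using F by (simp add: shell_def)
  then obtain N where "\<forall>n\<in>(\<Union>y\<in>F. shell (d x y)). n \<le> N"
    unfolding finite_nat_set_iff_bounded_le by blast
  then have N: "(\<Union>y\<in>F. shell (d x y)) \<subseteq> {..N}" by blast
  have summand: "d x y powr \<gamma> * k x y * m y \<le> G * (\<Sum>n\<in>{1..N}. if d x y \<le> rho n then m y * (b n / V (rho n)) else 0)"
    if y: "y \<in> F" for y
  proof (cases "x = y")
    case True
    have "0 \<le> G * (\<Sum>n\<in>{1..N}. if d x y \<le> rho n then m y * (b n / V (rho n)) else 0)"
      using G by (intro mult_nonneg_nonneg sum_nonneg) (auto simp: m_ge_0 b_pos less_imp_le)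
    then show ?thesis using True by simp
  next
    case False
    then have d: "d x y \<ge> 1" by (rule dist_ge_1)
    have "d x y powr \<gamma> * k x y * m y \<le> d x y powr \<gamma> * (Ck / (V (d x y) * \<phi> (d x y))) * m y"
      by (intro mult_left_mono mult_right_mono jump_upper m_ge_0) auto
    also have "\<dots> = Ck * m y * (d x y powr \<gamma> / (V (d x y) * \<phi> (d x y)))" by simp
    also have "\<dots> \<le> Ck * m y * (8 ^ (D + D') * (\<Sum>n\<in>shell (d x y). b n / V (rho n)))"
      using Ck m_ge_0 d by (intro mult_left_mono powr_le_shell_sum) auto
    also have "\<dots> = G * (\<Sum>n\<in>shell (d x y). m y * (b n / V (rho n)))"
      by (simp only: G_def sum_distrib_left mult_ac)
    also have "\<dots> \<le> G * (\<Sum>n\<in>{n\<in>{1..N}. d x y \<le> rho n}. m y * (b n / V (rho n)))"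
    proof (intro mult_left_mono sum_mono2)
      show "shell (d x y) \<subseteq> {n\<in>{1..N}. d x y \<le> rho n}"
        using N y shell(3)[OF d] shell(4)[OF d] by auto
    qed (use G in \<open>auto simp: m_ge_0 b_pos less_imp_le\<close>)
    also have "(\<Sum>n\<in>{n\<in>{1..N}. d x y \<le> rho n}. m y * (b n / V (rho n))) =
        (\<Sum>n\<in>{1..N}. if d x y \<le> rho n then m y * (b n / V (rho n)) else 0)"
      by (rule sum.inter_filter) simp
    finally show ?thesis .
  qed
  have outer: "(\<Sum>y\<in>F. if d x y \<le> rho n then m y * (b n / V (rho n)) else 0) \<le> Ch * b n" if n: "n \<in> {1..N}" for n
  proof -
    have "(\<Sum>y\<in>F. if d x y \<le> rho n then m y * (b n / V (rho n)) else 0) = (\<Sum>y\<in>{y\<in>F. d x y \<le> rho n}. m y * (b n / V (rho n)))"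
      by (rule sum.inter_filter[OF F, symmetric])
    also have "\<dots> \<le> (\<Sum>y\<in>graph_ball E x (rho n). m y * (b n / V (rho n)))"
      by (rule sum_mono2[OF finite_graph_ball]) (auto simp: graph_ball_def m_ge_0 b_pos less_imp_le)
    also have "\<dots> = volume E \<mu> x (rho n) * (b n / V (rho n))"
      by (simp only: volume_def sum_distrib_right)
    also have "\<dots> \<le> (Ch * V (rho n)) * (b n / V (rho n))"
      using rho_ge_1[of n] n by (intro mult_right_mono vol_upper) (auto simp: b_pos less_imp_le)
    also have "\<dots> = Ch * b n" using V_rho_pos[of n] by simp
    finally show ?thesis .
  qed
  have "(\<Sum>y\<in>F. d x y powr \<gamma> * k x y * m y) \<le> (\<Sum>y\<in>F. G * (\<Sum>n\<in>{1..N}. if d x y \<le> rho n then m y * (b n / V (rho n)) else 0))"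
    by (intro sum_mono summand)
  also have "\<dots> = G * (\<Sum>n\<in>{1..N}. \<Sum>y\<in>F. if d x y \<le> rho n then m y * (b n / V (rho n)) else 0)"
    by (subst sum.swap) (simp only: sum_distrib_left)
  also have "\<dots> \<le> G * (\<Sum>n\<in>{1..N}. Ch * b n)"
    using G by (intro mult_left_mono sum_mono outer) auto
  also have "\<dots> = G * (Ch * S N)" by (simp only: S_def sum_distrib_left)
  also have "\<dots> \<le> G * (Ch * Bd)" using G Ch bd by (intro mult_left_mono) auto
  finally show "(\<Sum>y\<in>F. d x y powr \<gamma> * k x y * m y) \<le> Ck * 8 ^ (D + D') * (Ch * Bd)"
    by (simp only: G_def)
qed

lemma moment_finite_iff: "moment E m k \<gamma> < \<infinity> \<longleftrightarrow> (\<exists>Bd. \<forall>N. S N \<le> Bd)"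
proof
  assume fin: "moment E m k \<gamma> < \<infinity>"
  then obtain M where M: "moment E m k \<gamma> = ennreal M" "M \<ge> 0" by (cases "moment E m k \<gamma>") auto
  obtain Q0 Q where Q: "Q \<ge> 0"
    "\<And>N x. S N \<le> Q0 + Q * (\<Sum>y\<in>graph_ball E x (rho N). d x y powr \<gamma> * k x y * m y)"
    using S_le_moment by blast
  have "S N \<le> Q0 + Q * M" for N
  proof -
    \<comment> \<open>One vertex is enough: its moment, truncated to a ball, already controls S
      N.\<close>
    obtain x :: 'v where True by simp
    let ?F = "graph_ball E x (rho N)"
    have nn: "0 \<le> d x y powr \<gamma> * k x y * m y" for y by (simp add: k_nonneg m_ge_0)
    have "ennreal (\<Sum>y\<in>?F. d x y powr \<gamma> * k x y * m y) = (\<Sum>y\<in>?F. ennreal (d x y powr \<gamma> * k x y * m y))"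
      by (rule sum_ennreal[symmetric]) (rule nn)
    also have "\<dots> \<le> (\<Sum>\<^sub>\<infinity>y. ennreal (d x y powr \<gamma> * k x y * m y))"
      by (subst nonneg_infsum_complete) (auto intro!: SUP_upper finite_graph_ball)
    also have "\<dots> \<le> moment E m k \<gamma>" unfolding moment_def by (rule SUP_upper) simp
    finally have "(\<Sum>y\<in>?F. d x y powr \<gamma> * k x y * m y) \<le> M"
      using M by (simp add: ennreal_le_iff)
    then have "Q * (\<Sum>y\<in>?F. d x y powr \<gamma> * k x y * m y) \<le> Q * M" using Q(1) by (rule mult_left_mono)
    then show ?thesis using Q(2)[of N x] by linarith
  qed
  then show "\<exists>Bd. \<forall>N. S N \<le> Bd" by blast
next
  assume "\<exists>Bd. \<forall>N. S N \<le> Bd"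
  then obtain Bd where "\<And>N. S N \<le> Bd" by blast
  then obtain C where C: "\<And>x F. finite F \<Longrightarrow> (\<Sum>y\<in>F. d x y powr \<gamma> * k x y * m y) \<le> C"
    using moment_sum_le by blast
  have "moment E m k \<gamma> \<le> ennreal C"
    unfolding moment_def
  proof (rule SUP_least)
    fix x
    show "(\<Sum>\<^sub>\<infinity>y. ennreal (d x y powr \<gamma> * k x y * m y)) \<le> ennreal C"
    proof (subst nonneg_infsum_complete, simp, rule SUP_least)
      fix F :: "'v set" assume "F \<in> {F. finite F \<and> F \<subseteq> UNIV}"
      then show "(\<Sum>y\<in>F. ennreal (d x y powr \<gamma> * k x y * m y)) \<le> ennreal C"
        by (subst sum_ennreal) (auto simp: k_nonneg m_ge_0 intro!: ennreal_leI C)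
    qed
  qed
  then show "moment E m k \<gamma> < \<infinity>" by (auto simp: top_unique less_top[symmetric])
qed

text \<open>If S is unbounded, \<open>return_small\<close> provides a time at which
  \<open>psi\<close> is at most half of the assumed lower bound. If S is bounded,
  \<open>return_upper\<close> and \<open>return_lower\<close> settle n \<ge> 1.\<close>

lemma psi_two_sided_iff:
  "(\<exists>C>0. \<forall>n::nat. ennreal (inverse C / V (rho n)) \<le> psi m k n \<and> psi m k n \<le> ennreal (C / V (rho n)))
    \<longleftrightarrow> (\<exists>Bd. \<forall>N. S N \<le> Bd)"
proof
  assume "\<exists>C>0. \<forall>n::nat. ennreal (inverse C / V (rho n)) \<le> psi m k n \<and> psi m k n \<le> ennreal (C / V (rho n))"
  then obtain C where C: "C > 0" "\<And>n. ennreal (inverse C / V (rho n)) \<le> psi m k n" by blast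
  show "\<exists>Bd. \<forall>N. S N \<le> Bd"
  proof (rule ccontr)
    assume "\<not> ?thesis"
    then have unb: "\<exists>N. L < S N" for L by (auto simp: not_le)
    have unb: "\<exists>N\<ge>1. S N \<ge> L" for L
    proof -
      obtain N where "L < S N" using unb by blast
      then show ?thesis using S_mono[of N "Suc N"] by (intro exI[of _ "Suc N"]) auto
    qed
    obtain t where t: "t \<ge> 1" "\<And>x. kn (2 * t) x x \<le> (inverse C / 2) / V (rho t)"
      using return_small[OF unb, of "inverse C / 2"] C(1) by auto
    have "psi m k t \<le> ennreal ((inverse C / 2) / V (rho t))"
      unfolding psi_def by (intro SUP_least ennreal_leI t)
    then have "ennreal (inverse C / V (rho t)) \<le> ennreal ((inverse C / 2) / V (rho t))"
      using C(2)[of t] by (rule order_trans[rotated])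
    then have "inverse C / V (rho t) \<le> (inverse C / 2) / V (rho t)"
      using C(1) by (subst (asm) ennreal_le_iff) (auto intro!: divide_nonneg_pos)
    then show False using C(1) V_rho_pos[of t] by (simp add: field_simps)
  qed
next
  assume "\<exists>Bd. \<forall>N. S N \<le> Bd"
  then obtain Bd where Bd: "\<And>N. S N \<le> Bd" by blast
  obtain A where A: "A > 0" "\<And>x t. t \<ge> 1 \<Longrightarrow> kn (2 * t) x x \<le> A / V (rho t)"
    using return_upper by blast
  obtain c where c: "c > 0"
    "\<And>T Se. T \<ge> 1 \<Longrightarrow> (\<And>x. ennreal (kn (2 * T) x x) \<le> Se) \<Longrightarrow> ennreal (c / V (rho T)) \<le> Se"
    using return_lower[OF Bd] by blast
  \<comment> \<open>The second maximum is for n = 0, where \<open>kn 0 x x\<close> = 1 / m x lies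
    between 1/Cm and Cm.\<close>
  define C where "C = max (max A (1 / c)) (max (Cm * V (rho 0)) (Cm / V (rho 0)))"
  have C: "C > 0" "A \<le> C" "1 / c \<le> C" "Cm * V (rho 0) \<le> C" "Cm / V (rho 0) \<le> C"
    using A(1) by (auto simp: C_def)
  have "inverse C \<le> inverse (1 / c)" using C c(1) by (intro le_imp_inverse_le) auto
  then have Cc: "inverse C \<le> c" by simp
  have k0: "kn 0 x x = 1 / m x" for x by (simp add: iter_kernel.simps)
  show "\<exists>C>0. \<forall>n::nat. ennreal (inverse C / V (rho n)) \<le> psi m k n \<and> psi m k n \<le> ennreal (C / V (rho n))"
  proof (intro exI[of _ C] conjI allI C(1))
    fix n :: nat
    have up: "ennreal (kn (2 * n) x x) \<le> psi m k n" for x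
      unfolding psi_def by (rule SUP_upper) simp
    show "ennreal (inverse C / V (rho n)) \<le> psi m k n"
    proof (cases "n = 0")
      case True
      obtain x :: 'v where True by simp
      have "inverse C \<le> inverse (Cm / V (rho 0))" using C Cm by (intro le_imp_inverse_le) auto
      then have "inverse C / V (rho 0) \<le> inverse (Cm / V (rho 0)) / V (rho 0)"
        by (intro divide_right_mono) (auto simp: less_imp_le)
      also have "\<dots> = inverse Cm"
        using less_imp_neq[OF V_rho_pos[of 0], symmetric] by (simp add: inverse_eq_divide)
      also have "\<dots> \<le> 1 / m x"
        using count_upper[of x] m_gt_0[of x] by (simp add: divide_inverse le_imp_inverse_le)
      finally have "ennreal (inverse C / V (rho 0)) \<le> ennreal (kn 0 x x)"
        unfolding k0 by (rule ennreal_leI)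
      also have "\<dots> \<le> psi m k n" using up[of x] True by simp
      finally show ?thesis using True by simp
    next
      case False
      have "ennreal (inverse C / V (rho n)) \<le> ennreal (c / V (rho n))"
        using Cc by (intro ennreal_leI divide_right_mono) (auto simp: less_imp_le)
      also have "\<dots> \<le> psi m k n" using False by (intro c(2) up) auto
      finally show ?thesis .
    qed
    show "psi m k n \<le> ennreal (C / V (rho n))"
      unfolding psi_def
    proof (intro SUP_least ennreal_leI)
      fix x
      show "kn (2 * n) x x \<le> C / V (rho n)"
      proof (cases "n = 0")
        case True
        have "kn (2 * n) x x \<le> Cm" by (rule kn_le_Cm)
        also have "\<dots> \<le> C / V (rho n)" using C True V_rho_pos[of 0] by (simp add: field_simps)
        finally show ?thesis .
      next
        case False
        then have "kn (2 * n) x x \<le> A / V (rho n)" by (intro A) auto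
        also have "\<dots> \<le> C / V (rho n)" using C by (intro divide_right_mono) (auto simp: less_imp_le)
        finally show ?thesis .
      qed
    qed
  qed
qed

end

theorem corollary1p3:
  fixes E :: "'v rel" and \<mu> :: "'v \<Rightarrow> 'v \<Rightarrow> real" and V \<phi> :: "real \<Rightarrow> real"
    and \<gamma> \<beta> :: real and k :: "'v \<Rightarrow> 'v \<Rightarrow> real"
  assumes "weighted_graph E \<mu>"
    and "COUNT E \<mu>"
    and "volume_scale V" and "VD V" and "HOM E \<mu> V"
    and "P0 E \<mu>"
    and "\<gamma> > 1" and "UE E \<mu> V \<gamma>" and "LE E \<mu> V \<gamma>"
    and "continuous_on {0..} \<phi>" and "\<forall>t\<ge>0. \<phi> t \<ge> 1"
    and "\<beta> > 0" and "regularly_varying \<phi> \<beta>"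
    and "symmetric_markov_kernel (vertex_weight E \<mu>) k" and "J_bounds E V \<phi> k"
  shows "moment E (vertex_weight E \<mu>) k \<gamma> < \<infinity> \<longleftrightarrow>
    (\<exists>C>0. \<forall>n::nat.
       ennreal (inverse C / V (real n powr (1 / \<gamma>))) \<le> psi (vertex_weight E \<mu>) k n \<and>
       psi (vertex_weight E \<mu>) k n \<le> ennreal (C / V (real n powr (1 / \<gamma>))))"
proof -
  interpret weighted_graph E \<mu> by fact
  obtain Cm where Cm: "Cm \<ge> 1" "\<And>x. inverse Cm \<le> vertex_weight E \<mu> x" "\<And>x. vertex_weight E \<mu> x \<le> Cm"
    using \<open>COUNT E \<mu>\<close> unfolding COUNT_def by blast
  have m0: "vertex_weight E \<mu> x \<ge> 0" for x
    unfolding vertex_weight_def by (intro sum_nonneg weight_nonneg)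
  have V_pos: "V t > 0" if "0 \<le> t" for t
    using \<open>volume_scale V\<close> that by (simp add: volume_scale_def)
  have V_mono: "V s \<le> V t" if "0 \<le> s" "s \<le> t" for s t
  proof (cases "s = t")
    case False
    then show ?thesis
      using \<open>volume_scale V\<close> that strict_mono_onD[of "{0..}" V s t]
      by (auto simp: volume_scale_def)
  qed simp
  obtain Cd where Cd: "Cd > 1" "\<And>r. r > 0 \<Longrightarrow> V (2 * r) \<le> Cd * V r"
    using \<open>VD V\<close> unfolding VD_def by blast
  obtain D :: nat where D: "\<And>s t. 1 \<le> t \<Longrightarrow> t \<le> s \<Longrightarrow> V s \<le> (2 * s / t) ^ D * V t"
  proof (rule doubling_polynomial[of V Cd])
    show "V s \<le> Cd * V t" if "1 \<le> t" "t \<le> s" "s \<le> 2 * t" for s t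
      using V_mono[of s "2 * t"] Cd(2)[of t] that by simp
  qed (use V_pos in auto)
  obtain Ch where Ch: "Ch > 1" "\<And>x r. r > 0 \<Longrightarrow> inverse Ch * V r \<le> volume E \<mu> x r \<and> volume E \<mu> x r \<le> Ch * V r"
    using \<open>HOM E \<mu> V\<close> unfolding HOM_def by blast
  have rev: "s / t * V t \<le> 8 * Ch\<^sup>2 * V s" if "1 \<le> t" "t \<le> s" for s t
    using m0 Ch V_mono V_pos that by (rule reverse_volume_doubling)
  obtain A where A: "A \<ge> 1"
    "\<And>s t. 1 \<le> t \<Longrightarrow> t \<le> s \<Longrightarrow> s \<le> 2 * t \<Longrightarrow> \<phi> s \<le> A * \<phi> t \<and> \<phi> t \<le> A * \<phi> s"
    using regularly_varying_comparable[OF assms(10,11,13,12)] by blast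
  obtain D' :: nat where D': "\<And>s t. 1 \<le> t \<Longrightarrow> t \<le> s \<Longrightarrow> \<phi> s \<le> (2 * s / t) ^ D' * \<phi> t"
  proof (rule doubling_polynomial[of \<phi> A])
    show "\<phi> t > 0" if "t \<ge> 1" for t using assms(11) that by (smt (verit))
  qed (use A in auto)
  obtain B where B: "B > 0" "\<And>s t. 1 \<le> t \<Longrightarrow> t \<le> s \<Longrightarrow> (s / t) powr (\<beta> / 2) * \<phi> t \<le> B * \<phi> s"
    using regularly_varying_potter_lower[OF assms(10,11,13,12)] by blast
  obtain Cu where Cu: "Cu > 0" "\<And>x y n. n \<ge> 1 \<Longrightarrow> heat_kernel E \<mu> n x y \<le> sub_gaussian E V \<gamma> Cu n x y"
    using \<open>UE E \<mu> V \<gamma>\<close> unfolding UE_def by blast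
  obtain cl where cl: "cl > 0" "\<And>x y n. n \<ge> 1 \<Longrightarrow> graph_dist E x y \<le> n \<Longrightarrow>
      sub_gaussian E V \<gamma> cl n x y \<le> heat_kernel E \<mu> n x y + heat_kernel E \<mu> (Suc n) x y"
    using \<open>LE E \<mu> V \<gamma>\<close> unfolding LE_def by auto
  obtain Ck where Ck: "Ck > 0"
    "\<And>x y. inverse Ck / (V (graph_dist E x y) * \<phi> (graph_dist E x y)) \<le> k x y"
    "\<And>x y. k x y \<le> Ck / (V (graph_dist E x y) * \<phi> (graph_dist E x y))"
    using \<open>J_bounds E V \<phi> k\<close> unfolding J_bounds_def by blast
  interpret long_range_walk E \<mu> V \<phi> \<gamma> "\<beta> / 2" "8 * Ch\<^sup>2" B D D' k Cm Ch Cu cl Ck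
  proof
    show "8 * Ch\<^sup>2 > 0" using Ch by simp
  qed (use assms V_pos V_mono D rev D' B Cm Ch Cu cl Ck in auto)
  show ?thesis
    using moment_finite_iff psi_two_sided_iff unfolding rho_def by blast
qed

end
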